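(* The Suzuki groups $G={}^2B_2(q^2)$ with $q^2=2^{2f+1}\ge 8$ do not satisfy property $(I_2)$.
   Context: For a prime $p$, let $k$ be an algebraically closed field of characteristic $p$. For a finite group $G$, let $\Phi_{1_G}$ be the projective cover of the trivial $kG$-module $k$. For a subgroup $H\le G$, $G$ has property $(I_p)$ with respect to $H$ if $\Phi_{1_G}\cong \mathrm{Ind}_H^G(k)$, the permutation $kG$-module on the cosets of $H$. $G$ has (satisfies) property $(I_p)$ if it has property $(I_p)$ with respect to some subgroup $H\le G$. ${}^2B_2(q^2)$ is the Suzuki group over the field with $q^2$ elements, of order $q^4(q^2-1)(q^4+1)$. *)

theory Defs
  imports
    "HOL-Algebra.Algebra"
    "HOL-Algebra.Algebraic_Closure_Type"
    "HOL-Algebra.Left_Coset"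
    "Jordan_Normal_Form.Determinant"
begin

section \<open>Modules for a group over a field\<close>

text \<open>
  A \<open>kG\<close>-module is given as a vector space over the type \<open>'k\<close> together with a linear action of
  the group \<open>G\<close>. Of the record of \<open>G\<close>-modules only \<open>carrier\<close>, \<open>zero\<close>, \<open>add\<close>, \<open>smult\<close> and \<open>gact\<close> are
  meaningful; the multiplicative fields are inherited from \<^theory>\<open>HOL-Algebra.Module\<close> and are
  never used.
\<close>

record ('k, 'm, 'g) gmodule = "('k, 'm) module" +
  gact :: "'g \<Rightarrow> 'm \<Rightarrow> 'm"

locale kG_module = group G + module ring_of_type_algebra M
  for G :: "('g, 'b) monoid_scheme" and M :: "('k::field, 'm, 'g) gmodule" +
  assumes gact_closed: "g \<in> carrier G \<Longrightarrow> x \<in> carrier M \<Longrightarrow> gact M g x \<in> carrier M"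
    and gact_add: "g \<in> carrier G \<Longrightarrow> x \<in> carrier M \<Longrightarrow> y \<in> carrier M \<Longrightarrow>
      gact M g (x \<oplus>\<^bsub>M\<^esub> y) = gact M g x \<oplus>\<^bsub>M\<^esub> gact M g y"
    and gact_smult: "g \<in> carrier G \<Longrightarrow> x \<in> carrier M \<Longrightarrow>
      gact M g (c \<odot>\<^bsub>M\<^esub> x) = c \<odot>\<^bsub>M\<^esub> gact M g x"
    and gact_one: "x \<in> carrier M \<Longrightarrow> gact M \<one>\<^bsub>G\<^esub> x = x"
    and gact_mult: "g \<in> carrier G \<Longrightarrow> h \<in> carrier G \<Longrightarrow> x \<in> carrier M \<Longrightarrow>
      gact M (g \<otimes>\<^bsub>G\<^esub> h) x = gact M g (gact M h x)"

definition kG_submodule ::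
    "('g, 'b) monoid_scheme \<Rightarrow> 'm set \<Rightarrow> ('k::field, 'm, 'g) gmodule \<Rightarrow> bool" where
  "kG_submodule G N M \<longleftrightarrow>
     submodule N ring_of_type_algebra M \<and> (\<forall>g\<in>carrier G. \<forall>x\<in>N. gact M g x \<in> N)"

definition kG_hom ::
    "('g, 'b) monoid_scheme \<Rightarrow> ('k::field, 'm, 'g) gmodule \<Rightarrow> ('k, 'n, 'g) gmodule \<Rightarrow> ('m \<Rightarrow> 'n) set"
  where
  "kG_hom G M N = {f. f \<in> carrier M \<rightarrow> carrier N \<and>
     (\<forall>x\<in>carrier M. \<forall>y\<in>carrier M. f (x \<oplus>\<^bsub>M\<^esub> y) = f x \<oplus>\<^bsub>N\<^esub> f y) \<and>
     (\<forall>c. \<forall>x\<in>carrier M. f (c \<odot>\<^bsub>M\<^esub> x) = c \<odot>\<^bsub>N\<^esub> f x) \<and>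
     (\<forall>g\<in>carrier G. \<forall>x\<in>carrier M. f (gact M g x) = gact N g (f x))}"

definition kG_iso ::
    "('g, 'b) monoid_scheme \<Rightarrow> ('k::field, 'm, 'g) gmodule \<Rightarrow> ('k, 'n, 'g) gmodule \<Rightarrow> bool" where
  "kG_iso G M N \<longleftrightarrow> (\<exists>f\<in>kG_hom G M N. bij_betw f (carrier M) (carrier N))"

text \<open>
  The lifting property is tested on all \<open>kG\<close>-modules \<open>A\<close>, \<open>B\<close> whose elements are sequences over
  \<open>'k\<close>, since one cannot quantify over types. For finite \<open>G\<close>, every finite-dimensional module has
  an isomorphic copy of this kind (take coordinates and pad with zeros). So for finitely generated
  \<open>P\<close> this is ordinary projectivity: lifting the identity of (a copy of) \<open>P\<close> along some surjection
  from \<open>(kG)\<^sup>n\<close> already makes \<open>P\<close> a direct summand of \<open>(kG)\<^sup>n\<close>.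
\<close>

definition kG_projective :: "('g, 'b) monoid_scheme \<Rightarrow> ('k::field, 'm, 'g) gmodule \<Rightarrow> bool" where
  "kG_projective G P \<longleftrightarrow>
     (\<forall>(A :: ('k, nat \<Rightarrow> 'k, 'g) gmodule) (B :: ('k, nat \<Rightarrow> 'k, 'g) gmodule).
        kG_module G A \<longrightarrow> kG_module G B \<longrightarrow>
        (\<forall>p\<in>kG_hom G A B. \<forall>f\<in>kG_hom G P B. p ` carrier A = carrier B \<longrightarrow>
           (\<exists>h\<in>kG_hom G P A. \<forall>x\<in>carrier P. p (h x) = f x)))"

text \<open>
  A projective cover of \<open>M\<close> is a projective module with an essential epimorphism onto \<open>M\<close>: one
  that maps no proper submodule onto \<open>M\<close>. A projective cover of a cyclic module is itself cyclic,
  so for such \<open>M\<close> (in particular the trivial module) \<^const>\<open>kG_projective\<close> is used only in the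
  range in which it is ordinary projectivity.
\<close>

definition projective_cover ::
    "('g, 'b) monoid_scheme \<Rightarrow> ('k::field, 'p, 'g) gmodule \<Rightarrow> ('k, 'm, 'g) gmodule \<Rightarrow> bool" where
  "projective_cover G P M \<longleftrightarrow> kG_module G P \<and> kG_projective G P \<and>
     (\<exists>p\<in>kG_hom G P M. p ` carrier P = carrier M \<and>
        (\<forall>N. kG_submodule G N P \<longrightarrow> p ` N = carrier M \<longrightarrow> N = carrier P))"

definition trivial_gmodule :: "('k::field, 'k, 'g) gmodule" where
  "trivial_gmodule = \<lparr>carrier = UNIV, monoid.mult = (*), one = 1, ring.zero = 0, add = (+),
     module.smult = (*), gact = (\<lambda>g x. x)\<rparr>"

text \<open>
  For a subgroup \<open>H\<close> of finite index, the module induced from the trivial \<open>kH\<close>-module is the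
  permutation module on the left cosets of \<open>H\<close>. The vector \<open>f\<close> stands for the formal sum of the
  \<open>f C \<cdot> C\<close> over the cosets \<open>C\<close>; as \<open>g\<close> maps \<open>C\<close> to \<open>gC\<close>, the coefficient of \<open>C\<close> in \<open>g f\<close> is
  that of \<open>g\<inverse>C\<close> in \<open>f\<close>.
\<close>

definition perm_gmodule ::
    "('g, 'b) monoid_scheme \<Rightarrow> 'g set \<Rightarrow> ('k::field, 'g set \<Rightarrow> 'k, 'g) gmodule" where
  "perm_gmodule G H = \<lparr>carrier = {f. \<forall>C. C \<notin> lcosets\<^bsub>G\<^esub> H \<longrightarrow> f C = 0},
     monoid.mult = (\<lambda>f f' C. f C * f' C), one = (\<lambda>C. of_bool (C \<in> lcosets\<^bsub>G\<^esub> H)),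
     ring.zero = (\<lambda>C. 0), add = (\<lambda>f f' C. f C + f' C),
     module.smult = (\<lambda>c f C. c * f C),
     gact = (\<lambda>g f C. if C \<in> lcosets\<^bsub>G\<^esub> H then f (inv\<^bsub>G\<^esub> g <#\<^bsub>G\<^esub> C) else 0)\<rparr>"


section \<open>Property \<open>(I\<^sub>p)\<close>\<close>

text \<open>
  Here \<open>p\<close> is the characteristic of \<open>'k\<close>, which is meant to be an algebraically closed field. The
  projective cover of the trivial module is finite-dimensional and unique up to isomorphism, so it
  may be taken to be some projective cover on sequences over \<open>'k\<close>.
\<close>

definition property_I_wrt ::
    "'k::field itself \<Rightarrow> ('g, 'b) monoid_scheme \<Rightarrow> 'g set \<Rightarrow> bool" where
  "property_I_wrt K G H \<longleftrightarrow>
     (\<exists>\<Phi> :: ('k, nat \<Rightarrow> 'k, 'g) gmodule.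
        projective_cover G \<Phi> (trivial_gmodule :: ('k, 'k, 'g) gmodule) \<and>
        kG_iso G \<Phi> (perm_gmodule G H))"

definition property_I :: "'k::field itself \<Rightarrow> ('g, 'b) monoid_scheme \<Rightarrow> bool" where
  "property_I K G \<longleftrightarrow> (\<exists>H. subgroup H G \<and> property_I_wrt K G H)"


section \<open>Suzuki groups\<close>

text \<open>
  The Suzuki group over the field \<open>F\<close> with \<open>2\<^bsup>2f+1\<^esup>\<close> elements, as Suzuki's subgroup of \<open>GL\<^sub>4(F)\<close>. It
  is generated by a Sylow 2-subgroup of matrices \<open>S(a,b)\<close>, a split torus \<open>M(t)\<close> and an involution;
  \<open>\<theta>\<close> is the automorphism of \<open>F\<close> whose square is the Frobenius map \<open>x \<mapsto> x\<^sup>2\<close>.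
\<close>

definition GL4 :: "'q::field itself \<Rightarrow> 'q mat monoid" where
  "GL4 F = units_of (ring_mat F 4 ())"

definition suzuki_theta :: "nat \<Rightarrow> 'q::field \<Rightarrow> 'q" where
  "suzuki_theta f x = x ^ (2 ^ (f + 1))"

definition suzuki_S :: "nat \<Rightarrow> 'q::field \<Rightarrow> 'q \<Rightarrow> 'q mat" where
  "suzuki_S f a b = (let \<theta> = suzuki_theta f in mat_of_rows_list 4
     [[1, 0, 0, 0],
      [a, 1, 0, 0],
      [b, \<theta> a, 1, 0],
      [a ^ 2 * \<theta> a + a * b + \<theta> b, a * \<theta> a + b, a, 1]])"

definition suzuki_M :: "nat \<Rightarrow> 'q::field \<Rightarrow> 'q mat" where
  "suzuki_M f t = mat_of_rows_list 4
     [[t ^ (1 + 2 ^ f), 0, 0, 0],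
      [0, t ^ (2 ^ f), 0, 0],
      [0, 0, inverse t ^ (2 ^ f), 0],
      [0, 0, 0, inverse t ^ (1 + 2 ^ f)]]"

definition suzuki_T :: "'q::field mat" where
  "suzuki_T = mat_of_rows_list 4
     [[0, 0, 0, 1],
      [0, 0, 1, 0],
      [0, 1, 0, 0],
      [1, 0, 0, 0]]"

definition suzuki_group :: "nat \<Rightarrow> 'q::field itself \<Rightarrow> 'q mat monoid" where
  "suzuki_group f F = (GL4 F)\<lparr>carrier := generate (GL4 F)
     ({suzuki_S f a b | a b. True} \<union> {suzuki_M f t | t. t \<noteq> 0} \<union> {suzuki_T})\<rparr>"


section \<open>Well-formedness of the definitions\<close>

lemma group_GL4: "group (GL4 (F :: 'q::field itself))"
proof -
  interpret ring "ring_mat F 4 ()"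
    using ring_mat[where 'a = 'q and n = 4 and b = "()"] by (simp add: ring_mat_def)
  show ?thesis
    unfolding GL4_def by (rule units_group)
qed

lemma suzuki_generators_in_GL4:
  "suzuki_S f a b \<in> carrier (GL4 (F :: 'q::field itself))"
  "t \<noteq> 0 \<Longrightarrow> suzuki_M f t \<in> carrier (GL4 F)"
  "suzuki_T \<in> carrier (GL4 F)"
proof -
  have unit: "A \<in> carrier (GL4 F)" if "A \<in> carrier_mat 4 4" "det A \<noteq> 0" for A :: "'q mat"
    using det_non_zero_imp_unit[OF that, where b = "()"]
    by (simp add: GL4_def units_of_def ring_mat_def)
  show "suzuki_S f a b \<in> carrier (GL4 F)"
  proof (rule unit)
    show S: "suzuki_S f a b \<in> carrier_mat 4 4"
      by (rule carrier_matI) (simp_all add: suzuki_S_def Let_def mat_of_rows_list_def)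
    have "det (suzuki_S f a b) = prod_list (diag_mat (suzuki_S f a b))"
      by (rule det_lower_triangular[OF _ S])
        (auto simp: suzuki_S_def Let_def mat_of_rows_list_def less_Suc_eq numeral_eq_Suc)
    then show "det (suzuki_S f a b) \<noteq> 0"
      by (simp add: suzuki_S_def Let_def mat_of_rows_list_def diag_mat_def numeral_eq_Suc)
  qed
  show "suzuki_M f t \<in> carrier (GL4 F)" if "t \<noteq> 0"
  proof (rule unit)
    show M: "suzuki_M f t \<in> carrier_mat 4 4"
      by (rule carrier_matI) (simp_all add: suzuki_M_def mat_of_rows_list_def)
    have "det (suzuki_M f t) = prod_list (diag_mat (suzuki_M f t))"
      by (rule det_lower_triangular[OF _ M])
        (auto simp: suzuki_M_def mat_of_rows_list_def less_Suc_eq numeral_eq_Suc)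
    then show "det (suzuki_M f t) \<noteq> 0"
      using that by (simp add: suzuki_M_def mat_of_rows_list_def diag_mat_def numeral_eq_Suc)
  qed
  have T: "(suzuki_T :: 'q mat) \<in> carrier_mat 4 4"
    by (rule carrier_matI) (simp_all add: suzuki_T_def mat_of_rows_list_def)
  have "(suzuki_T :: 'q mat) * suzuki_T = 1\<^sub>m 4"
    by (rule eq_matI)
      (auto simp: suzuki_T_def mat_of_rows_list_def scalar_prod_def less_Suc_eq numeral_eq_Suc)
  then have "det (suzuki_T :: 'q mat) * det (suzuki_T :: 'q mat) = 1"
    using det_mult[OF T T] by simp
  then show "suzuki_T \<in> carrier (GL4 F)"
    using unit[OF T] by fastforce
qed

lemma group_suzuki_group: "group (suzuki_group f (F :: 'q::field itself))"
  unfolding suzuki_group_def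
  by (rule subgroup.subgroup_is_group[OF group.generate_is_subgroup group_GL4])
    (auto simp: group_GL4 suzuki_generators_in_GL4)

lemma kG_module_trivial_gmodule:
  assumes "group G"
  shows "kG_module G (trivial_gmodule :: ('k::field, 'k, 'g) gmodule)"
proof -
  have "abelian_group (trivial_gmodule :: ('k, 'k, 'g) gmodule)"
  proof (rule abelian_groupI)
    show "\<exists>y\<in>carrier trivial_gmodule. y \<oplus>\<^bsub>trivial_gmodule\<^esub> x = \<zero>\<^bsub>trivial_gmodule\<^esub>"
      for x :: 'k by (rule bexI[of _ "- x"]) (auto simp: trivial_gmodule_def)
  qed (auto simp: trivial_gmodule_def)
  then have "module ring_of_type_algebra (trivial_gmodule :: ('k, 'k, 'g) gmodule)"
    by (intro moduleI cring_from_type_algebra)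
      (auto simp: trivial_gmodule_def ring_of_type_algebra_def algebra_simps)
  with assms show ?thesis
    by (intro kG_module.intro kG_module_axioms.intro) (auto simp: trivial_gmodule_def)
qed

lemma kG_module_perm_gmodule:
  fixes G (structure)
  assumes "subgroup H G" "group G"
  shows "kG_module G (perm_gmodule G H :: ('k::field, 'g set \<Rightarrow> 'k, 'g) gmodule)"
    (is "kG_module G ?M")
proof -
  interpret group G by (fact assms)
  interpret H: subgroup H G by (fact assms)
  have "abelian_group ?M"
  proof (rule abelian_groupI)
    show "\<exists>y\<in>carrier ?M. y \<oplus>\<^bsub>?M\<^esub> x = \<zero>\<^bsub>?M\<^esub>" if "x \<in> carrier ?M" for x
      using that by (intro bexI[of _ "\<lambda>C. - x C"]) (auto simp: perm_gmodule_def)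
  qed (auto simp: perm_gmodule_def algebra_simps)
  then have "module ring_of_type_algebra ?M"
    by (intro moduleI cring_from_type_algebra)
      (auto simp: perm_gmodule_def ring_of_type_algebra_def algebra_simps)
  moreover have sub: "C \<subseteq> carrier G" if "C \<in> lcosets H" for C
    using that l_coset_subset_G[OF H.subset] by (auto simp: LCOSETS_def)
  moreover have closed: "g <# C \<in> lcosets H" if "C \<in> lcosets H" "g \<in> carrier G" for C g
    using that by (auto simp: LCOSETS_def lcos_m_assoc[OF H.subset])
  moreover have one: "\<one> <# C = C" if "C \<in> lcosets H" for C
    using lcos_mult_one[OF sub[OF that]] .
  moreover have mult: "inv (g \<otimes> h) <# C = inv h <# (inv g <# C)"
    if "C \<in> lcosets H" "g \<in> carrier G" "h \<in> carrier G" for C g h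
    using that lcos_m_assoc[OF sub[OF that(1)]] by (simp add: inv_mult_group)
  ultimately show ?thesis
    by (intro kG_module.intro kG_module_axioms.intro)
      (auto simp: perm_gmodule_def fun_eq_iff group_axioms)
qed

end

theory Submission
  imports Defs "Jordan_Normal_Form.Char_Poly"
begin

text \<open>
  Let \<open>q\<close> be the number of elements of the field, \<open>\<theta>\<close> the
  automorphism whose square is the Frobenius map, and \<open>G\<close> the Suzuki group. By the
  Bruhat decomposition, the \<open>G\<close>-orbit of a coordinate line of
  \<open>F\<^sup>4\<close> is the Suzuki-Tits ovoid: it has \<open>q\<^sup>2 + 1\<close> points,
  and the Sylow 2-subgroup \<open>U\<close> of the matrices \<open>S a b\<close> fixes one point
  and is regular on the others. Suppose that \<open>k[G/H]\<close> is the projective cover of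
  the trivial module, over a field \<open>k\<close> of characteristic 2. Three consequences
  contradict each other.

  The order of \<open>H\<close> is odd (\<open>property_I_wrt_imp_card_nonzero\<close>). By
  projectivity, the map from \<open>k[G/H]\<close> onto \<open>k\<close> lifts along the
  augmentation \<open>kG \<rightarrow> k\<close>. The base coset goes to an
  \<open>H\<close>-invariant element of \<open>kG\<close>, in which the sum of the coefficients
  is a multiple of \<open>card H\<close>; but this sum is not zero.

  The group \<open>H\<close> is transitive on the ovoid
  (\<open>property_I_wrt_imp_transitive\<close>). All simple quotients of \<open>k[G/H]\<close>
  are trivial. If \<open>H\<close> were intransitive, some nonzero function on the ovoid with
  sum zero would be fixed by \<open>H\<close>, and would generate a quotient of
  \<open>k[G/H]\<close>. The functions with sum zero form the Steinberg module, which is simple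
  and not trivial.

  A subgroup of odd order has at most \<open>4q\<close> elements
  (\<open>odd_subgroup_card\<close>). Every element of \<open>G\<close> has a characteristic
  polynomial \<open>x\<^sup>4 + \<tau> x\<^sup>3 + \<theta>(\<tau>) x\<^sup>2 + \<tau> x +
  1\<close> with \<open>\<tau>\<close> in the field (\<open>char_poly_suzuki\<close>), so a
  nontrivial element of odd order has four distinct eigenvalues in the algebraic closure, and 1
  is not one of them. In a subgroup of odd order, two elements with a common eigenvector
  therefore commute, because their commutator has the eigenvalue 1. This makes commuting
  transitive on the nontrivial elements. Moreover, if \<open>x\<close> commutes with its
  conjugate by \<open>c\<close>, then \<open>c\<close> permutes the four eigenlines of
  \<open>x\<close>; as \<open>c\<close> has odd order, it fixes one of them and so commutes with
  \<open>x\<close>. Counting conjugates of a centralizer, one finds that the subgroup is abelian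
  (\<open>commutative_if_centralizers_abelian_self_normalizing\<close>). It then has a common
  eigenvector, and the eigenvalue determines the element. The eigenvalues are roots of
  \<open>q\<close> polynomials of degree 4.

  Finally \<open>4q < q\<^sup>2 + 1\<close>, so a group of order at most \<open>4q\<close> is
  not transitive on \<open>q\<^sup>2 + 1\<close> points.
\<close>

no_notation fps_nth (infixl "$" 75)

section \<open>The permutation module as projective cover of the trivial module\<close>

lemma kG_submoduleI:
  fixes M :: "('k::field, 'm, 'g) gmodule"
  assumes "kG_module G M" "N \<subseteq> carrier M" "N \<noteq> {}"
    and add: "\<And>x y. x \<in> N \<Longrightarrow> y \<in> N \<Longrightarrow> x \<oplus>\<^bsub>M\<^esub> y \<in> N"
    and smult: "\<And>c x. x \<in> N \<Longrightarrow> c \<odot>\<^bsub>M\<^esub> x \<in> N"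
    and gact: "\<And>g x. g \<in> carrier G \<Longrightarrow> x \<in> N \<Longrightarrow> gact M g x \<in> N"
  shows "kG_submodule G N M"
proof -
  interpret kG_module G M by fact
  have one: "\<one>\<^bsub>ring_of_type_algebra\<^esub> \<in> carrier (ring_of_type_algebra :: 'k ring)"
    by (simp add: ring_of_type_algebra_def)
  have neg: "\<ominus>\<^bsub>M\<^esub> x \<in> N" if "x \<in> N" for x
  proof -
    have "\<ominus>\<^bsub>M\<^esub> x = (\<ominus>\<^bsub>ring_of_type_algebra\<^esub> \<one>\<^bsub>ring_of_type_algebra\<^esub>) \<odot>\<^bsub>M\<^esub> x"
      using that assms(2) smult_l_minus[OF one, of x] by auto
    then show ?thesis using smult[OF that] by metis
  qed
  obtain x where x: "x \<in> N" using assms(3) by blast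
  have "\<zero>\<^bsub>M\<^esub> = x \<oplus>\<^bsub>M\<^esub> \<ominus>\<^bsub>M\<^esub> x" using x assms(2) M.r_neg by auto
  then have zero: "\<zero>\<^bsub>M\<^esub> \<in> N" using add[OF x neg[OF x]] by simp
  have "submodule N ring_of_type_algebra M"
    by (rule submoduleI) (use assms(2) zero neg add smult in auto)
  with gact show ?thesis by (simp add: kG_submodule_def)
qed

lemma kG_submoduleD:
  fixes M :: "('k::field, 'm, 'g) gmodule"
  assumes "kG_module G M" "kG_submodule G N M"
  shows "N \<subseteq> carrier M" "x \<in> N \<Longrightarrow> y \<in> N \<Longrightarrow> x \<oplus>\<^bsub>M\<^esub> y \<in> N" "x \<in> N \<Longrightarrow> c \<odot>\<^bsub>M\<^esub> x \<in> N"
    "g \<in> carrier G \<Longrightarrow> x \<in> N \<Longrightarrow> gact M g x \<in> N"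
proof -
  interpret kG_module G M by fact
  have N: "submodule N ring_of_type_algebra M" using assms(2) by (simp add: kG_submodule_def)
  show "N \<subseteq> carrier M" "x \<in> N \<Longrightarrow> y \<in> N \<Longrightarrow> x \<oplus>\<^bsub>M\<^esub> y \<in> N" using submoduleE[OF N] by auto
  show "x \<in> N \<Longrightarrow> c \<odot>\<^bsub>M\<^esub> x \<in> N"
    by (rule submoduleE(4)[OF N]) (simp_all add: ring_of_type_algebra_def)
  show "g \<in> carrier G \<Longrightarrow> x \<in> N \<Longrightarrow> gact M g x \<in> N" using assms(2) by (simp add: kG_submodule_def)
qed

lemma kG_homD:
  assumes "h \<in> kG_hom G M N" "x \<in> carrier M"
  shows "h x \<in> carrier N" "y \<in> carrier M \<Longrightarrow> h (x \<oplus>\<^bsub>M\<^esub> y) = h x \<oplus>\<^bsub>N\<^esub> h y"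
    "h (c \<odot>\<^bsub>M\<^esub> x) = c \<odot>\<^bsub>N\<^esub> h x" "g \<in> carrier G \<Longrightarrow> h (gact M g x) = gact N g (h x)"
  using assms by (auto simp: kG_hom_def)

lemma kG_homI:
  assumes "\<And>x. x \<in> carrier M \<Longrightarrow> h x \<in> carrier N"
    "\<And>x y. x \<in> carrier M \<Longrightarrow> y \<in> carrier M \<Longrightarrow> h (x \<oplus>\<^bsub>M\<^esub> y) = h x \<oplus>\<^bsub>N\<^esub> h y"
    "\<And>c x. x \<in> carrier M \<Longrightarrow> h (c \<odot>\<^bsub>M\<^esub> x) = c \<odot>\<^bsub>N\<^esub> h x"
    "\<And>g x. g \<in> carrier G \<Longrightarrow> x \<in> carrier M \<Longrightarrow> h (gact M g x) = gact N g (h x)"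
  shows "h \<in> kG_hom G M N"
  using assms by (auto simp: kG_hom_def)

lemma kG_module_closed:
  assumes "kG_module G M" "x \<in> carrier M"
  shows "y \<in> carrier M \<Longrightarrow> x \<oplus>\<^bsub>M\<^esub> y \<in> carrier M" "c \<odot>\<^bsub>M\<^esub> x \<in> carrier M"
    "g \<in> carrier G \<Longrightarrow> gact M g x \<in> carrier M"
proof -
  interpret kG_module G M by fact
  show "y \<in> carrier M \<Longrightarrow> x \<oplus>\<^bsub>M\<^esub> y \<in> carrier M" using assms(2) by simp
  show "c \<odot>\<^bsub>M\<^esub> x \<in> carrier M"
    by (rule smult_closed) (use assms(2) in \<open>simp_all add: ring_of_type_algebra_def\<close>)
  show "g \<in> carrier G \<Longrightarrow> gact M g x \<in> carrier M" using assms(2) gact_closed by simp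
qed

lemma kG_hom_inverse:
  assumes "kG_module G M" "h \<in> kG_hom G M N" "bij_betw h (carrier M) (carrier N)"
  shows "inv_into (carrier M) h \<in> kG_hom G N M"
proof (rule kG_homI)
  let ?k = "inv_into (carrier M) h"
  have k: "?k x \<in> carrier M" "h (?k x) = x" if "x \<in> carrier N" for x
    using that assms(3) by (auto simp: bij_betw_def inv_into_into f_inv_into_f)
  have eq: "?k y = x" if "x \<in> carrier M" "h x = y" for x y
    using that assms(3) by (auto simp: bij_betw_def)
  show "?k x \<in> carrier M" if "x \<in> carrier N" for x using k that by blast
  show "?k (x \<oplus>\<^bsub>N\<^esub> y) = ?k x \<oplus>\<^bsub>M\<^esub> ?k y" if "x \<in> carrier N" "y \<in> carrier N" for x y
    using that k by (intro eq kG_module_closed(1)[OF assms(1)]) (simp_all add: kG_homD(2)[OF assms(2)])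
  show "?k (c \<odot>\<^bsub>N\<^esub> x) = c \<odot>\<^bsub>M\<^esub> ?k x" if "x \<in> carrier N" for c x
    using that k by (intro eq kG_module_closed(2)[OF assms(1)]) (simp_all add: kG_homD(3)[OF assms(2)])
  show "?k (gact N g x) = gact M g (?k x)" if "g \<in> carrier G" "x \<in> carrier N" for g x
    using that k by (intro eq kG_module_closed(3)[OF assms(1)]) (simp_all add: kG_homD(4)[OF assms(2)])
qed

text \<open>
  The basis vector of \<open>perm_gmodule G H\<close> that belongs to the coset
  \<open>C\<close>. The vector of \<open>H\<close> itself generates the module.
\<close>

definition coset_vector :: "'g set \<Rightarrow> 'g set \<Rightarrow> 'k::field" where
  "coset_vector C = (\<lambda>D. of_bool (D = C))"

lemma (in group) lcosets_props:
  assumes H: "subgroup H G"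
  shows "H \<in> lcosets H" "C \<in> lcosets H \<Longrightarrow> C \<subseteq> carrier G"
    "C \<in> lcosets H \<Longrightarrow> g \<in> carrier G \<Longrightarrow> g <# C \<in> lcosets H"
    "C \<in> lcosets H \<Longrightarrow> D \<in> lcosets H \<Longrightarrow> g \<in> carrier G \<Longrightarrow> inv g <# C = D \<longleftrightarrow> C = g <# D"
proof -
  interpret subgroup H G by (fact H)
  show HH: "H \<in> lcosets H" using lcos_mult_one[OF subset] by (force simp: LCOSETS_def)
  show sub: "C \<subseteq> carrier G" if "C \<in> lcosets H" for C
    using that l_coset_subset_G[OF subset] by (auto simp: LCOSETS_def)
  show "g <# C \<in> lcosets H" if "C \<in> lcosets H" "g \<in> carrier G"
    using that by (auto simp: LCOSETS_def lcos_m_assoc[OF subset])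
  show "inv g <# C = D \<longleftrightarrow> C = g <# D" if "C \<in> lcosets H" "D \<in> lcosets H" "g \<in> carrier G"
    using that sub by (metis inv_closed l_inv lcos_m_assoc lcos_mult_one r_inv)
qed

lemma perm_gmodule_simps:
  "carrier (perm_gmodule G H) = {f. \<forall>C. C \<notin> lcosets\<^bsub>G\<^esub> H \<longrightarrow> f C = 0}"
  "f \<oplus>\<^bsub>perm_gmodule G H\<^esub> f' = (\<lambda>C. f C + f' C)" "c \<odot>\<^bsub>perm_gmodule G H\<^esub> f = (\<lambda>C. c * f C)"
  "gact (perm_gmodule G H) g f = (\<lambda>C. if C \<in> lcosets\<^bsub>G\<^esub> H then f (inv\<^bsub>G\<^esub> g <#\<^bsub>G\<^esub> C) else 0)"
  by (simp_all add: perm_gmodule_def)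

lemma trivial_gmodule_simps:
  "carrier trivial_gmodule = UNIV" "x \<oplus>\<^bsub>trivial_gmodule\<^esub> y = x + y" "c \<odot>\<^bsub>trivial_gmodule\<^esub> x = c * x"
  "gact trivial_gmodule g x = x"
  by (simp_all add: trivial_gmodule_def)

context group
begin

lemma coset_vector_carrier:
  assumes "subgroup H G" "C \<in> lcosets H"
  shows "coset_vector C \<in> carrier (perm_gmodule G H)"
  using assms by (auto simp: perm_gmodule_simps coset_vector_def)

lemma gact_coset_vector:
  assumes "subgroup H G" "C \<in> lcosets H" "g \<in> carrier G"
  shows "gact (perm_gmodule G H) g (coset_vector C) = coset_vector (g <# C)"
  using lcosets_props(3)[OF assms(1,2,3)] lcosets_props(4)[OF assms(1) _ assms(2,3)]
  by (auto simp: perm_gmodule_simps coset_vector_def fun_eq_iff)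

lemma finite_lcosets: "finite (carrier G) \<Longrightarrow> finite (lcosets H)"
  by (simp add: LCOSETS_def)

text \<open>
  \<open>G\<close> permutes the cosets transitively, so the translates of the base vector form a
  basis.
\<close>

lemma perm_gmodule_cyclic:
  fixes H :: "'a set" and N :: "('a set \<Rightarrow> 'k::field) set"
  defines "P \<equiv> perm_gmodule G H :: ('k, 'a set \<Rightarrow> 'k, 'a) gmodule"
  assumes H: "subgroup H G" and fin: "finite (carrier G)"
    and N: "kG_submodule G N P" and base: "coset_vector H \<in> N"
  shows "N = carrier P"
proof
  note N' = kG_submoduleD[OF kG_module_perm_gmodule[OF H is_group], OF N[unfolded P_def], folded P_def]
  show "N \<subseteq> carrier P" by (rule N')
  show "carrier P \<subseteq> N"
  proof
    fix f assume f: "f \<in> carrier P"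
    have coset: "coset_vector C \<in> N" if C: "C \<in> lcosets H" for C
    proof -
      obtain g where g: "g \<in> carrier G" "C = g <# H" using C by (auto simp: LCOSETS_def)
      have "gact P g (coset_vector H) \<in> N" by (rule N'(4)[OF g(1) base])
      then show ?thesis
        unfolding P_def gact_coset_vector[OF H lcosets_props(1)[OF H] g(1)] g(2) .
    qed
    have "(\<lambda>C. if C \<in> A then f C else 0) \<in> N" if "finite A" "A \<subseteq> lcosets H" for A
      using that
    proof (induction A)
      case empty
      show ?case using N'(3)[OF base, of 0] by (simp add: P_def perm_gmodule_simps)
    next
      case (insert C A)
      have "(\<lambda>D. (if D \<in> A then f D else 0) + f C * coset_vector C D) \<in> N"
        using N'(2)[OF insert.IH N'(3)[OF coset, of C "f C"]] insert.prems
        by (simp add: P_def perm_gmodule_simps)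
      also have "(\<lambda>D. (if D \<in> A then f D else 0) + f C * coset_vector C D)
          = (\<lambda>D. if D \<in> insert C A then f D else 0)"
        using insert.hyps by (auto simp: coset_vector_def fun_eq_iff)
      finally show ?case .
    qed
    from this[OF finite_lcosets[OF fin] subset_refl] have "(\<lambda>C. if C \<in> lcosets H then f C else 0) \<in> N" .
    also have "(\<lambda>C. if C \<in> lcosets H then f C else 0) = f"
      using f by (auto simp: P_def perm_gmodule_simps fun_eq_iff)
    finally show "f \<in> N" .
  qed
qed

text \<open>
  The projective cover lives on sequences over \<open>'k\<close>. Projectivity and the essential
  map are carried to the permutation module along the isomorphism. As the trivial module is
  one-dimensional, "essential" says that every submodule on which \<open>\<pi>\<close> does not
  vanish is everything: the kernel of \<open>\<pi>\<close> is the only maximal submodule. Were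
  \<open>\<pi>\<close> zero on the base vector, it would be zero everywhere.
\<close>

lemma projective_cover_of_trivial_perm:
  fixes H :: "'a set"
  defines "P \<equiv> perm_gmodule G H :: ('k::field, 'a set \<Rightarrow> 'k, 'a) gmodule"
  assumes H: "subgroup H G" and fin: "finite (carrier G)" and I: "property_I_wrt TYPE('k) G H"
  obtains \<pi> where "kG_projective G P" "\<pi> \<in> kG_hom G P trivial_gmodule" "\<pi> (coset_vector H) \<noteq> 0"
    "\<And>N f. kG_submodule G N P \<Longrightarrow> f \<in> N \<Longrightarrow> \<pi> f \<noteq> 0 \<Longrightarrow> N = carrier P"
proof -
  have modP: "kG_module G P" unfolding P_def by (rule kG_module_perm_gmodule[OF H is_group])
  obtain \<Phi> :: "('k, nat \<Rightarrow> 'k, 'a) gmodule" and p F where mod: "kG_module G \<Phi>"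
    and proj: "kG_projective G \<Phi>" and p: "p \<in> kG_hom G \<Phi> trivial_gmodule" "p ` carrier \<Phi> = UNIV"
    and ess: "\<And>N. kG_submodule G N \<Phi> \<Longrightarrow> p ` N = UNIV \<Longrightarrow> N = carrier \<Phi>"
    and F: "F \<in> kG_hom G \<Phi> P" "bij_betw F (carrier \<Phi>) (carrier P)"
    using I unfolding property_I_wrt_def projective_cover_def kG_iso_def P_def
    by (auto simp: trivial_gmodule_simps)
  define F' where "F' = inv_into (carrier \<Phi>) F"
  have F': "F' \<in> kG_hom G P \<Phi>" unfolding F'_def by (rule kG_hom_inverse[OF mod F])
  have F'_img: "F' ` carrier P = carrier \<Phi>"
    using bij_betw_inv_into[OF F(2)] by (simp add: F'_def bij_betw_def)
  have F'_inj: "inj_on F' (carrier P)"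
    using bij_betw_inv_into[OF F(2)] by (simp add: F'_def bij_betw_def)
  have FF': "F (F' f) = f" if "f \<in> carrier P" for f
    using that F(2) by (simp add: F'_def bij_betw_def f_inv_into_f)
  have projP: "kG_projective G P"
    unfolding kG_projective_def
  proof (intro allI impI ballI)
    fix A B :: "('k, nat \<Rightarrow> 'k, 'a) gmodule" and q f
    assume A: "kG_module G A" and B: "kG_module G B" and q: "q \<in> kG_hom G A B"
      and f: "f \<in> kG_hom G P B" and surj: "q ` carrier A = carrier B"
    have "f \<circ> F \<in> kG_hom G \<Phi> B"
      using kG_homD[OF F(1)] kG_homD[OF f] by (intro kG_homI) simp_all
    then obtain h where h: "h \<in> kG_hom G \<Phi> A" "\<forall>y\<in>carrier \<Phi>. q (h y) = (f \<circ> F) y"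
      using proj A B q surj unfolding kG_projective_def by metis
    have "h \<circ> F' \<in> kG_hom G P A"
      using kG_homD[OF F'] kG_homD[OF h(1)] by (intro kG_homI) simp_all
    moreover have "q ((h \<circ> F') x) = f x" if "x \<in> carrier P" for x
      using h(2) kG_homD(1)[OF F' that] FF'[OF that] by simp
    ultimately show "\<exists>h\<in>kG_hom G P A. \<forall>x\<in>carrier P. q (h x) = f x" by blast
  qed
  define \<pi> where "\<pi> = p \<circ> F'"
  have \<pi>: "\<pi> \<in> kG_hom G P trivial_gmodule"
    using kG_homD[OF F'] kG_homD[OF p(1)] by (intro kG_homI) (simp_all add: \<pi>_def)
  have local: "N = carrier P" if N: "kG_submodule G N P" and f: "f \<in> N" "\<pi> f \<noteq> 0" for N f
  proof -
    note N' = kG_submoduleD[OF modP N]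
    note h = kG_homD[OF F' subsetD[OF N'(1)]]
    have "kG_submodule G (F' ` N) \<Phi>"
    proof (rule kG_submoduleI[OF mod])
      show "F' ` N \<subseteq> carrier \<Phi>" using F'_img N'(1) by blast
      show "F' ` N \<noteq> {}" using f by blast
      fix x assume "x \<in> F' ` N"
      then obtain a where a: "a \<in> N" "x = F' a" by blast
      show "c \<odot>\<^bsub>\<Phi>\<^esub> x \<in> F' ` N" for c
        unfolding a(2) h(3)[OF a(1), symmetric] by (rule imageI[OF N'(3)[OF a(1)]])
      show "gact \<Phi> g x \<in> F' ` N" if "g \<in> carrier G" for g
        unfolding a(2) h(4)[OF a(1) that, symmetric] by (rule imageI[OF N'(4)[OF that a(1)]])
      fix y assume "y \<in> F' ` N"
      then obtain b where b: "b \<in> N" "y = F' b" by blast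
      show "x \<oplus>\<^bsub>\<Phi>\<^esub> y \<in> F' ` N"
        unfolding a(2) b(2) h(2)[OF a(1) subsetD[OF N'(1) b(1)], symmetric]
        by (rule imageI[OF N'(2)[OF a(1) b(1)]])
    qed
    moreover have "p ` F' ` N = UNIV"
    proof -
      have "c \<in> p ` F' ` N" for c
      proof -
        have "p (F' ((c / \<pi> f) \<odot>\<^bsub>P\<^esub> f)) = c"
          using kG_homD(3)[OF \<pi> subsetD[OF N'(1) f(1)], of "c / \<pi> f"] f(2)
          by (simp add: \<pi>_def trivial_gmodule_simps)
        then show ?thesis using N'(3)[OF f(1), of "c / \<pi> f"] by force
      qed
      then show ?thesis by blast
    qed
    ultimately have "F' ` N = carrier \<Phi>" by (rule ess)
    then show "N = carrier P" using F'_img inj_on_image_eq_iff[OF F'_inj N'(1) subset_refl] by simp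
  qed
  have "\<pi> (coset_vector H) \<noteq> 0"
  proof
    assume 0: "\<pi> (coset_vector H) = 0"
    let ?K = "{f \<in> carrier P. \<pi> f = 0}"
    have "kG_submodule G ?K P"
    proof (rule kG_submoduleI[OF modP])
      show "?K \<noteq> {}" using coset_vector_carrier[OF H lcosets_props(1)[OF H]] 0 by (auto simp: P_def)
      show "x \<oplus>\<^bsub>P\<^esub> y \<in> ?K" if "x \<in> ?K" "y \<in> ?K" for x y
        using that kG_module_closed(1)[OF modP, of x y] kG_homD(2)[OF \<pi>, of x y]
        by (simp add: trivial_gmodule_simps)
      show "c \<odot>\<^bsub>P\<^esub> x \<in> ?K" if "x \<in> ?K" for c x
        using that kG_module_closed(2)[OF modP, of x c] kG_homD(3)[OF \<pi>, of x c]
        by (simp add: trivial_gmodule_simps)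
      show "gact P g x \<in> ?K" if "g \<in> carrier G" "x \<in> ?K" for g x
        using that kG_module_closed(3)[OF modP, of x g] kG_homD(4)[OF \<pi>, of x g]
        by (simp add: trivial_gmodule_simps)
    qed auto
    moreover have "coset_vector H \<in> ?K"
      using 0 coset_vector_carrier[OF H lcosets_props(1)[OF H]] by (simp add: P_def)
    ultimately have K: "?K = carrier P"
      unfolding P_def by (rule perm_gmodule_cyclic[OF H fin])
    have "p y = 0" if "y \<in> carrier \<Phi>" for y
    proof -
      have "y \<in> F' ` carrier P" unfolding F'_img by (rule that)
      then obtain x where x: "x \<in> carrier P" "y = F' x" by (rule imageE)
      then have "x \<in> ?K" unfolding K by simp
      then show ?thesis using x(2) by (simp add: \<pi>_def)
    qed
    then have "p ` carrier \<Phi> \<subseteq> {0}" by auto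
    then have "(1::'k) \<in> {0}" unfolding p(2) by (rule subsetD) simp
    then show False by simp
  qed
  from that[OF projP \<pi> this local] show ?thesis .
qed

end

context group
begin

text \<open>
  Because \<open>U\<close> is regular on \<open>W - {w}\<close> and \<open>card W\<close> is
  odd, the functions on \<open>W\<close> with sum zero form a simple module in characteristic 2.
  If \<open>H\<close> is intransitive, it fixes such a function \<open>v \<noteq> 0\<close>, and
  \<open>v\<close> is the image of the base coset under a homomorphism \<open>\<phi>\<close>
  from the permutation module. The kernel of \<open>\<phi>\<close> is a proper submodule, so
  \<open>\<pi>\<close> vanishes on it and \<open>\<pi> f\<close> depends on \<open>\<phi>
  f\<close> only. The proof refutes this: it finds a second preimage of \<open>v\<close>, on
  which \<open>\<pi>\<close> is zero. Summing a translate of \<open>v\<close> over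
  \<open>U\<close> gives the indicator of \<open>W - {w}\<close>, and \<open>\<pi>\<close> takes
  equal values on the even number of summands. The translates of this indicator add up to
  \<open>v\<close>.
\<close>

theorem property_I_wrt_imp_transitive:
  fixes act :: "'a \<Rightarrow> 'p \<Rightarrow> 'p" and H :: "'a set"
  assumes H: "subgroup H G" and fin: "finite (carrier G)"
    and I: "property_I_wrt TYPE('k::field) G H" and two: "(2::'k) = 0"
    and finW: "finite W" and oddW: "odd (card W)"
    and closed: "\<And>g x. g \<in> carrier G \<Longrightarrow> x \<in> W \<Longrightarrow> act g x \<in> W"
    and act_one: "\<And>x. x \<in> W \<Longrightarrow> act \<one> x = x"
    and act_mult: "\<And>g h x. g \<in> carrier G \<Longrightarrow> h \<in> carrier G \<Longrightarrow> x \<in> W \<Longrightarrow> act (g \<otimes> h) x = act g (act h x)"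
    and w: "w \<in> W" and trans: "\<And>x. x \<in> W \<Longrightarrow> \<exists>g\<in>carrier G. act g w = x"
    and U: "subgroup U G" and U_fix: "\<And>u. u \<in> U \<Longrightarrow> act u w = w"
    and U_reg: "\<And>x. x \<in> W - {w} \<Longrightarrow> bij_betw (\<lambda>u. act u x) U (W - {w})"
    and x: "x \<in> W" and y: "y \<in> W"
  shows "\<exists>h\<in>H. act h x = y"
proof (rule ccontr)
  assume not: "\<not> (\<exists>h\<in>H. act h x = y)"
  interpret H: subgroup H G by (fact H)
  interpret U: subgroup U G by (fact U)
  define P where "P = (perm_gmodule G H :: ('k, 'a set \<Rightarrow> 'k, 'a) gmodule)"
  have modP: "kG_module G P" unfolding P_def by (rule kG_module_perm_gmodule[OF H is_group])
  obtain \<pi> where \<pi>: "\<pi> \<in> kG_hom G P trivial_gmodule" "\<pi> (coset_vector H) \<noteq> 0"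
    and local: "\<And>N f. kG_submodule G N P \<Longrightarrow> f \<in> N \<Longrightarrow> \<pi> f \<noteq> 0 \<Longrightarrow> N = carrier P"
    using projective_cover_of_trivial_perm[OF H fin I] unfolding P_def by metis
  have base: "coset_vector H \<in> carrier P"
    unfolding P_def by (rule coset_vector_carrier[OF H lcosets_props(1)[OF H]])
  have dbl: "c + c = 0" for c :: 'k using two by (metis mult_2 mult_zero_left)
  have inv_act: "act (inv g) (act g z) = z" "act g (act (inv g) z) = z" if "g \<in> carrier G" "z \<in> W" for g z
    using that act_mult[of "inv g" g z] act_mult[of g "inv g" z] act_one by simp_all
  have inv_iff: "act (inv g) z = z' \<longleftrightarrow> z = act g z'" if "g \<in> carrier G" "z \<in> W" "z' \<in> W" for g z z'
    using inv_act that by metis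

  \<comment> \<open>The indicator \<open>v\<close> of \<open>E\<close> has sum zero if \<open>E\<close> has even size. As \<open>card W\<close> is odd, this holds for the
     \<open>H\<close>-orbit \<open>Q\<close> of \<open>x\<close> or for its complement, and \<open>y\<close> shows that neither is empty.\<close>
  define Q where "Q = (\<lambda>h. act h x) ` H"
  define E where "E = (if even (card Q) then Q else W - Q)"
  have QW: "Q \<subseteq> W" unfolding Q_def by (rule image_subsetI) (simp add: closed x)
  have xQ: "x \<in> Q" unfolding Q_def by (rule image_eqI[of _ _ \<one>]) (simp_all add: act_one x)
  have yQ: "y \<notin> Q" using not by (auto simp only: Q_def image_iff)
  have EW: "E \<subseteq> W" using QW by (auto simp: E_def)
  have "even (card (W - Q))" if "odd (card Q)"
    using that oddW card_Diff_subset[OF finite_subset[OF QW finW] QW] card_mono[OF finW QW] by simp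
  then have E_even: "even (card E)" by (auto simp: E_def)
  have "(if even (card Q) then x else y) \<in> E" using xQ yQ y by (simp add: E_def)
  then obtain b where b: "b \<in> E" ..
  have Q_inv: "act h z \<in> Q" if h: "h \<in> H" and z: "z \<in> Q" for h z
  proof -
    obtain h' where h': "h' \<in> H" "z = act h' x" using z by (auto simp: Q_def)
    then have "act h z = act (h \<otimes> h') x" using act_mult[of h h' x] h x by simp
    then show ?thesis using h h' by (auto simp: Q_def)
  qed
  have Q_iff: "act h z \<in> Q \<longleftrightarrow> z \<in> Q" if "h \<in> H" "z \<in> W" for h z
    using Q_inv[OF that(1), of z] Q_inv[of "inv h" "act h z"] inv_act(1)[of h z] that by auto
  have E_iff: "act h z \<in> E \<longleftrightarrow> z \<in> E" if "h \<in> H" "z \<in> W" for h z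
    using Q_iff[OF that] closed[of h z] that by (auto simp: E_def)
  define v where "v = (\<lambda>z. of_bool (z \<in> E) :: 'k)"
  have of_even: "of_nat n = (0::'k)" if "even n" for n
    using that two by (auto elim!: evenE)

  \<comment> \<open>The coset \<open>g <# H\<close> is mapped to the translate of \<open>v\<close> by \<open>g\<close>; this depends on the coset only, because
     \<open>H\<close> fixes \<open>v\<close>.\<close>
  define c where "c = (\<lambda>C z. v (act (inv (SOME g. g \<in> C)) z))"
  have c: "c (g <# H) z = v (act (inv g) z)" if g: "g \<in> carrier G" and z: "z \<in> W" for g z
  proof -
    have "(SOME g'. g' \<in> g <# H) \<in> g <# H"
      by (rule someI[of _ g]) (use g lcos_self[OF g H] in simp)
    then obtain h where h: "h \<in> H" "(SOME g'. g' \<in> g <# H) = g \<otimes> h" by (auto simp: l_coset_def)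
    have "c (g <# H) z = v (act (inv h \<otimes> inv g) z)"
      using h g by (simp add: c_def inv_mult_group)
    also have "act (inv h \<otimes> inv g) z = act (inv h) (act (inv g) z)"
      using act_mult[of "inv h" "inv g" z] h g z by simp
    also have "v \<dots> = v (act (inv g) z)"
      unfolding v_def using E_iff[of "inv h" "act (inv g) z"] h g z closed by simp
    finally show ?thesis .
  qed
  have c_shift: "c (g <# C) z = c C (act (inv g) z)" if g: "g \<in> carrier G" and C: "C \<in> lcosets H" and z: "z \<in> W" for g C z
  proof -
    obtain a where a: "a \<in> carrier G" "C = a <# H" using C by (auto simp: LCOSETS_def)
    have "g <# C = (g \<otimes> a) <# H" using a g by (simp add: lcos_m_assoc[OF H.subset])
    then show ?thesis
      using c[of "g \<otimes> a" z] c[OF a(1), of "act (inv g) z"] a g z closed act_mult[of "inv a" "inv g" z]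
      by (simp add: inv_mult_group)
  qed
  define \<phi> where "\<phi> = (\<lambda>f z. \<Sum>C\<in>lcosets H. f C * c C z)"
  note finL = finite_lcosets[OF fin, of H]
  have \<phi>_add: "\<phi> (f \<oplus>\<^bsub>P\<^esub> f') z = \<phi> f z + \<phi> f' z" for f f' z
    by (simp add: \<phi>_def P_def perm_gmodule_simps algebra_simps sum.distrib)
  have \<phi>_smult: "\<phi> (d \<odot>\<^bsub>P\<^esub> f) z = d * \<phi> f z" for d f z
    by (simp add: \<phi>_def P_def perm_gmodule_simps algebra_simps sum_distrib_left)
  have \<phi>_act: "\<phi> (gact P g f) z = \<phi> f (act (inv g) z)" if g: "g \<in> carrier G" and z: "z \<in> W" for g f z
  proof -
    have shift: "g <# (inv g <# C) = C" "inv g <# (g <# C) = C" if "C \<in> lcosets H" for C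
      using lcos_m_assoc[OF lcosets_props(2)[OF H that]] lcos_mult_one[OF lcosets_props(2)[OF H that]] g
      by simp_all
    have "\<phi> (gact P g f) z = (\<Sum>C\<in>lcosets H. f (inv g <# C) * c C z)"
      by (simp add: \<phi>_def P_def perm_gmodule_simps)
    also have "\<dots> = (\<Sum>D\<in>lcosets H. f D * c (g <# D) z)"
      by (rule sum.reindex_bij_witness[of _ "\<lambda>D. g <# D" "\<lambda>C. inv g <# C"])
        (use lcosets_props(3)[OF H] shift g in auto)
    also have "\<dots> = \<phi> f (act (inv g) z)"
      unfolding \<phi>_def by (rule sum.cong[OF refl]) (simp add: c_shift g z)
    finally show ?thesis .
  qed
  have \<phi>_base: "\<phi> (coset_vector H) z = v z" if "z \<in> W" for z
  proof -
    have "\<phi> (coset_vector H) z = (\<Sum>C\<in>{H}. coset_vector H C * c C z)"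
      unfolding \<phi>_def by (rule sum.mono_neutral_right)
        (use finL lcosets_props(1)[OF H] in \<open>auto simp: coset_vector_def\<close>)
    also have "\<dots> = c (\<one> <# H) z" by (simp add: coset_vector_def lcos_mult_one[OF H.subset])
    finally show ?thesis using c[of \<one> z] that act_one by simp
  qed

  \<comment> \<open>The image of \<open>f \<mapsto> (\<phi> f, \<pi> f)\<close>. It is a submodule, and translation leaves the second component
     unchanged.\<close>
  define R where "R = {(\<psi>, t). \<exists>f\<in>carrier P. t = \<pi> f \<and> (\<forall>z\<in>W. \<psi> z = \<phi> f z)}"
  have R_add: "(\<lambda>z. \<psi> z + \<psi>' z, t + t') \<in> R" if "(\<psi>, t) \<in> R" "(\<psi>', t') \<in> R" for \<psi> \<psi>' t t'
  proof -
    obtain f f' where f: "f \<in> carrier P" "t = \<pi> f" "\<forall>z\<in>W. \<psi> z = \<phi> f z"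
      and f': "f' \<in> carrier P" "t' = \<pi> f'" "\<forall>z\<in>W. \<psi>' z = \<phi> f' z"
      using \<open>(\<psi>, t) \<in> R\<close> \<open>(\<psi>', t') \<in> R\<close> by (auto simp: R_def)
    show ?thesis unfolding R_def
      using kG_module_closed(1)[OF modP f(1) f'(1)] kG_homD(2)[OF \<pi>(1) f(1) f'(1)] f f' \<phi>_add
      by (auto simp: trivial_gmodule_simps intro!: bexI[of _ "f \<oplus>\<^bsub>P\<^esub> f'"])
  qed
  have R_act: "(\<lambda>z. \<psi> (act (inv g) z), t) \<in> R" if "(\<psi>, t) \<in> R" and g: "g \<in> carrier G" for \<psi> t g
  proof -
    obtain f where f: "f \<in> carrier P" "t = \<pi> f" "\<forall>z\<in>W. \<psi> z = \<phi> f z"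
      using \<open>(\<psi>, t) \<in> R\<close> by (auto simp: R_def)
    show ?thesis unfolding R_def
      using kG_module_closed(3)[OF modP f(1) g] kG_homD(4)[OF \<pi>(1) f(1) g] f \<phi>_act[OF g] closed g
      by (auto simp: trivial_gmodule_simps intro!: bexI[of _ "gact P g f"])
  qed
  have R_0: "(\<lambda>z. 0, 0) \<in> R"
  proof -
    have "\<pi> (0 \<odot>\<^bsub>P\<^esub> coset_vector H) = 0"
      using kG_homD(3)[OF \<pi>(1) base, of 0] by (simp add: trivial_gmodule_simps)
    then show ?thesis unfolding R_def using kG_module_closed(2)[OF modP base, of 0] \<phi>_smult[of 0]
      by (auto intro!: bexI[of _ "0 \<odot>\<^bsub>P\<^esub> coset_vector H"])
  qed
  have R_sum: "(\<lambda>z. \<Sum>i\<in>J. \<psi> i z, \<Sum>i\<in>J. t i) \<in> R" if "finite J" "\<And>i. i \<in> J \<Longrightarrow> (\<psi> i, t i) \<in> R"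
    for J :: "'j set" and \<psi> t
    using that by (induction J) (auto intro: R_0 R_add)
  have R_cong: "(\<psi>', t) \<in> R" if "(\<psi>, t) \<in> R" "\<And>z. z \<in> W \<Longrightarrow> \<psi>' z = \<psi> z" for \<psi> \<psi>' t
    using that by (auto simp: R_def)
  have v_R: "(v, \<pi> (coset_vector H)) \<in> R" unfolding R_def using base \<phi>_base by auto

  \<comment> \<open>A translate \<open>v1\<close> of \<open>v\<close> with \<open>v1 w = 1\<close> is summed over \<open>U\<close>. By regularity, each point other than \<open>w\<close> gets
     the sum of \<open>v1\<close> over \<open>W - {w}\<close>, which is 1; at \<open>w\<close> there are \<open>card U\<close> equal summands.\<close>
  obtain g0 where g0: "g0 \<in> carrier G" "act g0 w = b" using trans[of b] b EW by blast
  define v1 where "v1 = (\<lambda>z. v (act g0 z))"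
  have v1_R: "(v1, \<pi> (coset_vector H)) \<in> R"
    using R_act[OF v_R, of "inv g0"] g0 by (simp add: v1_def)
  have v1w: "v1 w = 1" using g0 b by (simp add: v1_def v_def)
  have sum_v1: "(\<Sum>z\<in>W. v1 z) = 0"
  proof -
    have "(\<Sum>z\<in>W. v1 z) = (\<Sum>z\<in>W. v z)"
      unfolding v1_def by (rule sum.reindex_bij_witness[of _ "act (inv g0)" "act g0"])
        (use g0 inv_act closed in auto)
    also have "\<dots> = of_nat (card E)"
      using sum.mono_neutral_right[OF finW EW, of v] by (simp add: v_def)
    finally show ?thesis using of_even[OF E_even] by simp
  qed
  have finU: "finite U" using finite_subset[OF U.subset fin] .
  have finWw: "card (W - {w}) = card W - 1" using w finW by simp
  have evenU: "even (card U)"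
  proof (cases "W - {w} = {}")
    case True
    then have sub: "W \<subseteq> {w}" by (simp only: Diff_eq_empty_iff)
    have "x = y" using singletonD[OF subsetD[OF sub x]] singletonD[OF subsetD[OF sub y]] by simp
    with xQ yQ show ?thesis by simp
  next
    case False
    then obtain z where "z \<in> W - {w}" by (metis all_not_in_conv)
    from bij_betw_same_card[OF U_reg[OF this]] show ?thesis using finWw oddW by simp
  qed
  define s where "s = (\<lambda>z. of_bool (z \<noteq> w) :: 'k)"
  have s_R: "(s, 0) \<in> R"
  proof (rule R_cong)
    have "(\<lambda>z. \<Sum>u\<in>U. v1 (act (inv u) z), \<Sum>u\<in>U. \<pi> (coset_vector H)) \<in> R"
      by (rule R_sum[OF finU]) (rule R_act[OF v1_R], simp)
    then show "(\<lambda>z. \<Sum>u\<in>U. v1 (act (inv u) z), 0) \<in> R" using of_even[OF evenU] by simp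
    fix z assume z: "z \<in> W"
    have "(\<Sum>u\<in>U. v1 (act (inv u) z)) = (\<Sum>u\<in>U. v1 (act u z))"
      by (rule sum.reindex_bij_witness[of _ "\<lambda>u. inv u" "\<lambda>u. inv u"]) auto
    also have "\<dots> = s z"
    proof (cases "z = w")
      case True
      then show ?thesis using U_fix of_even[OF evenU] by (simp add: s_def)
    next
      case False
      then have "(\<Sum>u\<in>U. v1 (act u z)) = (\<Sum>z\<in>W - {w}. v1 z)"
        by (intro sum.reindex_bij_betw U_reg) (use z in simp)
      also have "\<dots> = - v1 w" using sum_v1 sum.remove[OF finW w, of v1] by (simp add: add_eq_0_iff)
      also have "\<dots> = 1" unfolding v1w using dbl[of 1] by (simp add: eq_neg_iff_add_eq_0 minus_equation_iff)
      finally show ?thesis using False by (simp add: s_def)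
    qed
    finally show "s z = (\<Sum>u\<in>U. v1 (act (inv u) z))" ..
  qed

  \<comment> \<open>Summed over the points \<open>a\<close> of \<open>E\<close>, the indicators of \<open>W - {a}\<close> give \<open>card E - v = v\<close>.\<close>
  define g where "g = (\<lambda>a. SOME g. g \<in> carrier G \<and> act g w = a)"
  have g: "g a \<in> carrier G" "act (g a) w = a" if "a \<in> W" for a
  proof -
    have "\<exists>g. g \<in> carrier G \<and> act g w = a" using trans[OF that] by blast
    from someI_ex[OF this] show "g a \<in> carrier G" "act (g a) w = a" by (simp_all add: g_def)
  qed
  have v_R0: "(v, 0) \<in> R"
  proof (rule R_cong[of "\<lambda>z. \<Sum>a\<in>E. s (act (inv (g a)) z)"])
    have "(\<lambda>z. \<Sum>a\<in>E. s (act (inv (g a)) z), \<Sum>a\<in>E. 0) \<in> R"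
      by (rule R_sum[OF finite_subset[OF EW finW]]) (rule R_act[OF s_R g(1)], rule subsetD[OF EW])
    then show "(\<lambda>z. \<Sum>a\<in>E. s (act (inv (g a)) z), 0) \<in> R" unfolding sum.neutral_const .
    fix z assume z: "z \<in> W"
    have "(\<Sum>a\<in>E. s (act (inv (g a)) z)) = (\<Sum>a\<in>E. 1 + of_bool (a = z))"
    proof (rule sum.cong[OF refl])
      fix a assume "a \<in> E"
      then have a: "a \<in> W" using EW by blast
      have "act (inv (g a)) z = w \<longleftrightarrow> a = z" using inv_iff[OF g(1)[OF a] z w] g(2)[OF a] by auto
      then show "s (act (inv (g a)) z) = 1 + of_bool (a = z)" using dbl[of 1] by (simp add: s_def)
    qed
    also have "\<dots> = of_nat (card E) + (\<Sum>a\<in>E. of_bool (a = z))" by (simp add: sum.distrib)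
    also have "(\<Sum>a\<in>E. of_bool (a = z)) = v z"
      using finite_subset[OF EW finW] by (simp add: v_def of_bool_def)
    finally show "v z = (\<Sum>a\<in>E. s (act (inv (g a)) z))" using of_even[OF E_even] by simp
  qed
  from R_add[OF v_R v_R0] have "(\<lambda>z. 0, \<pi> (coset_vector H)) \<in> R" using dbl by simp
  then obtain f where f: "f \<in> carrier P" "\<pi> f = \<pi> (coset_vector H)" "\<forall>z\<in>W. \<phi> f z = 0"
    by (auto simp: R_def)
  let ?N = "{f \<in> carrier P. \<forall>z\<in>W. \<phi> f z = 0}"
  have "kG_submodule G ?N P"
  proof (rule kG_submoduleI[OF modP])
    have "f \<in> ?N" using f(1,3) by simp
    then show "?N \<noteq> {}" by blast
    show "x \<oplus>\<^bsub>P\<^esub> y \<in> ?N" if "x \<in> ?N" "y \<in> ?N" for x y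
      using that kG_module_closed(1)[OF modP, of x y] by (simp add: \<phi>_add)
    show "d \<odot>\<^bsub>P\<^esub> x \<in> ?N" if "x \<in> ?N" for d x
      using that kG_module_closed(2)[OF modP, of x d] by (simp add: \<phi>_smult)
    show "gact P g x \<in> ?N" if "g \<in> carrier G" "x \<in> ?N" for g x
      using that kG_module_closed(3)[OF modP, of x g] closed by (simp add: \<phi>_act)
  qed auto
  then have "?N = carrier P" by (rule local[of _ f]) (use f \<pi>(2) in auto)
  then have "\<phi> (coset_vector H) b = 0" using base b EW by blast
  then show False using \<phi>_base b EW by (auto simp: v_def)
qed

end

text \<open>
  The permutation module on \<open>{..<n}\<close>, with elements in the type over which
  \<open>kG_projective\<close> tests the lifting property. For each \<open>g\<close>, the map
  \<open>\<sigma> g\<close> is the permutation of the inverse of \<open>g\<close>, as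
  coefficients are pulled back.
\<close>

definition seq_gmodule :: "nat \<Rightarrow> ('g \<Rightarrow> nat \<Rightarrow> nat) \<Rightarrow> ('k::field, nat \<Rightarrow> 'k, 'g) gmodule" where
  "seq_gmodule n \<sigma> = \<lparr>carrier = {x. \<forall>i\<ge>n. x i = 0},
     monoid.mult = (\<lambda>x y i. x i * y i), one = (\<lambda>i. of_bool (i < n)),
     ring.zero = (\<lambda>i. 0), add = (\<lambda>x y i. x i + y i),
     module.smult = (\<lambda>c x i. c * x i),
     gact = (\<lambda>g x i. if i < n then x (\<sigma> g i) else 0)\<rparr>"

lemma seq_gmodule_simps:
  "carrier (seq_gmodule n \<sigma>) = {x. \<forall>i\<ge>n. x i = 0}"
  "x \<oplus>\<^bsub>seq_gmodule n \<sigma>\<^esub> y = (\<lambda>i. x i + y i)" "c \<odot>\<^bsub>seq_gmodule n \<sigma>\<^esub> x = (\<lambda>i. c * x i)"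
  "gact (seq_gmodule n \<sigma>) g x = (\<lambda>i. if i < n then x (\<sigma> g i) else 0)"
  by (simp_all add: seq_gmodule_def)

lemma kG_module_seq_gmodule:
  assumes "group G"
    and closed: "\<And>g i. g \<in> carrier G \<Longrightarrow> i < n \<Longrightarrow> \<sigma> g i < n"
    and one: "\<And>i. i < n \<Longrightarrow> \<sigma> \<one>\<^bsub>G\<^esub> i = i"
    and mult: "\<And>g h i. g \<in> carrier G \<Longrightarrow> h \<in> carrier G \<Longrightarrow> i < n \<Longrightarrow> \<sigma> (g \<otimes>\<^bsub>G\<^esub> h) i = \<sigma> h (\<sigma> g i)"
  shows "kG_module G (seq_gmodule n \<sigma> :: ('k::field, nat \<Rightarrow> 'k, 'g) gmodule)"
    (is "kG_module G ?M")
proof -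
  have "abelian_group ?M"
  proof (rule abelian_groupI)
    show "\<exists>y\<in>carrier ?M. y \<oplus>\<^bsub>?M\<^esub> x = \<zero>\<^bsub>?M\<^esub>" if "x \<in> carrier ?M" for x
      using that by (intro bexI[of _ "\<lambda>i. - x i"]) (auto simp: seq_gmodule_def)
  qed (auto simp: seq_gmodule_def algebra_simps)
  then have "module ring_of_type_algebra ?M"
    by (intro moduleI cring_from_type_algebra)
      (auto simp: seq_gmodule_def ring_of_type_algebra_def algebra_simps)
  with assms show ?thesis
    by (intro kG_module.intro kG_module_axioms.intro) (auto simp: seq_gmodule_def fun_eq_iff)
qed

context group
begin

text \<open>
  The function is constant on each right coset of \<open>H\<close>, so each coset contributes a
  multiple of \<open>card H\<close>.
\<close>

lemma sum_left_invariant: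
  fixes W :: "'a \<Rightarrow> 'k::field"
  assumes H: "subgroup H G" and fin: "finite (carrier G)"
    and inv: "\<And>k g. k \<in> H \<Longrightarrow> g \<in> carrier G \<Longrightarrow> W (k \<otimes> g) = W g"
    and 0: "of_nat (card H) = (0::'k)"
  shows "(\<Sum>g\<in>carrier G. W g) = 0"
proof -
  have part: "\<Union>(rcosets H) = carrier G" by (rule rcosets_part_G[OF H])
  have disj: "\<And>C D. C \<in> rcosets H \<Longrightarrow> D \<in> rcosets H \<Longrightarrow> C \<noteq> D \<Longrightarrow> C \<inter> D = {}"
    using rcos_disjoint[OF H] by (auto simp: pairwise_def disjnt_def)
  have finC: "finite C" if "C \<in> rcosets H" for C
    using that part fin by (metis Union_upper finite_subset)
  have "(\<Sum>g\<in>\<Union>(rcosets H). W g) = (\<Sum>C\<in>rcosets H. \<Sum>g\<in>C. W g)"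
    by (rule sum.Union_disjoint[of "rcosets H" W, unfolded comp_def]) (use finC disj in auto)
  also have "\<dots> = 0"
  proof (rule sum.neutral, rule ballI)
    fix C assume C: "C \<in> rcosets H"
    then obtain r where r: "r \<in> carrier G" "C = H #> r" by (auto simp: RCOSETS_def)
    have "(\<Sum>g\<in>C. W g) = (\<Sum>g\<in>C. W r)"
      by (rule sum.cong[OF refl]) (use r inv in \<open>auto simp: r_coset_def\<close>)
    also have "\<dots> = of_nat (card H) * W r"
      using card_rcosets_equal[OF C subgroup.subset[OF H]] by simp
    finally show "(\<Sum>g\<in>C. W g) = 0" using 0 by simp
  qed
  finally show ?thesis unfolding part .
qed

text \<open>
  The lifting property is applied to the regular module \<open>A\<close>, the trivial module
  \<open>B\<close> and the augmentation \<open>a\<close> from \<open>A\<close> onto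
  \<open>B\<close>. A lift \<open>h\<close> of \<open>\<pi>\<close> sends the base vector, which
  \<open>H\<close> fixes, to an \<open>H\<close>-invariant element of the group algebra with
  nonzero augmentation.
\<close>

theorem property_I_wrt_imp_card_nonzero:
  fixes H :: "'a set"
  assumes H: "subgroup H G" and fin: "finite (carrier G)" and I: "property_I_wrt TYPE('k::field) G H"
  shows "of_nat (card H) \<noteq> (0::'k)"
proof
  assume card0: "of_nat (card H) = (0::'k)"
  interpret H: subgroup H G by (fact H)
  define P where "P = (perm_gmodule G H :: ('k, 'a set \<Rightarrow> 'k, 'a) gmodule)"
  have modP: "kG_module G P" unfolding P_def by (rule kG_module_perm_gmodule[OF H is_group])
  obtain \<pi> where proj: "kG_projective G P" and \<pi>: "\<pi> \<in> kG_hom G P trivial_gmodule" "\<pi> (coset_vector H) \<noteq> 0"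
    using projective_cover_of_trivial_perm[OF H fin I] unfolding P_def by metis
  define n where "n = card (carrier G)"
  obtain e where e: "bij_betw e (carrier G) {..<n}"
    using ex_bij_betw_finite_nat[OF fin] by (auto simp: n_def atLeast0LessThan)
  define d where "d = inv_into (carrier G) e"
  have d: "d i \<in> carrier G" "e (d i) = i" if "i < n" for i
    using e that by (auto simp: d_def bij_betw_def inv_into_into f_inv_into_f)
  have ed: "e g < n" "d (e g) = g" if "g \<in> carrier G" for g
    using e that by (auto simp: d_def bij_betw_def)
  have n0: "n > 0" using fin by (auto simp: n_def card_gt_0_iff)
  define \<sigma> where "\<sigma> = (\<lambda>g i. e (inv g \<otimes> d i))"
  define A where "A = (seq_gmodule n \<sigma> :: ('k, nat \<Rightarrow> 'k, 'a) gmodule)"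
  define B where "B = (seq_gmodule 1 (\<lambda>g i. i) :: ('k, nat \<Rightarrow> 'k, 'a) gmodule)"
  have modA: "kG_module G A" unfolding A_def
    by (rule kG_module_seq_gmodule[OF is_group]) (simp_all add: \<sigma>_def d ed inv_mult_group m_assoc)
  have modB: "kG_module G B" unfolding B_def
    by (rule kG_module_seq_gmodule[OF is_group]) simp_all
  define a where "a = (\<lambda>(x :: nat \<Rightarrow> 'k) (i::nat). if i = 0 then \<Sum>j<n. x j else 0)"
  have shift: "(\<Sum>j<n. x (\<sigma> g j)) = (\<Sum>j<n. x j)" if g: "g \<in> carrier G" for g and x :: "nat \<Rightarrow> 'k"
    by (rule sum.reindex_bij_witness[of _ "\<sigma> (inv g)" "\<sigma> g"])
      (use g in \<open>simp_all add: \<sigma>_def d ed m_assoc[symmetric]\<close>)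
  have a_hom: "a \<in> kG_hom G A B"
  proof (rule kG_homI)
    show "a (gact A g x) = gact B g (a x)" if "g \<in> carrier G" "x \<in> carrier A" for g x
      using shift[OF that(1), of x] by (auto simp: a_def A_def B_def seq_gmodule_simps fun_eq_iff)
  qed (auto simp: a_def A_def B_def seq_gmodule_simps sum.distrib sum_distrib_left fun_eq_iff)
  have a_surj: "a ` carrier A = carrier B"
  proof (intro equalityI subsetI)
    show "y \<in> carrier B" if "y \<in> a ` carrier A" for y
      using that kG_homD(1)[OF a_hom] by blast
    fix y assume y: "y \<in> carrier B"
    have "y = a (\<lambda>i. if i = 0 then y 0 else 0)"
      using y n0 by (auto simp: a_def B_def seq_gmodule_simps fun_eq_iff)
    moreover have "(\<lambda>i. if i = 0 then y 0 else 0) \<in> carrier A"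
      using n0 by (simp add: A_def seq_gmodule_simps)
    ultimately show "y \<in> a ` carrier A" by (rule image_eqI)
  qed
  define b where "b = (\<lambda>y (i::nat). if i = 0 then \<pi> y else 0)"
  have b_hom: "b \<in> kG_hom G P B"
  proof (rule kG_homI)
    show "b (x \<oplus>\<^bsub>P\<^esub> y) = b x \<oplus>\<^bsub>B\<^esub> b y" if "x \<in> carrier P" "y \<in> carrier P" for x y
      using kG_homD(2)[OF \<pi>(1) that] by (auto simp: b_def B_def seq_gmodule_simps trivial_gmodule_simps)
    show "b (c \<odot>\<^bsub>P\<^esub> x) = c \<odot>\<^bsub>B\<^esub> b x" if "x \<in> carrier P" for c x
      using kG_homD(3)[OF \<pi>(1) that, of c] by (auto simp: b_def B_def seq_gmodule_simps trivial_gmodule_simps)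
    show "b (gact P g x) = gact B g (b x)" if "g \<in> carrier G" "x \<in> carrier P" for g x
      using kG_homD(4)[OF \<pi>(1) that(2,1)] by (auto simp: b_def B_def seq_gmodule_simps trivial_gmodule_simps)
  qed (auto simp: b_def B_def seq_gmodule_simps)
  obtain h where h: "h \<in> kG_hom G P A" "\<And>y. y \<in> carrier P \<Longrightarrow> a (h y) = b y"
    using proj modA modB a_hom b_hom a_surj unfolding kG_projective_def by metis
  have HL: "H \<in> lcosets H" by (rule lcosets_props(1)[OF H])
  define x where "x = (coset_vector H :: 'a set \<Rightarrow> 'k)"
  have x: "x \<in> carrier P" unfolding P_def x_def by (rule coset_vector_carrier[OF H HL])
  have fixed: "gact P k x = x" if k: "k \<in> H" for k
  proof -
    have kG: "k \<in> carrier G" using k by simp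
    have "gact P k x = coset_vector (k <# H)" unfolding P_def x_def by (rule gact_coset_vector[OF H HL kG])
    also have "k <# H = H" using coset_join3[OF kG H k] .
    finally show ?thesis unfolding x_def .
  qed
  define W where "W = (\<lambda>g. h x (e g))"
  have "W (k \<otimes> g) = W g" if k: "k \<in> H" and g: "g \<in> carrier G" for k g
  proof -
    have kG: "k \<in> carrier G" using k by simp
    have "h x (e (k \<otimes> g)) = h (gact P k x) (e (k \<otimes> g))" using fixed[OF k] by simp
    also have "\<dots> = gact A k (h x) (e (k \<otimes> g))" using kG_homD(4)[OF h(1) x kG] by simp
    also have "\<dots> = h x (e g)"
      using kG g by (simp add: A_def seq_gmodule_simps \<sigma>_def ed m_assoc[symmetric])
    finally show ?thesis by (simp add: W_def)
  qed
  from sum_left_invariant[OF H fin this card0] have "(\<Sum>g\<in>carrier G. W g) = 0" by blast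
  moreover have "(\<Sum>g\<in>carrier G. W g) = (\<Sum>j<n. h x j)"
    unfolding W_def by (rule sum.reindex_bij_betw[OF e])
  moreover have "(\<Sum>j<n. h x j) = \<pi> x" using fun_cong[OF h(2)[OF x], of 0] by (simp add: a_def b_def)
  ultimately show False using \<pi>(2) by (simp add: x_def)
qed

end

section \<open>Matrices with simple spectrum\<close>

lemma smult_vec_eq_0D:
  fixes v :: "'a::field vec"
  assumes "c \<cdot>\<^sub>v v = 0\<^sub>v n" "v \<in> carrier_vec n" "v \<noteq> 0\<^sub>v n" shows "c = 0"
  using assms by (auto simp: vec_eq_iff)

text \<open>
  Eigenvectors for distinct eigenvalues are linearly independent: the kernel of \<open>P\<close>
  is stable under the diagonal matrix \<open>mat_diag n l\<close>. If the coordinate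
  \<open>i\<close> of a vector of the kernel is nonzero, this matrix minus \<open>l i\<close>
  kills that coordinate and preserves the support elsewhere. So by induction on the support only
  one coordinate is nonzero, and then an eigenvector would vanish.
\<close>

lemma eigenvector_basis_injective:
  fixes A :: "'a::field mat"
  assumes A: "A \<in> carrier_mat n n"
    and ev: "\<And>i. i < n \<Longrightarrow> v i \<in> carrier_vec n \<and> v i \<noteq> 0\<^sub>v n \<and> A *\<^sub>v v i = l i \<cdot>\<^sub>v v i"
    and inj: "inj_on l {..<n}"
    and P_def: "P = mat n n (\<lambda>(r, i). v i $ r)"
  shows "A * P = P * mat_diag n l"
    and "c \<in> carrier_vec n \<Longrightarrow> P *\<^sub>v c = 0\<^sub>v n \<Longrightarrow> c = 0\<^sub>v n"
proof -
  have P: "P \<in> carrier_mat n n" by (simp add: P_def)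
  have D: "mat_diag n l \<in> carrier_mat n n" by (simp add: mat_diag_dim)
  have vd: "v i \<in> carrier_vec n" "dim_vec (v i) = n" "A *\<^sub>v v i = l i \<cdot>\<^sub>v v i" if "i < n" for i
    using ev[OF that] by (auto dest: carrier_vecD)
  have Dcarr: "mat_diag n l *\<^sub>v c \<in> carrier_vec n" if "c \<in> carrier_vec n" for c
    using mult_mat_vec_carrier[OF D that] .
  have colP: "col P i = v i" if "i < n" for i
    using vd[OF that] that by (intro eq_vecI) (auto simp: P_def)
  show AP: "A * P = P * mat_diag n l"
  proof (rule eq_matI)
    fix r i assume "r < dim_row (P * mat_diag n l)" "i < dim_col (P * mat_diag n l)"
    then have r: "r < n" and i: "i < n" using P D by (auto simp: P_def mat_diag_def)
    have "(A * P) $$ (r, i) = (A *\<^sub>v v i) $ r"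
      using r i A P colP[OF i] by (simp)
    also have "\<dots> = l i * v i $ r" using vd[OF i] r by simp
    also have "\<dots> = (P * mat_diag n l) $$ (r, i)"
      using r i by (subst mat_diag_mult_right[OF P]) (simp add: P_def)
    finally show "(A * P) $$ (r, i) = (P * mat_diag n l) $$ (r, i)" .
  qed (use A P D in \<open>auto simp: mat_diag_def\<close>)
  show "c = 0\<^sub>v n" if "c \<in> carrier_vec n" "P *\<^sub>v c = 0\<^sub>v n" for c
    using that
  proof (induction "card {i. i < n \<and> c $ i \<noteq> 0}" arbitrary: c rule: less_induct)
    case less
    have Dc: "(mat_diag n l *\<^sub>v c) $ i = l i * c $ i" if "i < n" for i
      using that less.prems(1)
      by (simp add: mat_diag_def scalar_prod_def if_distrib[where f="\<lambda>x. x * _"] sum.delta cong: if_cong)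
    show ?case
    proof (rule ccontr)
      assume "c \<noteq> 0\<^sub>v n"
      then obtain i where i: "i < n" "c $ i \<noteq> 0"
        using less.prems(1) by (metis carrier_vecD eq_vecI index_zero_vec)
      define c' where "c' = mat_diag n l *\<^sub>v c - l i \<cdot>\<^sub>v c"
      have c': "c' \<in> carrier_vec n"
        using Dcarr[OF less.prems(1)] less.prems(1) by (simp add: c'_def)
      have c'j: "c' $ j = (l j - l i) * c $ j" if "j < n" for j
        using that Dc[OF that] less.prems(1) Dcarr[OF less.prems(1)]
        by (simp add: c'_def algebra_simps del: index_mult_mat_vec)
      have "P *\<^sub>v c' = P *\<^sub>v (mat_diag n l *\<^sub>v c) - P *\<^sub>v (l i \<cdot>\<^sub>v c)"
        unfolding c'_def by (rule mult_minus_distrib_mat_vec[OF P]) (use Dcarr less.prems(1) in auto)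
      also have "P *\<^sub>v (mat_diag n l *\<^sub>v c) = A *\<^sub>v (P *\<^sub>v c)"
        using AP assoc_mult_mat_vec[OF P D less.prems(1)] assoc_mult_mat_vec[OF A P less.prems(1)] by simp
      also have "\<dots> = 0\<^sub>v n" using less.prems(2) A by (auto simp: scalar_prod_def)
      also have "P *\<^sub>v (l i \<cdot>\<^sub>v c) = 0\<^sub>v n"
        unfolding mult_mat_vec[OF P less.prems(1)] less.prems(2) by (auto intro!: eq_vecI)
      finally have Pc': "P *\<^sub>v c' = 0\<^sub>v n" by simp
      have "card {j. j < n \<and> c' $ j \<noteq> 0} < card {j. j < n \<and> c $ j \<noteq> 0}"
      proof (rule psubset_card_mono)
        have "j < n \<and> c' $ j \<noteq> 0 \<Longrightarrow> c $ j \<noteq> 0" for j using c'j[of j] by auto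
        then have "{j. j < n \<and> c' $ j \<noteq> 0} \<subseteq> {j. j < n \<and> c $ j \<noteq> 0}" by blast
        moreover have "c' $ i = 0" using c'j[OF i(1)] by simp
        ultimately show "{j. j < n \<and> c' $ j \<noteq> 0} \<subset> {j. j < n \<and> c $ j \<noteq> 0}" using i by blast
      qed simp
      from less.hyps[OF this c' Pc'] have "c' = 0\<^sub>v n" .
      then have c0: "c $ j = 0" if "j < n" "j \<noteq> i" for j
        using c'j[OF that(1)] inj that i(1) by (auto simp: inj_on_def)
      have "(c $ i) \<cdot>\<^sub>v v i = P *\<^sub>v c"
      proof (rule eq_vecI)
        fix r assume "r < dim_vec (P *\<^sub>v c)"
        then have r: "r < n" using P by simp
        have "(P *\<^sub>v c) $ r = (\<Sum>j\<in>{0..<n}. v j $ r * c $ j)"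
          using r less.prems(1) by (simp add: P_def scalar_prod_def)
        also have "\<dots> = (\<Sum>j\<in>{i}. v j $ r * c $ j)"
          by (rule sum.mono_neutral_right) (use i c0 in auto)
        finally show "((c $ i) \<cdot>\<^sub>v v i) $ r = (P *\<^sub>v c) $ r" using vd[OF i(1)] r by simp
      qed (use P vd[OF i(1)] in auto)
      with smult_vec_eq_0D[of "c $ i" "v i" n] ev[OF i(1)] i less.prems(2) show False by auto
    qed
  qed
qed

text \<open>
  With \<open>n\<close> distinct eigenvalues, the chosen eigenvectors form a basis, and in
  coordinates the matrix is diagonal with distinct entries; so each eigenspace is a line.
\<close>

lemma simple_spectrum_eigenvectors:
  fixes A :: "'a::field mat"
  assumes A: "A \<in> carrier_mat n n"
    and ev: "\<And>i. i < n \<Longrightarrow> v i \<in> carrier_vec n \<and> v i \<noteq> 0\<^sub>v n \<and> A *\<^sub>v v i = l i \<cdot>\<^sub>v v i"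
    and inj: "inj_on l {..<n}"
    and w: "w \<in> carrier_vec n" "w \<noteq> 0\<^sub>v n" "A *\<^sub>v w = m \<cdot>\<^sub>v w"
  shows "\<exists>i<n. m = l i \<and> (\<exists>c. w = c \<cdot>\<^sub>v v i)"
proof -
  define P where "P = mat n n (\<lambda>(r, i). v i $ r)"
  note * = eigenvector_basis_injective[OF A ev inj P_def]
  have P: "P \<in> carrier_mat n n" by (simp add: P_def)
  have D: "mat_diag n l \<in> carrier_mat n n" by (simp add: mat_diag_dim)
  have vd: "v i \<in> carrier_vec n" "dim_vec (v i) = n" if "i < n" for i
    using ev[OF that] by (auto dest: carrier_vecD)
  have "det P \<noteq> 0" using det_0_iff_vec_prod_zero[OF P] *(2) by auto
  then obtain Q where Q: "Q \<in> carrier_mat n n" "P * Q = 1\<^sub>m n"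
    using det_non_zero_imp_unit[OF P, of "()"] by (auto simp: Units_def ring_mat_def)
  define c where "c = Q *\<^sub>v w"
  have c: "c \<in> carrier_vec n" using Q w by (simp add: c_def)
  have Dcarr: "mat_diag n l *\<^sub>v c \<in> carrier_vec n" using mult_mat_vec_carrier[OF D c] .
  have Pc: "P *\<^sub>v c = w"
    unfolding c_def using assoc_mult_mat_vec[OF P Q(1) w(1)] Q(2) w(1) by simp
  have Dc: "(mat_diag n l *\<^sub>v c) $ i = l i * c $ i" if "i < n" for i
    using that c
    by (simp add: mat_diag_def scalar_prod_def if_distrib[where f="\<lambda>x. x * _"] sum.delta cong: if_cong)
  have "P *\<^sub>v (mat_diag n l *\<^sub>v c - m \<cdot>\<^sub>v c) = P *\<^sub>v (mat_diag n l *\<^sub>v c) - P *\<^sub>v (m \<cdot>\<^sub>v c)"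
    by (rule mult_minus_distrib_mat_vec[OF P]) (use Dcarr c in auto)
  also have "P *\<^sub>v (mat_diag n l *\<^sub>v c) = A *\<^sub>v (P *\<^sub>v c)"
    using *(1) assoc_mult_mat_vec[OF P D c] assoc_mult_mat_vec[OF A P c] by simp
  also have "P *\<^sub>v (m \<cdot>\<^sub>v c) = m \<cdot>\<^sub>v w" using mult_mat_vec[OF P c] Pc by simp
  finally have "P *\<^sub>v (mat_diag n l *\<^sub>v c - m \<cdot>\<^sub>v c) = 0\<^sub>v n" using Pc w by simp
  then have z: "mat_diag n l *\<^sub>v c - m \<cdot>\<^sub>v c = 0\<^sub>v n" using *(2) Dcarr c by (metis minus_carrier_vec smult_carrier_vec)
  have lc: "(l j - m) * c $ j = 0" if "j < n" for j
  proof -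
    have "(mat_diag n l *\<^sub>v c - m \<cdot>\<^sub>v c) $ j = (l j - m) * c $ j"
      using that Dc[OF that] c Dcarr by (simp add: algebra_simps del: index_mult_mat_vec)
    with z that show ?thesis by simp
  qed
  have "c \<noteq> 0\<^sub>v n" using Pc w(2) P by (auto simp: scalar_prod_def)
  then obtain i where i: "i < n" "c $ i \<noteq> 0"
    using c by (metis carrier_vecD eq_vecI index_zero_vec)
  have m: "m = l i" using lc[OF i(1)] i(2) by simp
  have c0: "c $ j = 0" if "j < n" "j \<noteq> i" for j
    using lc[OF that(1)] inj that i(1) m by (auto simp: inj_on_def)
  have "w = (c $ i) \<cdot>\<^sub>v v i"
  proof (rule eq_vecI)
    fix r assume "r < dim_vec ((c $ i) \<cdot>\<^sub>v v i)"
    then have r: "r < n" using vd[OF i(1)] by simp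
    have "(P *\<^sub>v c) $ r = (\<Sum>j\<in>{0..<n}. v j $ r * c $ j)"
      using r c by (simp add: P_def scalar_prod_def)
    also have "\<dots> = (\<Sum>j\<in>{i}. v j $ r * c $ j)"
      by (rule sum.mono_neutral_right) (use i c0 in auto)
    finally show "w $ r = ((c $ i) \<cdot>\<^sub>v v i) $ r" using vd[OF i(1)] r Pc by simp
  qed (use w vd[OF i(1)] in auto)
  with m i(1) show ?thesis by blast
qed

text \<open>
  The cycles of a permutation of odd order have odd length, and the only partitions of 4 into
  odd parts are 1+3 and 1+1+1+1. The proof follows the orbit of one point and excludes the cycle
  lengths 2 and 4.
\<close>

lemma odd_order_permutation_of_four_fixes:
  assumes S: "card S = 4" and f: "f ` S \<subseteq> S" "inj_on f S"
    and odd: "odd (m::nat)" and fm: "\<And>a. a \<in> S \<Longrightarrow> (f ^^ m) a = a"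
  shows "\<exists>a\<in>S. f a = a"
proof (rule ccontr)
  assume "\<not> ?thesis"
  then have nf: "f a \<noteq> a" if "a \<in> S" for a using that by blast
  have fin: "finite S" using S card.infinite by fastforce
  have two: "f (f a) \<noteq> a" if a: "a \<in> S" for a
  proof
    assume "f (f a) = a"
    then have e: "(f ^^ (2 * k)) a = a" for k
      by (induction k) (auto simp: funpow_add)
    obtain k where "m = Suc (2 * k)" using odd oddE by fastforce
    with fm[OF a] e[of k] nf[OF a] show False by simp
  qed
  have four: "f (f (f (f a))) \<noteq> a" if a: "a \<in> S" for a
  proof
    assume 4: "f (f (f (f a))) = a"
    then have e: "(f ^^ (4 * k)) a = a" for k
      by (induction k) (auto simp: funpow_add eval_nat_numeral)
    obtain j where "m = 2 * j + 1" using odd oddE by blast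
    moreover obtain k where "j = 2 * k \<or> j = 2 * k + 1" by (meson evenE oddE)
    ultimately consider "m = Suc (4 * k)" | "m = Suc (Suc (Suc (4 * k)))" by fastforce
    then show False
    proof cases
      case 1 with fm[OF a] e[of k] nf[OF a] show False by simp
    next
      case 2
      with fm[OF a] e[of k] have "f (f (f a)) = a" by simp
      with 4 nf[OF a] show False by simp
    qed
  qed
  have inX: "f a \<in> S" if "a \<in> S" for a using f that by blast
  have inj: "f a = f b \<Longrightarrow> a = b" if "a \<in> S" "b \<in> S" for a b
    using f(2) that by (auto simp: inj_on_def)
  obtain a where a: "a \<in> S" using S by fastforce
  define b c where "b = f a" and "c = f b"
  have b: "b \<in> S" "b \<noteq> a" and c: "c \<in> S" "c \<noteq> b" "c \<noteq> a"
    using a inX nf two by (auto simp: b_def c_def)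
  have "card {a, b, c} = 3" using b c by auto
  then have "card (S - {a, b, c}) = 1" using S fin a b c by (subst card_Diff_subset) auto
  then obtain d where d: "S - {a, b, c} = {d}" by (auto simp: card_1_singleton_iff)
  then have dX: "d \<in> S" "d \<noteq> a" "d \<noteq> b" "d \<noteq> c" by auto
  have ab: "f a = b" "f b = c" by (simp_all add: b_def c_def)
  have fc: "f c \<in> {a, d}"
    using inX[OF c(1)] d nf[OF c(1)] inj[OF c(1) a] ab c by blast
  have fd: "f d \<in> {a}"
    using inX[OF dX(1)] d nf[OF dX(1)] inj[OF dX(1) a] inj[OF dX(1) b(1)] ab dX by blast
  show False
  proof (cases "f c = a")
    case True
    then have "f c = f d" using fd by simp
    with inj[OF c(1) dX(1)] dX show False by simp
  next
    case False
    then have "f (f (f (f a))) = a" using fc fd ab by simp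
    with four[OF a] show False by simp
  qed
qed

text \<open>
  Lines are sets of vectors, zero included, so that a matrix acts on them by images.
\<close>

definition vec_line :: "'a::field vec \<Rightarrow> 'a vec set" where
  "vec_line v = range (\<lambda>c. c \<cdot>\<^sub>v v)"

definition eigenlines :: "'a::field mat \<Rightarrow> 'a vec set set" where
  "eigenlines A = {vec_line v | v k. eigenvector A v k}"

lemma vec_line_self: "v \<in> vec_line v"
  unfolding vec_line_def by (rule range_eqI[of _ _ 1]) simp

lemma vec_line_smult:
  assumes "c \<noteq> 0"
  shows "vec_line (c \<cdot>\<^sub>v v) = vec_line (v :: 'a::field vec)"
proof -
  have "d \<cdot>\<^sub>v v \<in> range (\<lambda>d. d \<cdot>\<^sub>v (c \<cdot>\<^sub>v v))" for d
    by (rule range_eqI[of _ _ "d / c"]) (use assms in \<open>simp add: smult_smult_assoc\<close>)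
  then show ?thesis by (auto simp: vec_line_def smult_smult_assoc)
qed

lemma image_vec_line:
  assumes "A \<in> carrier_mat n n" "v \<in> carrier_vec n"
  shows "(\<lambda>w. A *\<^sub>v w) ` vec_line v = vec_line (A *\<^sub>v v)"
  using mult_mat_vec[OF assms] by (auto simp: vec_line_def image_image)

lemma eigenvectorI:
  assumes "A \<in> carrier_mat n n" "v \<in> carrier_vec n" "v \<noteq> 0\<^sub>v n" "A *\<^sub>v v = k \<cdot>\<^sub>v v"
  shows "eigenvector A v k"
  using assms by (auto simp: eigenvector_def)

lemma eigenvectorD:
  assumes "eigenvector A v k" "A \<in> carrier_mat n n"
  shows "v \<in> carrier_vec n" "v \<noteq> 0\<^sub>v n" "A *\<^sub>v v = k \<cdot>\<^sub>v v"
  using assms by (auto simp: eigenvector_def)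

lemma simple_spectrum_basis:
  fixes A :: "'a::field mat"
  assumes A: "A \<in> carrier_mat n n" and spec: "card {k. eigenvalue A k} = n" and n: "n > 0"
  obtains l v where "inj_on l {..<n}" "\<And>i. i < n \<Longrightarrow> eigenvector A (v i) (l i)"
    "\<And>w k. eigenvector A w k \<Longrightarrow> \<exists>i<n. k = l i \<and> (\<exists>c. c \<noteq> 0 \<and> w = c \<cdot>\<^sub>v v i)"
proof -
  have fin: "finite {k. eigenvalue A k}" using spec n card.infinite by fastforce
  obtain l where l: "bij_betw l {..<n} {k. eigenvalue A k}"
    using ex_bij_betw_nat_finite[OF fin] spec by (auto simp: atLeast0LessThan)
  then have "\<forall>i. \<exists>v. i < n \<longrightarrow> eigenvector A v (l i)"
    by (auto simp: bij_betw_def eigenvalue_def)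
  then obtain v where v: "\<And>i. i < n \<Longrightarrow> eigenvector A (v i) (l i)" by metis
  have inj: "inj_on l {..<n}" using l by (simp add: bij_betw_def)
  show ?thesis
  proof (rule that[OF inj v])
    fix w k assume w: "eigenvector A w k"
    obtain i c where ic: "i < n" "k = l i" "w = c \<cdot>\<^sub>v v i"
      using simple_spectrum_eigenvectors[OF A _ inj eigenvectorD[OF w A], of v]
        eigenvectorD[OF v A] by blast
    moreover have "c \<noteq> 0"
    proof
      assume "c = 0"
      then have "w = 0\<^sub>v n" using ic carrier_vecD[OF eigenvectorD(1)[OF v A]] by (intro eq_vecI) auto
      then show False using eigenvectorD(2)[OF w A] by simp
    qed
    ultimately show "\<exists>i<n. k = l i \<and> (\<exists>c. c \<noteq> 0 \<and> w = c \<cdot>\<^sub>v v i)" by blast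
  qed
qed

lemma card_eigenlines:
  fixes A :: "'a::field mat"
  assumes A: "A \<in> carrier_mat n n" and spec: "card {k. eigenvalue A k} = n" and n: "n > 0"
  shows "card (eigenlines A) = n"
proof -
  obtain l v where l: "inj_on l {..<n}" and v: "\<And>i. i < n \<Longrightarrow> eigenvector A (v i) (l i)"
    and all: "\<And>w k. eigenvector A w k \<Longrightarrow> \<exists>i<n. k = l i \<and> (\<exists>c. c \<noteq> 0 \<and> w = c \<cdot>\<^sub>v v i)"
    using simple_spectrum_basis[OF assms] by metis
  have "eigenlines A = (\<lambda>i. vec_line (v i)) ` {..<n}"
  proof (intro equalityI subsetI)
    fix e assume "e \<in> eigenlines A"
    then obtain w k where "e = vec_line w" "eigenvector A w k" by (auto simp: eigenlines_def)
    with all[OF this(2)] show "e \<in> (\<lambda>i. vec_line (v i)) ` {..<n}"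
      by (auto simp: vec_line_smult)
  qed (use v in \<open>auto simp: eigenlines_def\<close>)
  moreover have "inj_on (\<lambda>i. vec_line (v i)) {..<n}"
  proof (rule inj_onI)
    fix i j assume ij: "i \<in> {..<n}" "j \<in> {..<n}" "vec_line (v i) = vec_line (v j)"
    then obtain c where c: "v i = c \<cdot>\<^sub>v v j"
      using vec_line_self[of "v i"] by (auto simp: vec_line_def)
    note vi = eigenvectorD[OF v A]
    have "(l i - l j) \<cdot>\<^sub>v v i = 0\<^sub>v n"
    proof (rule eq_vecI)
      fix r assume "r < dim_vec (0\<^sub>v n :: 'a vec)"
      then have r: "r < n" by simp
      have "l i \<cdot>\<^sub>v v i = A *\<^sub>v (c \<cdot>\<^sub>v v j)" using vi(3)[of i] ij c by simp
      also have "\<dots> = l j \<cdot>\<^sub>v v i"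
        using mult_mat_vec[OF A vi(1), of j c] vi(3)[of j] ij c
        by (simp add: smult_smult_assoc mult.commute)
      finally have "(l i \<cdot>\<^sub>v v i) $ r = (l j \<cdot>\<^sub>v v i) $ r" by simp
      then show "((l i - l j) \<cdot>\<^sub>v v i) $ r = 0\<^sub>v n $ r"
        using r carrier_vecD[OF vi(1)[of i]] ij by (simp add: algebra_simps)
    qed (use carrier_vecD[OF vi(1)[of i]] ij in simp)
    then have "l i - l j = 0" using smult_vec_eq_0D[OF _ vi(1) vi(2)] ij by blast
    then show "i = j" using l ij by (auto simp: inj_on_def)
  qed
  ultimately show ?thesis by (simp add: card_image)
qed

lemma commuting_preserves_eigenvectors:
  fixes A :: "'a::field mat"
  assumes A: "A \<in> carrier_mat n n" and spec: "card {k. eigenvalue A k} = n" and n: "n > 0"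
    and B: "B \<in> carrier_mat n n" and comm: "A * B = B * A" and w: "eigenvector A w k"
  shows "\<exists>m. eigenvector B w m"
proof -
  obtain l v where l: "inj_on l {..<n}" and v: "\<And>i. i < n \<Longrightarrow> eigenvector A (v i) (l i)"
    and all: "\<And>w k. eigenvector A w k \<Longrightarrow> \<exists>i<n. k = l i \<and> (\<exists>c. c \<noteq> 0 \<and> w = c \<cdot>\<^sub>v v i)"
    using simple_spectrum_basis[OF A spec n] by metis
  note w' = eigenvectorD[OF w A]
  have Bw: "B *\<^sub>v w \<in> carrier_vec n" using mult_mat_vec_carrier[OF B w'(1)] .
  have ABw: "A *\<^sub>v (B *\<^sub>v w) = k \<cdot>\<^sub>v (B *\<^sub>v w)"
    using assoc_mult_mat_vec[OF A B w'(1)] assoc_mult_mat_vec[OF B A w'(1)] comm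
      mult_mat_vec[OF B w'(1)] w'(3) by simp
  have "\<exists>m. B *\<^sub>v w = m \<cdot>\<^sub>v w"
  proof (cases "B *\<^sub>v w = 0\<^sub>v n")
    case True
    then show ?thesis using w'(1) by (intro exI[of _ 0]) auto
  next
    case False
    obtain i c where i: "i < n" "k = l i" "c \<noteq> 0" "w = c \<cdot>\<^sub>v v i" using all[OF w] by blast
    obtain j d where j: "j < n" "k = l j" "B *\<^sub>v w = d \<cdot>\<^sub>v v j"
      using all[OF eigenvectorI[OF A Bw False ABw]] by blast
    have "i = j" using i j l by (auto simp: inj_on_def)
    then have "B *\<^sub>v w = (d / c) \<cdot>\<^sub>v w" using i j by (simp add: smult_smult_assoc)
    then show ?thesis by blast
  qed
  then show ?thesis using eigenvectorI[OF B w'(1,2)] by blast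
qed

lemma pow_mat_vec_iterate:
  assumes "C \<in> carrier_mat n n" "v \<in> carrier_vec n"
  shows "((\<lambda>w. C *\<^sub>v w) ^^ k) v = (C ^\<^sub>m k) *\<^sub>v v"
  using assms(2)
proof (induction k arbitrary: v)
  case (Suc k)
  show ?case
    using Suc.IH[OF mult_mat_vec_carrier[OF assms(1) Suc.prems]]
      assoc_mult_mat_vec[OF pow_carrier_mat[OF assms(1)] assms(1) Suc.prems, of k]
    by (simp add: funpow_Suc_right del: funpow.simps)
qed (use assms in simp)

text \<open>
  As \<open>A\<close> and \<open>A'\<close> commute and have simple spectrum, they have the same
  four eigenlines, and \<open>C\<close> maps the eigenlines of \<open>A\<close> to those of
  \<open>A'\<close>. So \<open>C\<close> permutes four lines; its order is odd, hence it fixes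
  one of them.
\<close>

lemma odd_order_common_eigenvector:
  fixes A :: "'a::field mat"
  assumes A: "A \<in> carrier_mat 4 4" "card {k. eigenvalue A k} = 4"
    and A': "A' \<in> carrier_mat 4 4" "card {k. eigenvalue A' k} = 4"
    and comm: "A * A' = A' * A"
    and C: "C \<in> carrier_mat 4 4" "C * A = A' * C" and odd: "odd m" "C ^\<^sub>m m = 1\<^sub>m 4"
  obtains v k j where "eigenvector A v k" "eigenvector C v j"
proof -
  have sub: "eigenlines A \<subseteq> eigenlines A'"
    using commuting_preserves_eigenvectors[OF A _ A'(1) comm] unfolding eigenlines_def by fastforce
  have "eigenlines A' \<subseteq> eigenlines A"
    using commuting_preserves_eigenvectors[OF A' _ A(1) comm[symmetric]]
    unfolding eigenlines_def by fastforce
  with sub have eq: "eigenlines A' = eigenlines A" by blast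
  define F where "F = (\<lambda>e. (\<lambda>w. C *\<^sub>v w) ` e)"
  have Cm: "(C ^\<^sub>m m) *\<^sub>v v = v" if "v \<in> carrier_vec 4" for v
    using odd that by simp
  have C0: "C *\<^sub>v v \<noteq> 0\<^sub>v 4" if v: "v \<in> carrier_vec 4" "v \<noteq> 0\<^sub>v 4" for v
  proof
    assume 0: "C *\<^sub>v v = 0\<^sub>v 4"
    obtain j where j: "m = Suc j" using odd by (cases m) auto
    have "C ^\<^sub>m j * C = C ^\<^sub>m m" using j by simp
    then have "v = C ^\<^sub>m j *\<^sub>v (C *\<^sub>v v)"
      using assoc_mult_mat_vec[OF pow_carrier_mat[OF C(1)] C(1) v(1), of j] Cm[OF v(1)] by simp
    also have "\<dots> = 0\<^sub>v 4" unfolding 0 using carrier_matD[OF pow_carrier_mat[OF C(1), of j]]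
      by (intro eq_vecI) (auto simp: scalar_prod_def)
    finally show False using v by simp
  qed
  have Fline: "F (vec_line v) = vec_line (C *\<^sub>v v)" if "v \<in> carrier_vec 4" for v
    unfolding F_def by (rule image_vec_line[OF C(1) that])
  have Fe: "F e \<in> eigenlines A" if eA: "e \<in> eigenlines A" for e
  proof -
    obtain v k where e: "e = vec_line v" and v: "eigenvector A v k"
      using eA unfolding eigenlines_def by blast
    note v' = eigenvectorD[OF v A(1)]
    have "A' *\<^sub>v (C *\<^sub>v v) = k \<cdot>\<^sub>v (C *\<^sub>v v)"
      using assoc_mult_mat_vec[OF A'(1) C(1) v'(1)] assoc_mult_mat_vec[OF C(1) A(1) v'(1)] C(2)
        mult_mat_vec[OF C(1) v'(1)] v'(3) by simp
    then have "eigenvector A' (C *\<^sub>v v) k"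
      using eigenvectorI[OF A'(1) mult_mat_vec_carrier[OF C(1) v'(1)] C0[OF v'(1,2)]] by blast
    then have "F e \<in> eigenlines A'" using Fline[OF v'(1)] e by (auto simp: eigenlines_def)
    with eq show ?thesis by simp
  qed
  have Fpow: "(F ^^ j) (vec_line v) = vec_line ((C ^\<^sub>m j) *\<^sub>v v)" if v: "v \<in> carrier_vec 4" for v j
  proof (induction j)
    case (Suc j)
    have "(F ^^ Suc j) (vec_line v) = F (vec_line ((C ^\<^sub>m j) *\<^sub>v v))" using Suc by simp
    also have "\<dots> = vec_line (C *\<^sub>v ((C ^\<^sub>m j) *\<^sub>v v))"
      by (rule Fline) (use mult_mat_vec_carrier[OF pow_carrier_mat[OF C(1)] v] in simp)
    also have "C *\<^sub>v ((C ^\<^sub>m j) *\<^sub>v v) = (C ^\<^sub>m Suc j) *\<^sub>v v"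
      using pow_mat_vec_iterate[OF C(1) v, of j] pow_mat_vec_iterate[OF C(1) v, of "Suc j"]
      by simp
    finally show ?case .
  qed (use v C in simp)
  have Fm: "(F ^^ m) e = e" if "e \<in> eigenlines A" for e
    using that Fpow Cm eigenvectorD[OF _ A(1)] by (auto simp: eigenlines_def)
  have inj: "inj_on F (eigenlines A)"
  proof (rule inj_onI)
    fix e e' assume e: "e \<in> eigenlines A" "e' \<in> eigenlines A" "F e = F e'"
    obtain j where j: "m = Suc j" using odd by (cases m) auto
    have "(F ^^ m) e = (F ^^ m) e'" using e(3) by (simp add: j funpow_Suc_right del: funpow.simps)
    then show "e = e'" using Fm e by simp
  qed
  obtain e where e: "e \<in> eigenlines A" "F e = e"
    using odd_order_permutation_of_four_fixes[OF card_eigenlines[OF A] _ inj odd(1) Fm] Fe by auto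
  then obtain v k where v: "e = vec_line v" "eigenvector A v k" unfolding eigenlines_def by blast
  note v' = eigenvectorD[OF v(2) A(1)]
  have "C *\<^sub>v v \<in> vec_line v"
    using e(2) Fline[OF v'(1)] v(1) vec_line_self[of "C *\<^sub>v v"] by simp
  then obtain j where "C *\<^sub>v v = j \<cdot>\<^sub>v v" by (auto simp: vec_line_def)
  then have "eigenvector C v j" using eigenvectorI[OF C(1) v'(1,2)] by blast
  with v(2) that show ?thesis by blast
qed

text \<open>
  Take \<open>u = (A - 1) w \<noteq> 0\<close>. It is annihilated by \<open>p(A)\<close> with
  \<open>p = 1 + x + \<dots> + x\<^sup>m\<^sup>-\<^sup>1\<close>. Split \<open>p\<close> into
  linear factors and apply them to \<open>u\<close> one after the other; the vector that is
  killed first is an eigenvector whose eigenvalue is a root of \<open>p\<close>. As \<open>p(1)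
  = m \<noteq> 0\<close>, this eigenvalue is not 1.
\<close>

lemma finite_order_eigenvalue_neq_one:
  fixes A :: "'a::alg_closed_field mat"
  assumes A: "A \<in> carrier_mat n n" and m: "A ^\<^sub>m m = 1\<^sub>m n" "of_nat m \<noteq> (0 :: 'a)" and neq: "A \<noteq> 1\<^sub>m n"
  shows "\<exists>k. k \<noteq> 1 \<and> eigenvalue A k"
proof -
  define F where "F = (\<lambda>w. A *\<^sub>v w)"
  define ev where "ev = (\<lambda>p u. vec n (\<lambda>r. \<Sum>i\<le>degree p. coeff p i * ((F ^^ i) u $ r)))"
  have ev_carrier: "ev p u \<in> carrier_vec n" for p u by (simp add: ev_def)
  have Fc: "(F ^^ i) u \<in> carrier_vec n" if "u \<in> carrier_vec n" for i u
    using that A by (induction i) (auto simp: F_def)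
  have ev_le: "ev p u $ r = (\<Sum>i\<le>d. coeff p i * ((F ^^ i) u $ r))" if "degree p \<le> d" "r < n" for p u r d
    using that by (auto simp: ev_def intro!: sum.mono_neutral_left coeff_eq_0)
  have F_ev: "F (ev p u) $ r = (\<Sum>i\<le>degree p. coeff p i * ((F ^^ Suc i) u $ r))"
    if u: "u \<in> carrier_vec n" and r: "r < n" for p u r
  proof -
    have "F (ev p u) $ r = (\<Sum>j=0..<n. A $$ (r, j) * (\<Sum>i\<le>degree p. coeff p i * ((F ^^ i) u $ j)))"
      using r A by (simp add: F_def ev_def scalar_prod_def)
    also have "\<dots> = (\<Sum>i\<le>degree p. coeff p i * (\<Sum>j=0..<n. A $$ (r, j) * ((F ^^ i) u $ j)))"
      by (simp add: sum_distrib_left sum.swap[of _ "{..degree p}"] mult.left_commute)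
    also have "\<dots> = (\<Sum>i\<le>degree p. coeff p i * ((F ^^ Suc i) u $ r))"
      using r A carrier_vecD[OF Fc[OF u]] by (simp add: F_def scalar_prod_def)
    finally show ?thesis .
  qed
  have ev_mult: "ev ([:- z, 1:] * p) u = F (ev p u) - z \<cdot>\<^sub>v ev p u" if u: "u \<in> carrier_vec n" for z p u
  proof (rule eq_vecI)
    fix r assume "r < dim_vec (F (ev p u) - z \<cdot>\<^sub>v ev p u)"
    then have r: "r < n" by (simp add: ev_def)
    let ?g = "\<lambda>i. (F ^^ i) u $ r"
    have "ev ([:- z, 1:] * p) u $ r = (\<Sum>i\<le>Suc (degree p). coeff ([:- z, 1:] * p) i * ?g i)"
      by (rule ev_le[OF _ r]) (use degree_mult_le[of "[:- z, 1:]" p] in simp)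
    also have "\<dots> = (\<Sum>i\<le>Suc (degree p). (case i of 0 \<Rightarrow> 0 | Suc k \<Rightarrow> coeff p k) * ?g i)
        - z * (\<Sum>i\<le>Suc (degree p). coeff p i * ?g i)"
      by (simp add: coeff_pCons algebra_simps sum_subtractf sum_distrib_left)
    also have "(\<Sum>i\<le>Suc (degree p). (case i of 0 \<Rightarrow> 0 | Suc k \<Rightarrow> coeff p k) * ?g i) = F (ev p u) $ r"
      unfolding F_ev[OF u r] by (subst sum.atMost_Suc_shift) simp
    also have "(\<Sum>i\<le>Suc (degree p). coeff p i * ?g i) = ev p u $ r"
      by (rule ev_le[symmetric, OF _ r]) simp
    finally show "ev ([:- z, 1:] * p) u $ r = (F (ev p u) - z \<cdot>\<^sub>v ev p u) $ r"
      using r by (simp add: ev_def)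
  qed (simp add: ev_def)
  have key: "\<exists>k. poly p k = 0 \<and> eigenvalue A k"
    if "p \<noteq> 0" "u \<in> carrier_vec n" "u \<noteq> 0\<^sub>v n" "ev p u = 0\<^sub>v n" for p u
    using that
  proof (induction "degree p" arbitrary: p)
    case 0
    then obtain c where c: "p = [:c:]" by (metis degree_eq_zeroE)
    have "c \<cdot>\<^sub>v u = ev p u" using \<open>u \<in> carrier_vec n\<close> by (intro eq_vecI) (auto simp: ev_def c)
    then show ?case using 0 c smult_vec_eq_0D[of c u n] by simp
  next
    case (Suc d)
    obtain z where z: "poly p z = 0"
      using alg_closed_imp_poly_has_root[of p] Suc.hyps(2) by auto
    then obtain r where r: "p = [:- z, 1:] * r" by (metis poly_eq_0_iff_dvd dvdE)
    have r0: "r \<noteq> 0" using r Suc.prems by auto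
    have d: "d = degree r" using Suc.hyps(2) r0 unfolding r by (simp add: degree_mult_eq del: mult_pCons_left)
    show ?case
    proof (cases "ev r u = 0\<^sub>v n")
      case True
      from Suc.hyps(1)[OF d r0 Suc.prems(2,3) True] show ?thesis unfolding r by auto
    next
      case False
      have *: "F (ev r u) - z \<cdot>\<^sub>v ev r u = 0\<^sub>v n"
        using ev_mult[OF Suc.prems(2), of z r] Suc.prems(4) r by simp
      have "F (ev r u) = z \<cdot>\<^sub>v ev r u"
      proof (rule eq_vecI)
        fix i assume "i < dim_vec (z \<cdot>\<^sub>v ev r u)"
        then have i: "i < n" by (simp add: ev_def)
        with * have "(F (ev r u) - z \<cdot>\<^sub>v ev r u) $ i = 0" by simp
        then show "F (ev r u) $ i = (z \<cdot>\<^sub>v ev r u) $ i" using i by (simp add: ev_def)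
      qed (use A in \<open>simp add: F_def ev_def\<close>)
      then have "eigenvector A (ev r u) z"
        using eigenvectorI[OF A ev_carrier False] by (simp add: F_def)
      with z show ?thesis by (auto simp: eigenvalue_def)
    qed
  qed
  have Fm: "(F ^^ m) v = v" if "v \<in> carrier_vec n" for v
    using pow_mat_vec_iterate[OF A that, of m] m(1) that by (simp add: F_def)
  obtain j where j: "j < n" "col A j \<noteq> unit_vec n j"
  proof (rule ccontr)
    assume "\<not> thesis"
    then have "col A j = unit_vec n j" if "j < n" for j using that \<open>\<And>j. j < n \<Longrightarrow> _ \<Longrightarrow> thesis\<close> by blast
    then have "A $$ (i, j) = (1\<^sub>m n) $$ (i, j)" if "i < n" "j < n" for i j
      using that A by (metis carrier_matD index_col index_one_mat(1) index_unit_vec(1) )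
    then have "A = 1\<^sub>m n" using A by (intro eq_matI) auto
    with neq show False by simp
  qed
  define w where "w = (unit_vec n j :: 'a vec)"
  define u where "u = F w - w"
  have w: "w \<in> carrier_vec n" by (simp add: w_def)
  have Fw: "F w = col A j" using A j(1) by (intro eq_vecI) (auto simp: F_def w_def)
  have u: "u \<in> carrier_vec n" using w Fc[OF w, of 1] by (simp add: u_def)
  have u0: "u \<noteq> 0\<^sub>v n"
  proof
    assume "u = 0\<^sub>v n"
    then have "u $ i = 0" if "i < n" for i using that by simp
    then have "F w $ i = w $ i" if "i < n" for i using that w by (simp add: u_def)
    then have "F w = w" using Fc[OF w, of 1] w by (intro eq_vecI) auto
    with j Fw show False by (simp add: w_def)
  qed
  define p where "p = (\<Sum>i<m. monom (1::'a) i)"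
  have pc: "coeff p i = (if i < m then 1 else 0)" for i by (simp add: p_def coeff_sum)
  have m0: "m > 0" using m(2) by (cases m) auto
  have p0: "p \<noteq> 0" using pc[of 0] m0 by auto
  have p1: "poly p 1 = of_nat m" by (simp add: p_def poly_sum poly_monom)
  have "ev p u = 0\<^sub>v n"
  proof (rule eq_vecI)
    fix r assume "r < dim_vec (0\<^sub>v n :: 'a vec)"
    then have r: "r < n" by simp
    have Fu: "(F ^^ i) u = (F ^^ Suc i) w - (F ^^ i) w" for i
    proof (induction i)
      case (Suc i)
      have "F ((F ^^ Suc i) w - (F ^^ i) w) = F ((F ^^ Suc i) w) - F ((F ^^ i) w)"
        unfolding F_def by (rule mult_minus_distrib_mat_vec[OF A]) (use Fc[OF w, of i] Fc[OF w, of "Suc i"] in \<open>simp_all add: F_def\<close>)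
      then show ?case using Suc by simp
    qed (simp add: u_def)
    have "degree p \<le> m" using pc by (intro degree_le) simp
    then have "ev p u $ r = (\<Sum>i\<le>m. coeff p i * ((F ^^ i) u $ r))" by (rule ev_le[OF _ r])
    also have "\<dots> = (\<Sum>i<m. (F ^^ i) u $ r)"
      by (rule sum.mono_neutral_cong_right) (auto simp: pc)
    also have "\<dots> = (\<Sum>i<m. (F ^^ Suc i) w $ r - (F ^^ i) w $ r)"
      by (rule sum.cong[OF refl], subst Fu, rule index_minus_vec) (use r carrier_vecD[OF Fc[OF w]] in simp)
    also have "\<dots> = (F ^^ m) w $ r - (F ^^ 0) w $ r"
      by (rule sum_lessThan_telescope)
    also have "\<dots> = 0" using Fm[OF w] by simp
    finally show "ev p u $ r = 0\<^sub>v n $ r" using r by simp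
  qed (simp add: ev_def)
  from key[OF p0 u u0 this] obtain k where "poly p k = 0" "eigenvalue A k" by blast
  with p1 m(2) show ?thesis by metis
qed

section \<open>Groups in which centralizers are abelian and self-normalizing\<close>

text \<open>
  The assumptions say that distinct centralizers of nontrivial elements meet trivially, are
  abelian, and that no two elements of one centralizer are conjugate in \<open>G\<close>. So the
  conjugates of the nontrivial elements of a centralizer \<open>C a\<close> form a set \<open>I
  a\<close> with \<open>card G * (1 - 1 / card (C a))\<close> elements, which is at least half
  of the order of \<open>G\<close>. There is no room for two disjoint such sets among the
  nontrivial elements. Hence \<open>I a\<close> contains all of them, and comparing
  cardinalities gives that \<open>C a\<close> is the whole group.
\<close>

theorem (in group) commutative_if_centralizers_abelian_self_normalizing:
  assumes fin: "finite (carrier G)"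
    and trans: "\<And>x y z. \<lbrakk>x \<in> carrier G; y \<in> carrier G; z \<in> carrier G; y \<noteq> \<one>;
      x \<otimes> y = y \<otimes> x; y \<otimes> z = z \<otimes> y\<rbrakk> \<Longrightarrow> x \<otimes> z = z \<otimes> x"
    and norm: "\<And>c x y. \<lbrakk>c \<in> carrier G; x \<in> carrier G; y \<in> carrier G; x \<noteq> \<one>; y \<noteq> \<one>;
      c \<otimes> x = y \<otimes> c; x \<otimes> y = y \<otimes> x\<rbrakk> \<Longrightarrow> c \<otimes> x = x \<otimes> c"
    and x: "x \<in> carrier G" and y: "y \<in> carrier G"
  shows "x \<otimes> y = y \<otimes> x"
proof -
  have cancel: "inv g \<otimes> (g \<otimes> z) = z" "g \<otimes> (inv g \<otimes> z) = z"
    if "g \<in> carrier G" "z \<in> carrier G" for g z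
    using that by (simp_all add: m_assoc[symmetric])
  define K where "K = carrier G - {\<one>}"
  define C where "C a = {x \<in> carrier G. x \<otimes> a = a \<otimes> x}" for a
  define conj where "conj = (\<lambda>(g, x). g \<otimes> x \<otimes> inv g)"
  define I where "I a = conj ` (carrier G \<times> (C a - {\<one>}))" for a
  have C_sub: "C a \<subseteq> carrier G" for a by (auto simp: C_def)
  have finC: "finite (C a)" for a using fin C_sub finite_subset by blast
  have one_C: "\<one> \<in> C a" if "a \<in> carrier G" for a using that by (simp add: C_def)
  have self_C: "a \<in> C a" if "a \<in> carrier G" for a using that by (simp add: C_def)
  have I_sub: "I a \<subseteq> K" for a
  proof
    fix b assume "b \<in> I a"
    then obtain g x where b: "b = g \<otimes> x \<otimes> inv g" "g \<in> carrier G" "x \<in> carrier G" "x \<noteq> \<one>"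
      using C_sub[of a] by (auto simp: I_def conj_def)
    have "x = inv g \<otimes> b \<otimes> g" using b by (simp add: m_assoc cancel)
    then have "b \<noteq> \<one>" using b by auto
    with b show "b \<in> K" by (simp add: K_def)
  qed
  have card_I: "card (I a) * card (C a) = card (carrier G) * (card (C a) - 1)" if a: "a \<in> K" for a
  proof -
    have aG: "a \<in> carrier G" "a \<noteq> \<one>" using a by (auto simp: K_def)
    have fiber: "card {p \<in> carrier G \<times> (C a - {\<one>}). conj p = b} = card (C a)" if b: "b \<in> I a" for b
    proof -
      obtain g0 x0 where g0: "g0 \<in> carrier G" "x0 \<in> C a" "x0 \<noteq> \<one>" "b = g0 \<otimes> x0 \<otimes> inv g0"
        using b by (auto simp: I_def conj_def)
      have x0G: "x0 \<in> carrier G" using g0 C_sub by blast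
      have "{p \<in> carrier G \<times> (C a - {\<one>}). conj p = b} = (\<lambda>c. (g0 \<otimes> c, x0)) ` C a"
      proof (intro equalityI subsetI)
        fix p assume "p \<in> {p \<in> carrier G \<times> (C a - {\<one>}). conj p = b}"
        then obtain g x where p: "p = (g, x)" "g \<in> carrier G" "x \<in> C a" "x \<noteq> \<one>"
          "g \<otimes> x \<otimes> inv g = g0 \<otimes> x0 \<otimes> inv g0"
          using g0 by (auto simp: conj_def)
        have xG: "x \<in> carrier G" using p C_sub by blast
        define c where "c = inv g0 \<otimes> g"
        have c: "c \<in> carrier G" using g0 p by (simp add: c_def)
        have "c \<otimes> x = inv g0 \<otimes> (g \<otimes> x \<otimes> inv g) \<otimes> g"
          using g0(1) p(2) xG by (simp add: c_def m_assoc)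
        also have "\<dots> = x0 \<otimes> c"
          unfolding p(5) using g0 p x0G by (simp add: c_def m_assoc cancel)
        finally have cx: "c \<otimes> x = x0 \<otimes> c" .
        have "x \<otimes> x0 = x0 \<otimes> x"
          by (rule trans[OF xG aG(1) x0G aG(2)]) (use p g0 in \<open>auto simp: C_def\<close>)
        with norm[OF c xG x0G p(4) g0(3) cx] have cxx: "c \<otimes> x = x \<otimes> c" .
        have "c \<otimes> a = a \<otimes> c"
          by (rule trans[OF c xG aG(1) p(4) cxx]) (use p in \<open>auto simp: C_def\<close>)
        then have "c \<in> C a" using c by (simp add: C_def)
        moreover have "x = x0" using cx cxx c xG x0G by simp
        moreover have "g = g0 \<otimes> c" using g0 p by (simp add: c_def cancel)
        ultimately show "p \<in> (\<lambda>c. (g0 \<otimes> c, x0)) ` C a" using p by blast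
      next
        fix p assume "p \<in> (\<lambda>c. (g0 \<otimes> c, x0)) ` C a"
        then obtain c where c: "c \<in> C a" "p = (g0 \<otimes> c, x0)" by blast
        have cG: "c \<in> carrier G" using c C_sub by blast
        have "c \<otimes> x0 = x0 \<otimes> c"
          by (rule trans[OF cG aG(1) x0G aG(2)]) (use c g0 in \<open>auto simp: C_def\<close>)
        then have "g0 \<otimes> c \<otimes> x0 \<otimes> inv (g0 \<otimes> c) = g0 \<otimes> x0 \<otimes> c \<otimes> (inv c \<otimes> inv g0)"
          using cG x0G g0 by (simp add: m_assoc inv_mult_group)
        also have "\<dots> = g0 \<otimes> x0 \<otimes> inv g0"
          using cG x0G g0 by (simp add: m_assoc cancel)
        finally show "p \<in> {p \<in> carrier G \<times> (C a - {\<one>}). conj p = b}"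
          using c cG g0 by (auto simp: conj_def)
      qed
      moreover have "inj_on (\<lambda>c. (g0 \<otimes> c, x0)) (C a)"
        using g0(1) C_sub[of a] by (auto simp: inj_on_def subset_eq)
      ultimately show ?thesis by (simp add: card_image)
    qed
    have "card (carrier G \<times> (C a - {\<one>})) = (\<Sum>b\<in>I a. card {p \<in> carrier G \<times> (C a - {\<one>}). conj p = b})"
      using sum.image_gen[of "carrier G \<times> (C a - {\<one>})" "\<lambda>_. 1::nat" conj] fin finC
      by (simp add: I_def)
    also have "\<dots> = card (I a) * card (C a)" using fiber by simp
    finally show ?thesis
      using one_C[OF aG(1)] finC by (simp add: card_cartesian_product mult.commute)
  qed
  have K_less: "card K < card (carrier G)"
    using fin by (intro psubset_card_mono) (auto simp: K_def)
  have half: "card (carrier G) \<le> 2 * card (I a) \<and> card (I a) < card (carrier G)" if a: "a \<in> K" for a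
  proof -
    have "{\<one>, a} \<subseteq> C a" using a one_C self_C by (auto simp: K_def)
    then have c2: "card (C a) \<ge> 2" using card_mono[OF finC, of "{\<one>, a}" a] a by (auto simp: K_def)
    then obtain k where k: "card (C a) = k + 2" using le_Suc_ex by (metis add.commute)
    have "card (I a) * (k + 2) = card (carrier G) * (k + 1)" using card_I[OF a] k by simp
    moreover have "card (I a) \<le> card K" using I_sub fin by (intro card_mono) (auto simp: K_def)
    moreover have "card (carrier G) * (k + 2) \<le> 2 * (card (carrier G) * (k + 1))" by (simp add: algebra_simps)
    ultimately have "card (carrier G) * (k + 2) \<le> (2 * card (I a)) * (k + 2)" by (simp add: algebra_simps)
    then have "card (carrier G) \<le> 2 * card (I a)" by (subst (asm) mult_le_cancel2) simp
    then show ?thesis using \<open>card (I a) \<le> card K\<close> K_less by simp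
  qed
  have covers: "I a = K" if a: "a \<in> K" for a
  proof (rule ccontr)
    assume "I a \<noteq> K"
    then obtain b where b: "b \<in> K" "b \<notin> I a" using I_sub by blast
    have aG: "a \<in> carrier G" "a \<noteq> \<one>" and bG: "b \<in> carrier G" "b \<noteq> \<one>" using a b by (auto simp: K_def)
    have "I a \<inter> I b = {}"
    proof (rule ccontr)
      assume "I a \<inter> I b \<noteq> {}"
      then obtain g x h z where gx: "g \<in> carrier G" "x \<in> C a" "x \<noteq> \<one>" "h \<in> carrier G" "z \<in> C b" "z \<noteq> \<one>"
        "g \<otimes> x \<otimes> inv g = h \<otimes> z \<otimes> inv h"
        by (auto simp: I_def conj_def)
      have xG: "x \<in> carrier G" and zG: "z \<in> carrier G" using gx C_sub by blast+
      define c where "c = inv h \<otimes> g"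
      have c: "c \<in> carrier G" using gx by (simp add: c_def)
      have "c \<otimes> x \<otimes> inv c = inv h \<otimes> (g \<otimes> x \<otimes> inv g) \<otimes> h"
        using gx(1,4) xG by (simp add: c_def m_assoc inv_mult_group)
      also have "\<dots> = z" unfolding gx(7) using gx zG by (simp add: m_assoc cancel)
      finally have z: "z = c \<otimes> x \<otimes> inv c" ..
      define b' where "b' = inv c \<otimes> b \<otimes> c"
      have b': "b' \<in> carrier G" using c bG by (simp add: b'_def)
      have b'b: "b = c \<otimes> b' \<otimes> inv c"
        using c bG by (simp add: b'_def m_assoc cancel)
      have zb: "z \<otimes> b = b \<otimes> z" using gx by (simp add: C_def)
      have "x \<otimes> b' = inv c \<otimes> (z \<otimes> b) \<otimes> c"
        unfolding z b'_def using c bG xG by (simp add: m_assoc cancel)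
      also have "\<dots> = b' \<otimes> x"
        unfolding zb unfolding z b'_def using c bG xG by (simp add: m_assoc cancel)
      finally have xb': "x \<otimes> b' = b' \<otimes> x" .
      have "a \<otimes> b' = b' \<otimes> a"
        by (rule trans[OF aG(1) xG b' gx(3) _ xb']) (use gx in \<open>auto simp: C_def\<close>)
      moreover have "b' \<noteq> \<one>" using b'b bG c by auto
      ultimately have "b \<in> I a" unfolding I_def using b' c b'b by (force simp: conj_def C_def)
      with b(2) show False ..
    qed
    then have "card (I a) + card (I b) = card (I a \<union> I b)"
      using I_sub fin by (intro card_Un_disjoint[symmetric]) (auto simp: K_def intro: finite_subset)
    also have "\<dots> \<le> card K" using I_sub fin by (intro card_mono) (auto simp: K_def)
    also have "\<dots> < card (carrier G)" by (rule K_less)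
    finally show False using half[OF a] half[OF b(1)] by simp
  qed
  show ?thesis
  proof (cases "x = \<one>")
    case False
    then have xK: "x \<in> K" using x by (simp add: K_def)
    have fC: "card (C x) \<le> card (carrier G)" using C_sub fin by (simp add: card_mono)
    have cK: "card K = card (carrier G) - 1" using fin by (simp add: K_def)
    have o: "card (carrier G) > 0" using fin by (auto simp: card_gt_0_iff)
    have c0: "card (C x) > 0" using one_C[OF x] finC by (auto simp: card_gt_0_iff)
    have "(card (carrier G) - 1) * card (C x) = card (carrier G) * (card (C x) - 1)"
      using card_I[OF xK] covers[OF xK] cK by simp
    moreover obtain n where n: "card (carrier G) = Suc n" using o gr0_implies_Suc by blast
    moreover obtain c where c: "card (C x) = Suc c" using c0 gr0_implies_Suc by blast
    ultimately have "n * Suc c = Suc n * c" by simp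
    then have "card (C x) = card (carrier G)" unfolding n c by simp
    then have "C x = carrier G" using C_sub fin by (simp add: card_subset_eq)
    with y have "y \<in> C x" by blast
    then show ?thesis by (simp add: C_def)
  qed (use y in simp)
qed

section \<open>Explicit matrices of size 4\<close>

lemma mat4_carrier: "length rs = 4 \<Longrightarrow> mat_of_rows_list 4 rs \<in> carrier_mat 4 4"
  by (rule carrier_matI) (simp_all add: mat_of_rows_list_def)

lemma mat4_mult:
  "mat_of_rows_list 4 [[a00, a01, a02, a03], [a10, a11, a12, a13], [a20, a21, a22, a23], [a30, a31, a32, a33]] * mat_of_rows_list 4 [[b00, b01, b02, b03], [b10, b11, b12, b13], [b20, b21, b22, b23], [b30, b31, b32, b33]] =
   (mat_of_rows_list 4 [[a00*b00+a01*b10+a02*b20+a03*b30, a00*b01+a01*b11+a02*b21+a03*b31, a00*b02+a01*b12+a02*b22+a03*b32, a00*b03+a01*b13+a02*b23+a03*b33],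
     [a10*b00+a11*b10+a12*b20+a13*b30, a10*b01+a11*b11+a12*b21+a13*b31, a10*b02+a11*b12+a12*b22+a13*b32, a10*b03+a11*b13+a12*b23+a13*b33],
     [a20*b00+a21*b10+a22*b20+a23*b30, a20*b01+a21*b11+a22*b21+a23*b31, a20*b02+a21*b12+a22*b22+a23*b32, a20*b03+a21*b13+a22*b23+a23*b33],
     [a30*b00+a31*b10+a32*b20+a33*b30, a30*b01+a31*b11+a32*b21+a33*b31, a30*b02+a31*b12+a32*b22+a33*b32, a30*b03+a31*b13+a32*b23+a33*b33]] :: 'a::comm_ring_1 mat)"
  by (rule eq_matI) (auto simp: mat_of_rows_list_def scalar_prod_def less_Suc_eq numeral_eq_Suc)

lemma det2:
  assumes "A \<in> carrier_mat 2 2"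
  shows "det A = (A $$ (0,0) * A $$ (1,1) - A $$ (0,1) * A $$ (1,0) :: 'a::comm_ring_1)"
  using assms by (subst laplace_expansion_row[OF assms, of 0])
    (auto simp: cofactor_def eval_nat_numeral det_single mat_delete_def)

lemma det3:
  assumes "A \<in> carrier_mat 3 3"
  shows "det A = A $$ (0,0) * (A $$ (1,1) * A $$ (2,2) - A $$ (1,2) * A $$ (2,1))
    - A $$ (0,1) * (A $$ (1,0) * A $$ (2,2) - A $$ (1,2) * A $$ (2,0))
    + A $$ (0,2) * (A $$ (1,0) * A $$ (2,1) - A $$ (1,1) * A $$ (2,0) :: 'a::comm_ring_1)"
  using assms by (subst laplace_expansion_row[OF assms, of 0])
    (auto simp: cofactor_def eval_nat_numeral det2 mat_delete_def algebra_simps)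

lemma det4:
  "det (mat_of_rows_list 4 [[a00, a01, a02, a03], [a10, a11, a12, a13], [a20, a21, a22, a23], [a30, a31, a32, a33]]) =
   (a00*a11*a22*a33 - a00*a11*a23*a32 - a00*a12*a21*a33 + a00*a12*a23*a31 + a00*a13*a21*a32 -
     a00*a13*a22*a31 - a01*a10*a22*a33 + a01*a10*a23*a32 + a01*a12*a20*a33 - a01*a12*a23*a30 -
     a01*a13*a20*a32 + a01*a13*a22*a30 + a02*a10*a21*a33 - a02*a10*a23*a31 - a02*a11*a20*a33 +
     a02*a11*a23*a30 + a02*a13*a20*a31 - a02*a13*a21*a30 - a03*a10*a21*a32 + a03*a10*a22*a31 +
     a03*a11*a20*a32 - a03*a11*a22*a30 - a03*a12*a20*a31 + a03*a12*a21*a30 :: 'a::comm_ring_1)"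
proof -
  let ?A = "mat_of_rows_list 4 [[a00, a01, a02, a03], [a10, a11, a12, a13], [a20, a21, a22, a23], [a30, a31, a32, a33]]"
  have A: "?A \<in> carrier_mat 4 4" by (rule mat4_carrier) simp
  have c: "mat_delete ?A 0 j \<in> carrier_mat 3 3" for j
    using mat_delete_carrier[OF A, of 0 j] by simp
  have "det ?A = a00 * det (mat_delete ?A 0 0) - a01 * det (mat_delete ?A 0 1)
     + a02 * det (mat_delete ?A 0 2) - a03 * det (mat_delete ?A 0 3)"
    by (subst laplace_expansion_row[OF A, of 0])
      (simp_all add: cofactor_def mat_of_rows_list_def eval_nat_numeral)
  then show ?thesis unfolding det3[OF c]
    by (simp add: mat_delete_def mat_of_rows_list_def eval_nat_numeral algebra_simps)
qed

section \<open>The field automorphism and the Bruhat decomposition of the Suzuki group\<close>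

locale suzuki_field =
  fixes f :: nat and F :: "'q::{field,finite} itself"
  assumes card_field: "card (UNIV :: 'q set) = 2 ^ (2 * f + 1)"
begin

abbreviation \<theta> :: "'q \<Rightarrow> 'q" where "\<theta> \<equiv> suzuki_theta f"
abbreviation S :: "'q \<Rightarrow> 'q \<Rightarrow> 'q mat" where "S \<equiv> suzuki_S f"
abbreviation M :: "'q \<Rightarrow> 'q mat" where "M \<equiv> suzuki_M f"
abbreviation T :: "'q mat" where "T \<equiv> suzuki_T"

text \<open>
  The lower left entry of \<open>S a b\<close>, which is also the last coordinate of the point
  \<open>(1, a, b, N a b)\<close> of the Suzuki-Tits ovoid.
\<close>

definition N :: "'q \<Rightarrow> 'q \<Rightarrow> 'q" where "N a b = a ^ 2 * \<theta> a + a * b + \<theta> b"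

lemma two_eq_0: "(2::'q) = 0"
proof -
  have "(\<Sum>x\<in>UNIV. x + 1 :: 'q) = (\<Sum>x\<in>UNIV. x)"
    by (rule sum.reindex_bij_witness[of _ "\<lambda>x. x - 1" "\<lambda>x. x + 1"]) auto
  then have "of_nat (card (UNIV :: 'q set)) = (0 :: 'q)" by (simp add: sum.distrib)
  then have "(2 :: 'q) ^ (2 * f + 1) = 0" unfolding card_field by (simp only: of_nat_power of_nat_numeral)
  then show ?thesis by (metis power_not_zero)
qed

lemma char2 [simp]: "(x::'q) + x = 0" "- x = (x::'q)"
proof -
  show "x + x = 0" using two_eq_0 by (metis mult_2 mult_zero_left)
  then show "- x = x" by (simp add: add_eq_0_iff)
qed

lemma char2_cancel: "(x::'q) + (x + y) = y" "(x::'q) - y = x + y"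
  by (simp_all add: add.assoc[symmetric] diff_conv_add_uminus del: add_uminus_conv_diff)

lemmas char2_normalize = two_eq_0 char2_cancel algebra_simps power2_eq_square power3_eq_cube

text \<open>
  Multiplication by \<open>x \<noteq> 0\<close> permutes the nonzero elements and so preserves
  their product.
\<close>

lemma power_card: "x ^ (2 ^ (2 * f + 1)) = (x::'q)"
proof (cases "x = 0")
  case False
  let ?U = "UNIV - {0::'q}"
  have "(\<Prod>y\<in>?U. x * y) = (\<Prod>y\<in>?U. y)"
    by (rule prod.reindex_bij_witness[of _ "\<lambda>y. y / x" "\<lambda>y. x * y"]) (use False in auto)
  then have "x ^ card ?U * (\<Prod>y\<in>?U. y) = (\<Prod>y\<in>?U. y)" by (simp add: prod.distrib)
  moreover have "(\<Prod>y\<in>?U. y) \<noteq> 0" by simp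
  ultimately have 1: "x ^ card ?U = 1" by simp
  have "(2::nat) ^ (2 * f + 1) = Suc (card ?U)" using card_field by (simp add: card_Diff_subset)
  then have "x ^ (2 ^ (2 * f + 1)) = x * x ^ card ?U" by (simp only: power_Suc)
  with 1 show ?thesis by simp
qed simp

lemma frobenius_add: "(x + y :: 'q) ^ (2 ^ n) = x ^ (2 ^ n) + y ^ (2 ^ n)"
proof (induction n)
  case (Suc n)
  have e: "(2::nat) ^ Suc n = 2 ^ n * 2" by simp
  show ?case unfolding e power_mult Suc.IH power2_sum using two_eq_0 by simp
qed simp

lemma theta_simps [simp]: "\<theta> 0 = 0" "\<theta> 1 = 1" "\<theta> x = 0 \<longleftrightarrow> x = 0"
  by (simp_all add: suzuki_theta_def)

lemma theta_add: "\<theta> (x + y) = \<theta> x + \<theta> y"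
  unfolding suzuki_theta_def by (rule frobenius_add)

lemma theta_mult: "\<theta> (x * y) = \<theta> x * \<theta> y"
  by (simp add: suzuki_theta_def power_mult_distrib)

lemma theta_divide: "\<theta> (x / y) = \<theta> x / \<theta> y"
  by (simp add: suzuki_theta_def power_divide)

lemma theta_power: "\<theta> (x ^ n) = \<theta> x ^ n"
  by (simp add: suzuki_theta_def power_mult[symmetric] mult.commute)

lemma theta_theta: "\<theta> (\<theta> x) = x ^ 2"
proof -
  have "(2::nat) ^ (f + 1) * 2 ^ (f + 1) = 2 ^ (2 * f + 1) * 2"
    by (subst power_add[symmetric], subst power_Suc2[symmetric], rule arg_cong) simp
  then have "\<theta> (\<theta> x) = (x ^ (2 ^ (2 * f + 1))) ^ 2"
    unfolding suzuki_theta_def by (simp only: power_mult[symmetric])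
  then show ?thesis unfolding power_card .
qed

lemma theta_half: "\<theta> (x ^ (2 ^ f)) = x"
proof -
  have "\<theta> (x ^ (2 ^ f)) = x ^ (2 ^ (2 * f + 1))"
    unfolding suzuki_theta_def power_mult[symmetric] power_add[symmetric] by (simp add: mult_2)
  then show ?thesis unfolding power_card .
qed

lemma half_theta: "\<theta> x ^ (2 ^ f) = x"
  using theta_half theta_power by metis

lemma half_square: "(x ^ (2 ^ f)) ^ 2 = \<theta> x"
  by (simp add: suzuki_theta_def power_mult[symmetric] mult.commute)

lemmas theta_rules = theta_add theta_mult theta_divide theta_power theta_theta

text \<open>
  After scaling, a zero with \<open>a \<noteq> 0\<close> gives \<open>c\<close> with
  \<open>\<theta> c = 1 + c\<close>. Applying \<open>\<theta>\<close> twice shows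
  \<open>c\<^sup>2 = c\<close>, so \<open>c\<close> is 0 or 1 and is fixed by
  \<open>\<theta>\<close>, a contradiction.
\<close>

lemma N_nonzero: "N a b = 0 \<longleftrightarrow> a = 0 \<and> b = 0"
proof
  assume 0: "N a b = 0"
  show "a = 0 \<and> b = 0"
  proof (cases "a = 0")
    case True
    with 0 show ?thesis by (simp add: N_def)
  next
    case False
    define c where "c = b / (a * \<theta> a)"
    have b: "b = c * (a * \<theta> a)" using False by (simp add: c_def)
    have "a ^ 2 * \<theta> a * (1 + c + \<theta> c) = 0"
      using 0 unfolding N_def b by (simp add: theta_rules algebra_simps power2_eq_square)
    then have e: "1 + c + \<theta> c = 0" using False by simp
    then have t: "\<theta> c = 1 + c" using add_eq_0_iff char2(2) by metis
    have "c ^ 2 = \<theta> (1 + c)" using theta_theta[of c] t by simp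
    also have "\<dots> = 1 + (1 + c)" using t by (simp add: theta_add)
    also have "\<dots> = (1 + 1) + c" by (simp only: add.assoc)
    also have "\<dots> = c" by (simp only: char2 add_0)
    finally have "c * (c - 1) = 0" by (simp add: power2_eq_square algebra_simps)
    then have "c = 0 \<or> c = 1" by simp
    with t show ?thesis by (metis add.right_neutral char2(1) theta_simps(1,2) zero_neq_one)
  qed
qed (simp add: N_def)

lemma S_explicit: "S a b = mat_of_rows_list 4 [[1, 0, 0, 0], [a, 1, 0, 0], [b, \<theta> a, 1, 0],
    [N a b, a * \<theta> a + b, a, 1]]"
  by (simp add: suzuki_S_def Let_def N_def)

lemma M_explicit: "M t = mat_of_rows_list 4 [[t * t ^ (2 ^ f), 0, 0, 0], [0, t ^ (2 ^ f), 0, 0],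
    [0, 0, inverse (t ^ (2 ^ f)), 0], [0, 0, 0, inverse (t * t ^ (2 ^ f))]]"
  by (simp add: suzuki_M_def power_inverse)

lemma carriers [simp]: "S a b \<in> carrier_mat 4 4" "M t \<in> carrier_mat 4 4" "T \<in> carrier_mat 4 4"
  by (simp_all add: S_explicit M_explicit suzuki_T_def mat4_carrier)

lemma S_mult: "S a b * S c d = S (a + c) (b + d + \<theta> a * c)"
  unfolding S_explicit mat4_mult using two_eq_0
  by (simp add: N_def theta_rules algebra_simps power2_eq_square)

lemma M_mult: "M s * M t = M (s * t)"
  unfolding M_explicit mat4_mult by (simp add: power_mult_distrib mult_ac)

lemma T_mult: "T * T = 1\<^sub>m 4"
  unfolding suzuki_T_def mat4_mult
  by (rule eq_matI) (auto simp: mat_of_rows_list_def less_Suc_eq numeral_eq_Suc)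

lemma S_0: "S 0 0 = 1\<^sub>m 4" and M_1: "M 1 = 1\<^sub>m 4"
  unfolding S_explicit M_explicit
  by (rule eq_matI; auto simp: N_def mat_of_rows_list_def less_Suc_eq numeral_eq_Suc)+

lemma M_S:
  assumes t: "t \<noteq> 0"
  shows "M t * S a b = S (a / t) (b / (t * \<theta> t)) * M t"
proof -
  define m where "m = t ^ (2 ^ f)"
  have m: "m \<noteq> 0" "\<theta> t = m ^ 2" using t by (simp_all add: m_def half_square)
  have tm: "\<theta> m = t" unfolding m_def by (rule theta_half)
  show ?thesis
    unfolding S_explicit M_explicit mat4_mult m_def[symmetric] N_def
    using t m by (intro arg_cong[where f = "mat_of_rows_list 4"])
      (simp add: theta_rules tm field_simps power2_eq_square)
qed

lemma T_M: "T * M t = M (inverse t) * T"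
  unfolding M_explicit suzuki_T_def mat4_mult by (simp add: power_inverse)

text \<open>
  The relation that makes the Bruhat decomposition work. Both sides map the last coordinate line
  to that of \<open>(1, b/n, a/n, 1/n)\<close> with \<open>n = N a b\<close>, which determines
  \<open>p\<close> and \<open>k\<close>; the lower right entry \<open>n\<close> of \<open>M
  t\<close> determines \<open>t\<close>, and comparing first rows gives \<open>c\<close> and
  \<open>d = b\<close>.
\<close>

lemma T_S_T:
  assumes "(a, b) \<noteq> (0, 0)"
  shows "\<exists>p k c d t. t \<noteq> 0 \<and> T * S a b * T = S p k * T * (S c d * M t)"
proof -
  define A B n m where "A = \<theta> a" and "B = \<theta> b" and "n = N a b" and "m = \<theta> n"
  have n0: "n \<noteq> 0" using assms by (simp add: n_def N_nonzero)
  have m0: "m \<noteq> 0" using n0 by (simp add: m_def)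
  have n: "n = a ^ 2 * A + a * b + B" by (simp add: n_def N_def A_def B_def)
  have tA: "\<theta> A = a ^ 2" "\<theta> B = b ^ 2" by (simp_all add: A_def B_def theta_theta)
  have m: "m = a ^ 2 * A ^ 2 + A * B + b ^ 2"
    unfolding m_def n by (simp add: theta_rules tA A_def[symmetric] B_def[symmetric] mult.commute)
  define t where "t = m / n ^ 2"
  have t0: "t \<noteq> 0" using n0 m0 by (simp add: t_def)
  have th: "t ^ (2 ^ f) = n / m"
  proof -
    have "t ^ (2 ^ f) = m ^ (2 ^ f) / (n ^ (2 ^ f)) ^ 2"
      by (simp add: t_def power_divide power_mult[symmetric] mult.commute)
    then show ?thesis by (simp add: half_square m_def half_theta)
  qed
  have tt: "t * t ^ (2 ^ f) = 1 / n" unfolding th unfolding t_def using n0 m0 by (simp add: power2_eq_square)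
  define c where "c = (a * A + b) * n / m"
  have tc: "\<theta> c = (a ^ 2 * A + B) * m / n ^ 2"
    unfolding c_def by (simp add: theta_rules tA A_def[symmetric] B_def[symmetric] m_def[symmetric])
      (simp add: m_def theta_theta mult_ac)
  have M_t: "M t = mat_of_rows_list 4 [[1 / n, 0, 0, 0], [0, n / m, 0, 0], [0, 0, m / n, 0], [0, 0, 0, n]]"
    unfolding M_explicit tt unfolding th using n0 m0 by simp
  (* This identity gives d = b and makes the last coordinate of the point (c, d) equal to n. *)
  have i1: "(a * A + b) * (a ^ 2 * A + B) = a * m + b * n"
    unfolding m n by (simp add: char2_normalize)
  have cc: "c * \<theta> c + b = a * m / n"
  proof -
    have "c * \<theta> c = (a * A + b) * (a ^ 2 * A + B) / n"
      unfolding tc unfolding c_def using n0 m0 by (simp add: field_simps power2_eq_square)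
    also have "\<dots> = a * m / n + b" unfolding i1 using n0 by (simp add: field_simps)
    finally show ?thesis by (simp add: add.assoc)
  qed
  have Nc: "N c b = n"
  proof -
    have "N c b = c * (c * \<theta> c + b) + B" by (simp add: N_def B_def algebra_simps power2_eq_square)
    also have "\<dots> = a * (a * A + b) + B" unfolding cc unfolding c_def using n0 m0 by simp
    also have "\<dots> = n" unfolding n by (simp add: algebra_simps power2_eq_square)
    finally show ?thesis .
  qed
  have S_c: "S c b = mat_of_rows_list 4 [[1, 0, 0, 0], [c, 1, 0, 0], [b, (a ^ 2 * A + B) * m / n ^ 2, 1, 0],
    [n, a * m / n, c, 1]]"
    unfolding S_explicit Nc cc unfolding tc ..
  define p k where "p = b / n" and "k = a / n"
  have tp: "\<theta> p = B / m" "\<theta> k = A / m" by (simp_all add: p_def k_def theta_divide A_def B_def m_def)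
  have i2: "b ^ 2 * B + a * b * m + A * n ^ 2 = n * m"
    unfolding m n by (simp add: char2_normalize)
  have Np: "N p k = 1 / n"
  proof -
    have "N p k = (b ^ 2 * B + a * b * m + A * n ^ 2) / (n ^ 2 * m)"
      unfolding N_def tp unfolding p_def k_def using n0 m0 by (simp add: field_simps power2_eq_square)
    also have "\<dots> = 1 / n" unfolding i2 using n0 m0 by (simp add: power2_eq_square)
    finally show ?thesis .
  qed
  have S_p: "S p k = mat_of_rows_list 4 [[1, 0, 0, 0], [b / n, 1, 0, 0], [a / n, B / m, 1, 0],
    [1 / n, (b * B + a * m) / (n * m), b / n, 1]]"
    unfolding S_explicit Np unfolding tp unfolding p_def k_def using n0 m0 by (simp add: field_simps)
  have lhs: "T * S a b * T = mat_of_rows_list 4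
    [[1, a, a * A + b, n], [0, 1, A, b], [0, 0, 1, a], [0, 0, 0, 1]]"
    unfolding S_explicit suzuki_T_def mat4_mult by (simp add: A_def n_def)
  define V W where "V = a ^ 2 * A + B" and "W = a * A + b"
  have ids: "V + a * b = n" "B + a * W = n" "m + b * W = n * A"
    "W * n + b * B + a * m = 0" "n * n + B * V + a * a * m = 0"
    "b * n * n + (b * B + a * m) * V + a * m * n = 0"
    unfolding m n V_def W_def by (simp_all add: char2_normalize)
  have c: "c * m = W * n" unfolding c_def W_def using m0 by simp
  (* The entries of the product that do not simplify by themselves, in the shape in which they arise.
     Each is reduced to one of the identities above by a common denominator. *)
  have entries: "c * m / n = W" "V * n / n\<^sup>2 + b * a / n = 1" "m / n + b * (c * m) / (n * n) = A"
    "c / n + B * b / (m * n) + a / n = 0" "n / m + B * (V * n) / (m * n\<^sup>2) + a * a / n = 0"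
    "B / n + a * (c * m) / (n * n) = 1" "b * c / (n * n) + (b * B + a * m) * b / (n * m * n) = 0"
    "b / m + (b * B + a * m) * V / (m * n\<^sup>2) + a / n = 0"
    "(b * B + a * m) / (n * n) + c * m / (n * n) = 0"
  proof -
    show "c * m / n = W" unfolding c using n0 by simp
    have "V * n / n\<^sup>2 + b * a / n = (V + a * b) / n" using n0 by (simp add: field_simps power2_eq_square)
    then show "V * n / n\<^sup>2 + b * a / n = 1" unfolding ids using n0 by simp
    have "m / n + b * (W * n) / (n * n) = (m + b * W) / n" using n0 by (simp add: field_simps)
    then show "m / n + b * (c * m) / (n * n) = A" unfolding c ids using n0 by simp
    have "c / n + B * b / (m * n) + a / n = (c * m + b * B + a * m) / (m * n)"
      using n0 m0 by (simp add: field_simps)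
    then show "c / n + B * b / (m * n) + a / n = 0" unfolding c ids by simp
    have "n / m + B * (V * n) / (m * n\<^sup>2) + a * a / n = (n * n + B * V + a * a * m) / (m * n)"
      using n0 m0 by (simp add: field_simps power2_eq_square)
    then show "n / m + B * (V * n) / (m * n\<^sup>2) + a * a / n = 0" unfolding ids by simp
    have "B / n + a * (W * n) / (n * n) = (B + a * W) / n" using n0 by (simp add: field_simps)
    then show "B / n + a * (c * m) / (n * n) = 1" unfolding c ids using n0 by simp
    have "b * c / (n * n) + (b * B + a * m) * b / (n * m * n) = b * (c * m + b * B + a * m) / (n * m * n)"
      using n0 m0 by (simp add: field_simps)
    then show "b * c / (n * n) + (b * B + a * m) * b / (n * m * n) = 0" unfolding c ids by simp
    have "b / m + (b * B + a * m) * V / (m * n\<^sup>2) + a / n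
        = (b * n * n + (b * B + a * m) * V + a * m * n) / (m * n * n)"
      using n0 m0 by (simp add: field_simps power2_eq_square)
    then show "b / m + (b * B + a * m) * V / (m * n\<^sup>2) + a / n = 0" unfolding ids by simp
    have "(b * B + a * m) / (n * n) + W * n / (n * n) = (W * n + b * B + a * m) / (n * n)"
      by (simp add: add_divide_distrib)
    then show "(b * B + a * m) / (n * n) + c * m / (n * n) = 0" unfolding c ids by simp
  qed
  have entries': "m / n + b * W / n = A" "B / n + a * W / n = 1" "(b * B + a * m) / (n * n) + W / n = 0"
    using entries(3,6,9) n0 unfolding c by simp_all
  have "S p k * T * (S c b * M t) = T * S a b * T"
    unfolding lhs unfolding S_p S_c M_t suzuki_T_def mat4_mult V_def[symmetric] W_def[symmetric]
    by (rule arg_cong[where f = "mat_of_rows_list 4"]) (simp add: n0 m0 entries entries' two_eq_0)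
  with t0 show ?thesis by metis
qed

end

lemma char_poly_mat4:
  "char_poly (mat_of_rows_list 4 [[a00, a01, a02, a03], [a10, a11, a12, a13], [a20, a21, a22, a23], [a30, a31, a32, a33]]) =
   det (mat_of_rows_list 4 [[[:- a00, 1:], [:- a01:], [:- a02:], [:- a03:]], [[:- a10:], [:- a11, 1:], [:- a12:], [:- a13:]], [[:- a20:], [:- a21:], [:- a22, 1:], [:- a23:]], [[:- a30:], [:- a31:], [:- a32:], [:- a33, 1:]]] :: 'a::comm_ring_1 poly mat)"
  unfolding char_poly_defs
  by (intro arg_cong[where f = det] eq_matI)
    (auto simp: mat_of_rows_list_def less_Suc_eq numeral_eq_Suc)

lemmas assoc_mat4 = assoc_mult_mat[of _ 4 4 _ 4 _ 4]

context suzuki_field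
begin

lemma S_inverse: "S a b * S a (b + \<theta> a * a) = 1\<^sub>m 4" "S a (b + \<theta> a * a) * S a b = 1\<^sub>m 4"
  by (simp_all add: S_mult S_0 char2_normalize)

text \<open>
  The middle coefficient is determined by the trace because the exterior square of the natural
  module has, apart from two trivial factors, only its twist by \<open>\<theta>\<close> as
  composition factor.
\<close>

definition suzuki_char_poly :: "'q \<Rightarrow> 'q poly" where
  "suzuki_char_poly \<tau> = [:1, \<tau>, \<theta> \<tau>, \<tau>, 1:]"

lemma char_poly_Borel:
  assumes "t \<noteq> 0"
  shows "\<exists>\<tau>. char_poly (S a b * M t) = suzuki_char_poly \<tau>"
proof -
  define m where "m = t ^ (2 ^ f)"
  have m: "m \<noteq> 0" "\<theta> t = m ^ 2" "\<theta> m = t" using assms by (simp_all add: m_def half_square theta_half)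
  have i: "\<theta> (inverse z) = inverse (\<theta> z)" for z by (simp add: suzuki_theta_def power_inverse)
  have "char_poly (S a b * M t) = suzuki_char_poly (t * m + m + inverse m + inverse (t * m))"
    unfolding S_explicit M_explicit m_def[symmetric] mat4_mult
    using assms m
    by (simp add: char_poly_mat4 det4 suzuki_char_poly_def theta_rules i field_simps)
      (simp add: char2_normalize power4_eq_xxxx)
  then show ?thesis ..
qed

text \<open>
  The trace of this matrix is \<open>\<theta> x m + N x y t m\<close> with \<open>m = t ^ (2 ^
  f)\<close>.
\<close>

lemma char_poly_opposite:
  assumes "t \<noteq> 0"
  shows "\<exists>\<tau>. char_poly (S x y * (M t * T)) = suzuki_char_poly \<tau>"
proof -
  define m where "m = t ^ (2 ^ f)"
  have m: "m \<noteq> 0" "\<theta> t = m ^ 2" "\<theta> m = t" using assms by (simp_all add: m_def half_square theta_half)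
  define A B where "A = \<theta> x" and "B = \<theta> y"
  have tA: "\<theta> A = x ^ 2" "\<theta> B = y ^ 2" by (simp_all add: A_def B_def theta_theta)
  have "char_poly (S x y * (M t * T)) = suzuki_char_poly (A * m + (x ^ 2 * A + x * y + B) * (t * m))"
    unfolding S_explicit M_explicit m_def[symmetric] suzuki_T_def mat4_mult N_def A_def[symmetric] B_def[symmetric]
    using assms m
    by (simp add: char_poly_mat4 det4 suzuki_char_poly_def theta_rules m tA A_def[symmetric] B_def[symmetric] field_simps)
      (simp add: char2_normalize power4_eq_xxxx)
  then show ?thesis ..
qed

abbreviation G :: "'q mat monoid" where "G \<equiv> suzuki_group f F"

lemma G_mult [simp]: "x \<otimes>\<^bsub>G\<^esub> y = x * y" and G_one [simp]: "\<one>\<^bsub>G\<^esub> = 1\<^sub>m 4"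
  by (simp_all add: suzuki_group_def GL4_def units_of_def ring_mat_def)

lemma GL4_mult [simp]: "x \<otimes>\<^bsub>GL4 F\<^esub> y = x * y" and GL4_one [simp]: "\<one>\<^bsub>GL4 F\<^esub> = 1\<^sub>m 4"
  by (simp_all add: GL4_def units_of_def ring_mat_def)

lemma GL4_carrier: "x \<in> carrier (GL4 F) \<Longrightarrow> x \<in> carrier_mat 4 4"
  by (simp add: GL4_def units_of_def Units_def ring_mat_def)

definition generators :: "'q mat set" where
  "generators = {S a b | a b. True} \<union> {M t | t. t \<noteq> 0} \<union> {T}"

lemma carrier_G: "carrier G = generate (GL4 F) generators"
  by (simp add: suzuki_group_def generators_def)

lemma generators_GL4: "generators \<subseteq> carrier (GL4 F)"
  by (auto simp: generators_def suzuki_generators_in_GL4)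

interpretation GL4: group "GL4 F" by (rule group_GL4)
sublocale G: group G by (rule group_suzuki_group)

lemma G_sub_GL4: "x \<in> carrier G \<Longrightarrow> x \<in> carrier (GL4 F)"
  using GL4.generate_incl[OF generators_GL4] by (auto simp: carrier_G)

lemma G_carrier_mat: "x \<in> carrier G \<Longrightarrow> x \<in> carrier_mat 4 4"
  using G_sub_GL4 GL4_carrier by blast

lemma generators_G: "S a b \<in> carrier G" "t \<noteq> 0 \<Longrightarrow> M t \<in> carrier G" "T \<in> carrier G"
  by (auto simp: carrier_G generators_def intro: generate.incl)

lemma finite_G: "finite (carrier G)"
proof (rule finite_subset)
  show "carrier G \<subseteq> (\<lambda>h. mat 4 4 h) ` (({0..<4} \<times> {0..<4}) \<rightarrow>\<^sub>E UNIV)"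
  proof
    fix x assume "x \<in> carrier G"
    then have x: "x \<in> carrier_mat 4 4" by (rule G_carrier_mat)
    have "x = mat 4 4 (restrict (\<lambda>ij. x $$ ij) ({0..<4} \<times> {0..<4}))"
      using x by (intro eq_matI) auto
    moreover have "restrict (\<lambda>ij. x $$ ij) ({0..<4} \<times> {0..<4}) \<in> ({0..<4} \<times> {0..<4}) \<rightarrow>\<^sub>E UNIV"
      by simp
    ultimately show "x \<in> (\<lambda>h. mat 4 4 h) ` (({0..<4} \<times> {0..<4}) \<rightarrow>\<^sub>E UNIV)"
      by (rule image_eqI)
  qed
  show "finite ((\<lambda>h. mat 4 4 h :: 'q mat) ` (({0..<4} \<times> {0..<4}) \<rightarrow>\<^sub>E UNIV))"
    by (intro finite_imageI finite_PiE) auto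
qed

text \<open>
  The two double cosets of the Borel subgroup of the matrices \<open>S a b * M t\<close>; in the
  second one, the left factor may be taken unipotent because \<open>T\<close> inverts the torus.
\<close>

definition Bruhat_cells :: "'q mat set" where
  "Bruhat_cells = {S a b * M t | a b t. t \<noteq> 0} \<union> {S a b * (T * (S c d * M t)) | a b c d t. t \<noteq> 0}"

lemma Bruhat_cells_carrier: "x \<in> Bruhat_cells \<Longrightarrow> x \<in> carrier_mat 4 4"
  by (auto simp: Bruhat_cells_def intro!: mult_carrier_mat[of _ 4 4])

lemma cellI1: "t \<noteq> 0 \<Longrightarrow> S a b * M t \<in> Bruhat_cells"
  and cellI2: "t \<noteq> 0 \<Longrightarrow> S a b * (T * (S c d * M t)) \<in> Bruhat_cells"
  unfolding Bruhat_cells_def by blast+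

lemma S_cells:
  assumes "x \<in> Bruhat_cells" shows "S a b * x \<in> Bruhat_cells"
proof -
  have *: "S a b * (S c d * y) = S (a + c) (b + d + \<theta> a * c) * y" if "y \<in> carrier_mat 4 4" for c d y
    using that by (simp add: S_mult[symmetric] assoc_mat4)
  from assms show ?thesis
    by (auto simp: Bruhat_cells_def * mult_carrier_mat[of _ 4 4])
qed

lemma M_mult_left: "y \<in> carrier_mat 4 4 \<Longrightarrow> t \<noteq> 0 \<Longrightarrow>
    M t * (S a b * y) = S (a / t) (b / (t * \<theta> t)) * (M t * y)"
  using assoc_mat4[of "M t" "S a b" y] assoc_mat4[of "S (a / t) (b / (t * \<theta> t))" "M t" y] by (simp add: M_S)

lemma M_cells:
  assumes "x \<in> Bruhat_cells" "s \<noteq> 0" shows "M s * x \<in> Bruhat_cells"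
proof -
  have MT: "M s * (T * y) = T * (M (inverse s) * y)" if "y \<in> carrier_mat 4 4" for y
    using that T_M[of "inverse s"] by (simp add: assoc_mat4[symmetric])
  from assms(1) consider (1) a b t where "t \<noteq> 0" "x = S a b * M t"
    | (2) a b c d t where "t \<noteq> 0" "x = S a b * (T * (S c d * M t))"
    unfolding Bruhat_cells_def by blast
  then show ?thesis
  proof cases
    case 1
    then show ?thesis using assms(2) by (simp add: M_mult_left M_mult cellI1)
  next
    case 2
    have "M s * x = S (a / s) (b / (s * \<theta> s)) * (T * (M (inverse s) * (S c d * M t)))"
      using 2 assms(2) by (simp add: M_mult_left MT mult_carrier_mat[of _ 4 4])
    also have "M (inverse s) * (S c d * M t) = S (c / inverse s) (d / (inverse s * \<theta> (inverse s))) * M (inverse s * t)"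
      using assms(2) by (simp add: M_mult_left M_mult)
    finally show ?thesis using 2 assms(2) by (simp only:) (rule cellI2, simp)
  qed
qed

lemma T_cells:
  assumes "x \<in> Bruhat_cells" shows "T * x \<in> Bruhat_cells"
proof -
  from assms consider (1) a b t where "t \<noteq> 0" "x = S a b * M t"
    | (2) a b c d t where "t \<noteq> 0" "x = S a b * (T * (S c d * M t))"
    unfolding Bruhat_cells_def by blast
  then show ?thesis
  proof cases
    case 1
    have "T * x = S 0 0 * (T * (S a b * M t))"
      using 1 left_mult_one_mat[of "T * (S a b * M t)" 4 4] by (simp add: S_0 mult_carrier_mat[of _ 4 4])
    with 1 show ?thesis using cellI2 by metis
  next
    case 2
    show ?thesis
    proof (cases "(a, b) = (0, 0)")
      case True
      have "T * x = T * T * (S c d * M t)"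
        using 2 True assoc_mat4[of T T "S c d * M t"] left_mult_one_mat[of "T * (S c d * M t)" 4 4]
        by (simp add: S_0 mult_carrier_mat[of _ 4 4])
      also have "\<dots> = S c d * M t"
        using left_mult_one_mat[of "S c d * M t" 4 4] by (simp add: T_mult mult_carrier_mat[of _ 4 4])
      finally show ?thesis using 2 cellI1 by simp
    next
      case False
      obtain p k c' d' t' where t': "t' \<noteq> 0" "T * S a b * T = S p k * T * (S c' d' * M t')"
        using T_S_T[OF False] by blast
      let ?y = "S c d * M t"
      have y: "?y \<in> carrier_mat 4 4" by (simp add: mult_carrier_mat[of _ 4 4])
      have "T * x = T * S a b * T * ?y"
        using 2 y by (simp add: assoc_mat4 mult_carrier_mat[of _ 4 4])
      also have "\<dots> = S p k * (T * (S c' d' * (M t' * ?y)))"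
        unfolding t'(2) using y by (simp add: assoc_mat4 mult_carrier_mat[of _ 4 4])
      also have "M t' * ?y = S (c / t') (d / (t' * \<theta> t')) * M (t' * t)"
        using t' by (simp add: M_mult_left M_mult)
      also have "S c' d' * (S (c / t') (d / (t' * \<theta> t')) * M (t' * t)) =
          S (c' + c / t') (d' + d / (t' * \<theta> t') + \<theta> c' * (c / t')) * M (t' * t)"
        unfolding S_mult[symmetric] by (simp add: assoc_mat4)
      finally show ?thesis using 2 t' by (simp only:) (rule cellI2, simp)
    qed
  qed
qed

text \<open>
  The union of the two cells contains the identity and is stable under left multiplication by
  all generators, and the inverse of a generator is a generator.
\<close>

theorem Bruhat_decomposition: "carrier G = Bruhat_cells"
proof (intro equalityI subsetI)
  have "\<forall>x\<in>Bruhat_cells. g * x \<in> Bruhat_cells" if "g \<in> generate (GL4 F) generators" for g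
    using that
  proof induction
    case one
    then show ?case using Bruhat_cells_carrier by (metis GL4_one left_mult_one_mat)
  next
    case (incl h)
    then show ?case using S_cells M_cells T_cells by (auto simp: generators_def)
  next
    case (inv h)
    have "\<exists>h'\<in>generators. h' * h = 1\<^sub>m 4"
      using inv unfolding generators_def
    proof (elim UnE CollectE exE conjE insertE emptyE)
      fix a b assume "h = S a b"
      then show "\<exists>h'\<in>{S a b |a b. True} \<union> {M t |t. t \<noteq> 0} \<union> {T}. h' * h = 1\<^sub>m 4"
        using S_inverse(2)[of a b] by blast
    next
      fix t :: 'q assume "h = M t" "t \<noteq> 0"
      then show "\<exists>h'\<in>{S a b |a b. True} \<union> {M t |t. t \<noteq> 0} \<union> {T}. h' * h = 1\<^sub>m 4"
        by (intro bexI[of _ "M (inverse t)"]) (auto simp: M_mult M_1)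
    next
      assume "h = T"
      then show "\<exists>h'\<in>{S a b |a b. True} \<union> {M t |t. t \<noteq> 0} \<union> {T}. h' * h = 1\<^sub>m 4"
        using T_mult by blast
    qed
    then obtain h' where h': "h' \<in> generators" "h' * h = 1\<^sub>m 4" by blast
    have "inv\<^bsub>GL4 F\<^esub> h = h'"
      by (rule GL4.inv_equality) (use h' inv generators_GL4 in auto)
    then show ?case using h'(1) S_cells M_cells T_cells by (auto simp: generators_def)
  next
    case (eng h1 h2)
    have "h1 \<in> carrier_mat 4 4" "h2 \<in> carrier_mat 4 4"
      using eng.hyps GL4.generate_incl[OF generators_GL4] GL4_carrier by blast+
    then show ?case using eng.IH Bruhat_cells_carrier by (auto simp: assoc_mat4)
  qed
  moreover have "1\<^sub>m 4 \<in> Bruhat_cells"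
    using cellI1[of 1 0 0] by (simp add: S_0 M_1)
  ultimately show "g \<in> Bruhat_cells" if "g \<in> carrier G" for g
    using that G_carrier_mat[OF that] by (metis carrier_G right_mult_one_mat)
next
  have mult: "x * y \<in> carrier G" if "x \<in> carrier G" "y \<in> carrier G" for x y
    using G.m_closed[OF that] by simp
  fix g assume "g \<in> Bruhat_cells"
  then show "g \<in> carrier G"
    unfolding Bruhat_cells_def by (auto intro!: mult generators_G)
qed

text \<open>
  In the big cell, conjugation by the factor \<open>S a b * T\<close> moves the Borel factor to
  the left, which brings the element to the form \<open>S x y * (M t * T)\<close>.
\<close>

theorem char_poly_suzuki:
  assumes "g \<in> carrier G"
  shows "\<exists>\<tau>. char_poly g = suzuki_char_poly \<tau>"
proof -
  from assms consider (1) a b t where "t \<noteq> 0" "g = S a b * M t"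
    | (2) a b c d t where "t \<noteq> 0" "g = S a b * (T * (S c d * M t))"
    unfolding Bruhat_decomposition Bruhat_cells_def by blast
  then show ?thesis
  proof cases
    case 1
    then show ?thesis using char_poly_Borel by simp
  next
    case 2
    (* Q is the inverse of P, because T is an involution. *)
    define P Q where "P = S a b * T" and "Q = T * S a (b + \<theta> a * a)"
    have PQ: "P \<in> carrier_mat 4 4" "Q \<in> carrier_mat 4 4"
      by (simp_all add: P_def Q_def mult_carrier_mat[of _ 4 4])
    have c: "S x y * T * (T * z) = S x y * z" "T * S x y * (z * T) = T * (S x y * z) * T"
      if "z \<in> carrier_mat 4 4" for x y z
    proof -
      have "S x y * T * (T * z) = S x y * (T * T * z)"
        using that by (simp add: assoc_mat4 mult_carrier_mat[of _ 4 4])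
      then show "S x y * T * (T * z) = S x y * z" using that by (simp add: T_mult)
    qed (use that in \<open>simp add: assoc_mat4 mult_carrier_mat[of _ 4 4]\<close>)
    have PQ1: "P * Q = 1\<^sub>m 4" unfolding P_def Q_def by (simp add: c S_inverse)
    have QP1: "Q * P = 1\<^sub>m 4" unfolding P_def Q_def
      using c(2)[of "S a b" a "b + \<theta> a * a"] by (simp add: S_inverse T_mult right_mult_one_mat[of T 4 4] assoc_mat4[symmetric] mult_carrier_mat[of _ 4 4])
    define h where "h = S c d * M t * P"
    have h: "h \<in> carrier_mat 4 4" using PQ by (simp add: h_def mult_carrier_mat[of _ 4 4])
    have "g = P * (S c d * M t)"
      using 2 by (simp add: P_def assoc_mat4 mult_carrier_mat[of _ 4 4])
    also have "\<dots> = P * (S c d * M t * (P * Q))"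
      unfolding PQ1 by (subst right_mult_one_mat[of _ 4 4]) (simp_all add: mult_carrier_mat[of _ 4 4])
    also have "\<dots> = P * h * Q" using PQ by (simp add: h_def assoc_mat4 mult_carrier_mat[of _ 4 4])
    finally have "similar_mat g h"
      using PQ PQ1 QP1 h by (intro similar_matI[of _ _ P Q 4]) (auto intro!: mult_carrier_mat[of _ 4 4])
    then have "char_poly g = char_poly h" by (rule char_poly_similar)
    moreover have "h = S (c + a / t) (d + b / (t * \<theta> t) + \<theta> c * (a / t)) * (M t * T)"
    proof -
      have "h = S c d * (M t * (S a b * T))"
        by (simp add: h_def P_def assoc_mat4 mult_carrier_mat[of _ 4 4])
      also have "\<dots> = S c d * (S (a / t) (b / (t * \<theta> t)) * (M t * T))"
        using 2 by (simp add: M_mult_left)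
      also have "\<dots> = S (c + a / t) (d + b / (t * \<theta> t) + \<theta> c * (a / t)) * (M t * T)"
        unfolding S_mult[symmetric] by (simp add: assoc_mat4 mult_carrier_mat[of _ 4 4])
      finally show ?thesis .
    qed
    ultimately show ?thesis using char_poly_opposite[OF 2(1)] by simp
  qed
qed

end

section \<open>Subgroups of odd order\<close>

text \<open>
  The substitution \<open>r = x + 1/x\<close> turns the equation into \<open>r\<^sup>2 + t r + s
  = 0\<close>. Its roots \<open>r\<close> and \<open>r + t\<close> are distinct and nonzero, so
  each of them comes from two distinct values of \<open>x\<close>.
\<close>

lemma reciprocal_quartic_roots_char_2:
  fixes t s :: "'a::alg_closed_field"
  assumes two: "(2::'a) = 0" and t: "t \<noteq> 0" and s: "s \<noteq> 0"
  shows "card {x. 1 + t * x + s * x ^ 2 + t * x ^ 3 + x ^ 4 = 0} = 4"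
proof -
  have dbl: "x + x = 0" for x :: 'a using two by (metis mult_2 mult_zero_left)
  have neg: "- x = x" for x :: 'a using dbl[of x] by (simp add: add_eq_0_iff)
  have quad: "\<exists>x. x ^ 2 + p * x + q = 0" for p q :: 'a
  proof -
    have "\<exists>x. poly [:q, p, 1:] x = 0" by (rule alg_closed_imp_poly_has_root) simp
    then show ?thesis by (auto simp: power2_eq_square algebra_simps)
  qed
  have roots: "x ^ 2 + p * x + 1 = 0 \<longleftrightarrow> x = y \<or> x = y + p" if "y ^ 2 + p * y + 1 = 0" for x y p :: 'a
  proof -
    have "x ^ 2 + p * x + 1 = (x ^ 2 + p * x + 1) - (y ^ 2 + p * y + 1)" using that by simp
    also have "\<dots> = (x - y) * (x + y + p)" by (simp add: algebra_simps power2_eq_square)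
    finally have "x ^ 2 + p * x + 1 = 0 \<longleftrightarrow> x = y \<or> x + y + p = 0" by simp
    moreover have "x + y + p = 0 \<longleftrightarrow> x = y + p" by (metis add.assoc add_eq_0_iff neg)
    ultimately show ?thesis by simp
  qed
  obtain r where r: "r ^ 2 + t * r + s = 0" using quad by blast
  define r' where "r' = r + t"
  have rr: "r * r' = s"
  proof -
    have "r * r' + s = 0" using r by (simp add: r'_def algebra_simps power2_eq_square)
    then show ?thesis using neg by (metis add_eq_0_iff)
  qed
  have sum: "r + r' = t" using dbl[of r] by (simp add: r'_def add.assoc[symmetric])
  have r0: "r \<noteq> 0" "r' \<noteq> 0" using rr s by auto
  obtain x where x: "x ^ 2 + r * x + 1 = 0" using quad by blast
  obtain y where y: "y ^ 2 + r' * y + 1 = 0" using quad by blast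
  have "1 + t * z + s * z ^ 2 + t * z ^ 3 + z ^ 4 = (z ^ 2 + r * z + 1) * (z ^ 2 + r' * z + 1)" for z
  proof -
    have "(z ^ 2 + r * z + 1) * (z ^ 2 + r' * z + 1)
        = 1 + (r + r') * z + (r * r' + 2) * z ^ 2 + (r + r') * z ^ 3 + z ^ 4"
      by (simp add: algebra_simps power2_eq_square power3_eq_cube power4_eq_xxxx)
    then show ?thesis unfolding sum rr two by simp
  qed
  then have "{z. 1 + t * z + s * z ^ 2 + t * z ^ 3 + z ^ 4 = 0} = {x, x + r} \<union> {y, y + r'}"
    using roots[OF x] roots[OF y] by auto
  moreover have "card ({x, x + r} \<union> {y, y + r'}) = 4"
  proof -
    have "{x, x + r} \<inter> {y, y + r'} = {}"
    proof (rule ccontr)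
      assume "{x, x + r} \<inter> {y, y + r'} \<noteq> {}"
      then obtain z where "z \<in> {x, x + r}" "z \<in> {y, y + r'}" by blast
      then have z: "z ^ 2 + r * z + 1 = 0" "z ^ 2 + r' * z + 1 = 0"
        using roots[OF x, of z] roots[OF y, of z] by auto
      have "(r' - r) * z = (z ^ 2 + r' * z + 1) - (z ^ 2 + r * z + 1)" by (simp add: algebra_simps)
      also have "\<dots> = 0" using z by simp
      finally have "(r' - r) * z = 0" .
      then have "z = 0" using t by (simp add: r'_def)
      with z show False by simp
    qed
    then show ?thesis using r0 by (subst card_Un_disjoint) auto
  qed
  ultimately show ?thesis by simp
qed

context suzuki_field
begin

interpretation ac: inj_comm_ring_hom "to_ac :: 'q \<Rightarrow> 'q alg_closure"
  by unfold_locales auto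

definition lift_mat :: "'q mat \<Rightarrow> 'q alg_closure mat" where "lift_mat = map_mat to_ac"

lemma lift_mat_simps:
  "x \<in> carrier_mat 4 4 \<Longrightarrow> lift_mat x \<in> carrier_mat 4 4"
  "x \<in> carrier_mat 4 4 \<Longrightarrow> y \<in> carrier_mat 4 4 \<Longrightarrow> lift_mat (x * y) = lift_mat x * lift_mat y"
  "lift_mat (1\<^sub>m 4) = 1\<^sub>m 4" "lift_mat x = lift_mat y \<longleftrightarrow> x = y"
  "x \<in> carrier_mat 4 4 \<Longrightarrow> lift_mat (x ^\<^sub>m n) = lift_mat x ^\<^sub>m n"
  unfolding lift_mat_def by (auto simp: ac.mat_hom_mult ac.mat_hom_one ac.mat_hom_pow dest: ac.mat_hom_inj)

text \<open>
  The roots of \<open>suzuki_char_poly \<tau>\<close> in the algebraic closure.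
\<close>

definition eigenvalues :: "'q \<Rightarrow> 'q alg_closure set" where
  "eigenvalues \<tau> = {x. 1 + to_ac \<tau> * x + to_ac (\<theta> \<tau>) * x ^ 2 + to_ac \<tau> * x ^ 3 + x ^ 4 = 0}"

lemma eigenvalues_suzuki:
  assumes "g \<in> carrier G"
  obtains \<tau> where "{x. eigenvalue (lift_mat g) x} = eigenvalues \<tau>"
proof -
  obtain \<tau> where \<tau>: "char_poly g = suzuki_char_poly \<tau>" using char_poly_suzuki[OF assms] by blast
  have g: "g \<in> carrier_mat 4 4" by (rule G_carrier_mat[OF assms])
  have "char_poly (lift_mat g) = map_poly to_ac (suzuki_char_poly \<tau>)"
    unfolding lift_mat_def ac.char_poly_hom[OF g] \<tau> ..
  then have "{x. eigenvalue (lift_mat g) x} = eigenvalues \<tau>"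
    unfolding eigenvalues_def eigenvalue_root_char_poly[OF lift_mat_simps(1)[OF g]]
    by (simp add: suzuki_char_poly_def algebra_simps power2_eq_square power3_eq_cube power4_eq_xxxx)
  then show ?thesis by (rule that)
qed

lemma two_ac: "(2 :: 'q alg_closure) = 0"
  using two_eq_0 by (metis to_ac_0 to_ac_numeral)

lemma eigenvalues_0: "eigenvalues 0 \<subseteq> {1}"
proof
  fix x assume "x \<in> eigenvalues 0"
  then have "1 + x ^ 4 = 0" by (simp add: eigenvalues_def)
  moreover have "(1 + x) ^ 4 = 1 + x ^ 4 + 2 * (2 * x + 3 * x ^ 2 + 2 * x ^ 3)"
    by (simp add: algebra_simps power2_eq_square power3_eq_cube power4_eq_xxxx)
  ultimately have "(1 + x) ^ 4 = 0" using two_ac by simp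
  then have "1 + x = 0" by simp
  then have "x = - 1" by (simp add: add_eq_0_iff)
  also have "- 1 = (1 :: 'q alg_closure)" using two_ac by (simp add: minus_equation_iff numeral_eq_iff eq_neg_iff_add_eq_0)
  finally show "x \<in> {1}" by simp
qed

lemma eigenvalues_nonzero:
  assumes "\<tau> \<noteq> 0"
  shows "card (eigenvalues \<tau>) = 4" "1 \<notin> eigenvalues \<tau>"
proof -
  show "card (eigenvalues \<tau>) = 4"
    unfolding eigenvalues_def using assms by (intro reciprocal_quartic_roots_char_2 two_ac) auto
  have "1 + to_ac \<tau> * 1 + to_ac (\<theta> \<tau>) * 1 ^ 2 + to_ac \<tau> * 1 ^ 3 + 1 ^ 4 = to_ac (\<theta> \<tau>) + 2 * (1 + to_ac \<tau>)"
    by simp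
  then show "1 \<notin> eigenvalues \<tau>" using assms two_ac by (simp add: eigenvalues_def)
qed

lemma eigenvalues_finite: "finite (eigenvalues \<tau>)" "card (eigenvalues \<tau>) \<le> 4"
  using eigenvalues_0 eigenvalues_nonzero[of \<tau>] card_mono[OF _ eigenvalues_0]
    finite_subset[OF eigenvalues_0] card.infinite[of "eigenvalues \<tau>"]
  by (cases "\<tau> = 0"; fastforce)+

text \<open>
  For \<open>\<tau> = 0\<close> the characteristic polynomial is \<open>(x + 1)\<^sup>4\<close>.
  This is impossible here, since an element of odd order other than the identity has an
  eigenvalue different from 1.
\<close>

lemma odd_order_spectrum:
  assumes g: "g \<in> carrier G" "g \<noteq> 1\<^sub>m 4" and m: "odd m" "g ^\<^sub>m m = 1\<^sub>m 4"
  shows "card {x. eigenvalue (lift_mat g) x} = 4" "\<not> eigenvalue (lift_mat g) 1"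
proof -
  have gc: "g \<in> carrier_mat 4 4" by (rule G_carrier_mat[OF g(1)])
  obtain \<tau> where \<tau>: "{x. eigenvalue (lift_mat g) x} = eigenvalues \<tau>" using eigenvalues_suzuki[OF g(1)] .
  obtain j where j: "m = 2 * j + 1" using m(1) oddE by blast
  have "of_nat m = (1 :: 'q alg_closure)" unfolding j using two_ac by simp
  moreover have "lift_mat g ^\<^sub>m m = 1\<^sub>m 4" using lift_mat_simps(5)[OF gc, of m] m(2) lift_mat_simps(3) by simp
  moreover have "lift_mat g \<noteq> 1\<^sub>m 4" using lift_mat_simps(3,4) g(2) by metis
  ultimately obtain k where "k \<noteq> 1" "eigenvalue (lift_mat g) k"
    using finite_order_eigenvalue_neq_one[OF lift_mat_simps(1)[OF gc], of m] by auto
  then have "\<tau> \<noteq> 0" using \<tau> eigenvalues_0 by blast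
  from eigenvalues_nonzero[OF this] show "card {x. eigenvalue (lift_mat g) x} = 4" "\<not> eigenvalue (lift_mat g) 1"
    unfolding \<tau>[symmetric] by auto
qed

context
  fixes H :: "'q mat set"
  assumes H: "subgroup H G" and odd_H: "odd (card H)"
begin

interpretation H: subgroup H G by (fact H)

lemma H_carrier_mat: "x \<in> H \<Longrightarrow> x \<in> carrier_mat 4 4"
  using H.subset G_carrier_mat by blast

lemma H_pow: "x \<in> H \<Longrightarrow> x ^\<^sub>m card H = 1\<^sub>m 4"
proof -
  assume x: "x \<in> H"
  have xG: "x \<in> carrier G" using x by simp
  have e: "x [^]\<^bsub>G\<lparr>carrier := H\<rparr>\<^esub> (n::nat) = x ^\<^sub>m n" for n
    using H_carrier_mat[OF x] by (induction n) simp_all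
  interpret HG: group "G\<lparr>carrier := H\<rparr>" by (rule H.subgroup_is_group) (rule G.is_group)
  have "x [^]\<^bsub>G\<lparr>carrier := H\<rparr>\<^esub> Coset.order (G\<lparr>carrier := H\<rparr>) = \<one>\<^bsub>G\<lparr>carrier := H\<rparr>\<^esub>"
    by (rule HG.pow_order_eq_1) (use x in simp)
  then show ?thesis unfolding e by (simp add: Coset.order_def)
qed

lemma odd_subgroup_spectrum:
  assumes "x \<in> H" "x \<noteq> 1\<^sub>m 4"
  shows "card {k. eigenvalue (lift_mat x) k} = 4" "\<not> eigenvalue (lift_mat x) 1"
  using odd_order_spectrum[OF _ assms(2) odd_H H_pow[OF assms(1)]] assms(1) by auto

text \<open>
  No nontrivial element of \<open>H\<close> has the eigenvalue 1, so \<open>H\<close> acts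
  freely on nonzero vectors.
\<close>

lemma odd_subgroup_free:
  assumes ab: "a \<in> H" "b \<in> H" and v: "v \<in> carrier_vec 4" "v \<noteq> 0\<^sub>v 4" and eq: "lift_mat a *\<^sub>v v = lift_mat b *\<^sub>v v"
  shows "a = b"
proof -
  define c where "c = inv\<^bsub>G\<^esub> b"
  have c: "c \<in> H" "c * b = 1\<^sub>m 4"
    using ab G.l_inv[of b] by (simp_all add: c_def)
  have ca: "c * a \<in> H" using H.m_closed[OF c(1) ab(1)] by simp
  note cm = H_carrier_mat[OF ab(1)] H_carrier_mat[OF ab(2)] H_carrier_mat[OF c(1)]
  have "lift_mat (c * a) *\<^sub>v v = lift_mat c *\<^sub>v (lift_mat b *\<^sub>v v)"
    using cm v(1) by (simp add: lift_mat_simps assoc_mult_mat_vec[of _ 4 4 _ 4] eq)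
  also have "\<dots> = lift_mat (c * b) *\<^sub>v v"
    using cm v(1) by (simp add: lift_mat_simps assoc_mult_mat_vec[of _ 4 4 _ 4])
  also have "\<dots> = 1 \<cdot>\<^sub>v v" unfolding c(2) using v(1) by (simp add: lift_mat_simps)
  finally have "eigenvector (lift_mat (c * a)) v 1"
    using eigenvectorI[OF lift_mat_simps(1)[OF H_carrier_mat[OF ca]] v] by blast
  then have "c * a = 1\<^sub>m 4" using odd_subgroup_spectrum(2)[OF ca] by (auto simp: eigenvalue_def)
  with c(2) have "c * a = c * b" by simp
  then have "c \<otimes>\<^bsub>G\<^esub> a = c \<otimes>\<^bsub>G\<^esub> b" by simp
  then show ?thesis using ab c(1) G.l_cancel[of c b a] by (simp del: G_mult)
qed

text \<open>
  The two products agree on \<open>v\<close>.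
\<close>

lemma odd_subgroup_common_eigenvector:
  assumes xy: "x \<in> H" "y \<in> H" and v: "eigenvector (lift_mat x) v k" "eigenvector (lift_mat y) v l"
  shows "x * y = y * x"
proof (rule odd_subgroup_free)
  show "x * y \<in> H" "y * x \<in> H" using H.m_closed[OF xy] H.m_closed[OF xy(2,1)] by simp_all
  note c = H_carrier_mat[OF xy(1)] H_carrier_mat[OF xy(2)]
  note x = eigenvectorD[OF v(1) lift_mat_simps(1)[OF c(1)]] and y = eigenvectorD[OF v(2) lift_mat_simps(1)[OF c(2)]]
  show "v \<in> carrier_vec 4" "v \<noteq> 0\<^sub>v 4" using x by auto
  show "lift_mat (x * y) *\<^sub>v v = lift_mat (y * x) *\<^sub>v v"
    using c x y by (simp add: lift_mat_simps assoc_mult_mat_vec[of _ 4 4 _ 4] mult_mat_vec[of _ 4 4]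
        smult_smult_assoc mult.commute)
qed

lemma exists_eigenvector:
  assumes "x \<in> H" "x \<noteq> 1\<^sub>m 4"
  obtains v k where "eigenvector (lift_mat x) v k"
proof -
  have "{k. eigenvalue (lift_mat x) k} \<noteq> {}" using odd_subgroup_spectrum(1)[OF assms] by force
  then show ?thesis using that by (auto simp: eigenvalue_def)
qed

lemma commuting_eigenvector:
  assumes x: "x \<in> H" "x \<noteq> 1\<^sub>m 4" and y: "y \<in> H" "x * y = y * x" and v: "eigenvector (lift_mat x) v k"
  shows "\<exists>l. eigenvector (lift_mat y) v l"
proof (rule commuting_preserves_eigenvectors[OF _ odd_subgroup_spectrum(1)[OF x] _ _ _ v])
  show "lift_mat x * lift_mat y = lift_mat y * lift_mat x"
    using y(2) lift_mat_simps(2)[OF H_carrier_mat[OF x(1)] H_carrier_mat[OF y(1)]]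
      lift_mat_simps(2)[OF H_carrier_mat[OF y(1)] H_carrier_mat[OF x(1)]] by simp
qed (use x y lift_mat_simps(1) H_carrier_mat in auto)

theorem odd_subgroup_commutative:
  assumes "x \<in> H" "y \<in> H"
  shows "x * y = y * x"
proof -
  interpret HG: group "G\<lparr>carrier := H\<rparr>" by (rule H.subgroup_is_group) (rule G.is_group)
  have fin: "finite H" using finite_subset[OF H.subset finite_G] .
  have "x \<otimes>\<^bsub>G\<lparr>carrier := H\<rparr>\<^esub> y = y \<otimes>\<^bsub>G\<lparr>carrier := H\<rparr>\<^esub> x"
  proof (rule HG.commutative_if_centralizers_abelian_self_normalizing)
    fix x y z
    assume "x \<in> carrier (G\<lparr>carrier := H\<rparr>)" "y \<in> carrier (G\<lparr>carrier := H\<rparr>)" "z \<in> carrier (G\<lparr>carrier := H\<rparr>)"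
      "y \<noteq> \<one>\<^bsub>G\<lparr>carrier := H\<rparr>\<^esub>" "x \<otimes>\<^bsub>G\<lparr>carrier := H\<rparr>\<^esub> y = y \<otimes>\<^bsub>G\<lparr>carrier := H\<rparr>\<^esub> x"
      "y \<otimes>\<^bsub>G\<lparr>carrier := H\<rparr>\<^esub> z = z \<otimes>\<^bsub>G\<lparr>carrier := H\<rparr>\<^esub> y"
    then have xyz: "x \<in> H" "y \<in> H" "z \<in> H" "y \<noteq> 1\<^sub>m 4" "y * x = x * y" "y * z = z * y" by simp_all
    obtain v k where v: "eigenvector (lift_mat y) v k" using exists_eigenvector[OF xyz(2,4)] .
    obtain l l' where "eigenvector (lift_mat x) v l" "eigenvector (lift_mat z) v l'"
      using commuting_eigenvector[OF xyz(2,4) _ _ v] xyz by metis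
    then show "x \<otimes>\<^bsub>G\<lparr>carrier := H\<rparr>\<^esub> z = z \<otimes>\<^bsub>G\<lparr>carrier := H\<rparr>\<^esub> x"
      using odd_subgroup_common_eigenvector xyz by simp
  next
    fix c x y
    assume "c \<in> carrier (G\<lparr>carrier := H\<rparr>)" "x \<in> carrier (G\<lparr>carrier := H\<rparr>)" "y \<in> carrier (G\<lparr>carrier := H\<rparr>)"
      "x \<noteq> \<one>\<^bsub>G\<lparr>carrier := H\<rparr>\<^esub>" "y \<noteq> \<one>\<^bsub>G\<lparr>carrier := H\<rparr>\<^esub>"
      "c \<otimes>\<^bsub>G\<lparr>carrier := H\<rparr>\<^esub> x = y \<otimes>\<^bsub>G\<lparr>carrier := H\<rparr>\<^esub> c"
      "x \<otimes>\<^bsub>G\<lparr>carrier := H\<rparr>\<^esub> y = y \<otimes>\<^bsub>G\<lparr>carrier := H\<rparr>\<^esub> x"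
    then have h: "c \<in> H" "x \<in> H" "y \<in> H" "x \<noteq> 1\<^sub>m 4" "y \<noteq> 1\<^sub>m 4" "c * x = y * c" "x * y = y * x"
      by simp_all
    note cm = H_carrier_mat[OF h(1)] H_carrier_mat[OF h(2)] H_carrier_mat[OF h(3)]
    have "lift_mat x * lift_mat y = lift_mat y * lift_mat x" "lift_mat c * lift_mat x = lift_mat y * lift_mat c" "lift_mat c ^\<^sub>m card H = 1\<^sub>m 4"
      using cm h(6,7) H_pow[OF h(1)] lift_mat_simps(5)[OF cm(1), symmetric] by (simp_all add: lift_mat_simps(2)[symmetric] lift_mat_simps(3))
    then obtain v k l where "eigenvector (lift_mat x) v k" "eigenvector (lift_mat c) v l"
      using odd_order_common_eigenvector[OF lift_mat_simps(1)[OF cm(2)] odd_subgroup_spectrum(1)[OF h(2,4)]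
          lift_mat_simps(1)[OF cm(3)] odd_subgroup_spectrum(1)[OF h(3,5)] _ lift_mat_simps(1)[OF cm(1)] _ odd_H] by metis
    then show "c \<otimes>\<^bsub>G\<lparr>carrier := H\<rparr>\<^esub> x = x \<otimes>\<^bsub>G\<lparr>carrier := H\<rparr>\<^esub> c"
      using odd_subgroup_common_eigenvector[OF h(1,2)] by simp
  qed (use assms fin in simp_all)
  then show ?thesis by simp
qed

text \<open>
  As \<open>H\<close> is abelian, an eigenvector of one nontrivial element is a common
  eigenvector of \<open>H\<close>. By freeness, the map from elements to eigenvalues on it is
  injective.
\<close>

theorem odd_subgroup_card: "card H \<le> 4 * card (UNIV :: 'q set)"
proof (cases "H = {1\<^sub>m 4}")
  case True
  have "card (UNIV :: 'q set) > 0" by (simp add: card_gt_0_iff)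
  then have "1 \<le> 4 * card (UNIV :: 'q set)" by simp
  then show ?thesis unfolding True by simp
next
  case False
  then obtain x where x: "x \<in> H" "x \<noteq> 1\<^sub>m 4" using H.one_closed by auto
  obtain v k where v: "eigenvector (lift_mat x) v k" using exists_eigenvector[OF x] .
  note vc = eigenvectorD[OF v lift_mat_simps(1)[OF H_carrier_mat[OF x(1)]]]
  have "\<exists>l. eigenvector (lift_mat h) v l" if "h \<in> H" for h
    by (rule commuting_eigenvector[OF x that odd_subgroup_commutative[OF x(1) that] v])
  then obtain e where e: "\<And>h. h \<in> H \<Longrightarrow> eigenvector (lift_mat h) v (e h)" by metis
  have inj: "inj_on e H"
  proof (rule inj_onI)
    fix a b assume ab: "a \<in> H" "b \<in> H" "e a = e b"
    have "lift_mat a *\<^sub>v v = lift_mat b *\<^sub>v v"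
      using eigenvectorD(3)[OF e[OF ab(1)] lift_mat_simps(1)[OF H_carrier_mat[OF ab(1)]]]
        eigenvectorD(3)[OF e[OF ab(2)] lift_mat_simps(1)[OF H_carrier_mat[OF ab(2)]]] ab(3) by simp
    then show "a = b" using odd_subgroup_free[OF ab(1,2) vc(1,2)] by blast
  qed
  have "e ` H \<subseteq> (\<Union>\<tau>. eigenvalues \<tau>)"
  proof
    fix l assume "l \<in> e ` H"
    then obtain h where h: "h \<in> H" "l = e h" by blast
    obtain \<tau> where "{x. eigenvalue (lift_mat h) x} = eigenvalues \<tau>"
      using eigenvalues_suzuki[of h] h(1) H.subset by blast
    then show "l \<in> (\<Union>\<tau>. eigenvalues \<tau>)" using e[OF h(1)] h(2) by (auto simp: eigenvalue_def)
  qed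
  then have "card (e ` H) \<le> card (\<Union>\<tau>. eigenvalues \<tau>)"
    by (rule card_mono[rotated]) (simp add: eigenvalues_finite)
  also have "\<dots> \<le> (\<Sum>\<tau>\<in>UNIV. card (eigenvalues \<tau>))" by (rule card_UN_le) simp
  also have "\<dots> \<le> (\<Sum>\<tau>\<in>(UNIV :: 'q set). 4)" by (rule sum_mono) (rule eigenvalues_finite)
  finally show ?thesis using card_image[OF inj] by simp
qed

end

end

section \<open>The Suzuki-Tits ovoid\<close>

context suzuki_field
begin

definition point_at_infinity :: "'q vec" where "point_at_infinity = vec_of_list [0, 0, 0, 1]"

definition affine_point :: "'q \<Rightarrow> 'q \<Rightarrow> 'q vec" where
  "affine_point a b = vec_of_list [1, a, b, N a b]"

definition act :: "'q mat \<Rightarrow> 'q vec set \<Rightarrow> 'q vec set" where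
  "act g l = (\<lambda>v. g *\<^sub>v v) ` l"

definition \<omega> :: "'q vec set" where "\<omega> = vec_line point_at_infinity"

text \<open>
  Defined as an orbit, so that its invariance is immediate; \<open>ovoid_iff\<close> describes
  its points by coordinates.
\<close>

definition ovoid :: "'q vec set set" where "ovoid = (\<lambda>g. act g \<omega>) ` carrier G"

lemma points_carrier [simp]: "point_at_infinity \<in> carrier_vec 4" "affine_point a b \<in> carrier_vec 4"
  by (rule carrier_vecI, simp add: point_at_infinity_def affine_point_def)+

lemma mat4_mult_vec:
  "mat_of_rows_list 4 [[a00, a01, a02, a03], [a10, a11, a12, a13], [a20, a21, a22, a23], [a30, a31, a32, a33]]
     *\<^sub>v vec_of_list [x0, x1, x2, x3 :: 'q] =
   vec_of_list [a00 * x0 + a01 * x1 + a02 * x2 + a03 * x3, a10 * x0 + a11 * x1 + a12 * x2 + a13 * x3,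
     a20 * x0 + a21 * x1 + a22 * x2 + a23 * x3, a30 * x0 + a31 * x1 + a32 * x2 + a33 * x3]"
  by (rule eq_vecI)
    (auto simp: mat_of_rows_list_def scalar_prod_def vec_of_list_index less_Suc_eq numeral_eq_Suc)

lemma act_vec_line: "g \<in> carrier_mat 4 4 \<Longrightarrow> v \<in> carrier_vec 4 \<Longrightarrow> act g (vec_line v) = vec_line (g *\<^sub>v v)"
  unfolding act_def by (rule image_vec_line)

lemma act_mult:
  assumes "g \<in> carrier_mat 4 4" "h \<in> carrier_mat 4 4" "l \<subseteq> carrier_vec 4"
  shows "act (g * h) l = act g (act h l)"
  unfolding act_def image_image
  by (rule image_cong[OF refl]) (use assms in \<open>auto simp: assoc_mult_mat_vec[of _ 4 4 _ 4]\<close>)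

lemma act_one: "l \<subseteq> carrier_vec 4 \<Longrightarrow> act (1\<^sub>m 4) l = l"
  unfolding act_def by (subst image_cong[OF refl, of _ _ "\<lambda>v. v"]) (auto dest: subsetD)

lemma act_S_infinity: "act (S a b) \<omega> = \<omega>"
proof -
  have "S a b *\<^sub>v point_at_infinity = point_at_infinity"
    unfolding S_explicit point_at_infinity_def mat4_mult_vec by simp
  then show ?thesis by (simp add: \<omega>_def act_vec_line)
qed

lemma act_M_infinity:
  assumes "t \<noteq> 0" shows "act (M t) \<omega> = \<omega>"
proof -
  have "M t *\<^sub>v point_at_infinity = inverse (t * t ^ (2 ^ f)) \<cdot>\<^sub>v point_at_infinity"
    unfolding M_explicit point_at_infinity_def mat4_mult_vec
    by (rule eq_vecI) (auto simp: less_Suc_eq numeral_eq_Suc)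
  then show ?thesis using assms by (simp add: \<omega>_def act_vec_line vec_line_smult)
qed

lemma act_T_infinity: "act T \<omega> = vec_line (affine_point 0 0)"
proof -
  have "T *\<^sub>v point_at_infinity = affine_point 0 0"
    unfolding suzuki_T_def point_at_infinity_def affine_point_def mat4_mult_vec by (simp add: N_def)
  then show ?thesis by (simp add: \<omega>_def act_vec_line)
qed

lemma act_S_affine: "act (S a b) (vec_line (affine_point c d)) = vec_line (affine_point (a + c) (b + d + \<theta> a * c))"
proof -
  have base: "S x y *\<^sub>v affine_point 0 0 = affine_point x y" for x y
    unfolding S_explicit affine_point_def mat4_mult_vec by (simp add: N_def)
  have "S a b *\<^sub>v affine_point c d = (S a b * S c d) *\<^sub>v affine_point 0 0"
    by (simp add: assoc_mult_mat_vec[of _ 4 4 _ 4] base)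
  also have "\<dots> = affine_point (a + c) (b + d + \<theta> a * c)" unfolding S_mult base ..
  finally show ?thesis by (simp add: act_vec_line)
qed

lemma affine_point_inj: "vec_line (affine_point a b) = vec_line (affine_point c d) \<longleftrightarrow> a = c \<and> b = d"
proof
  assume eq: "vec_line (affine_point a b) = vec_line (affine_point c d)"
  have "affine_point a b \<in> vec_line (affine_point c d)" unfolding eq[symmetric] by (rule vec_line_self)
  then obtain k where k: "affine_point a b = k \<cdot>\<^sub>v affine_point c d" by (auto simp: vec_line_def)
  have e: "affine_point a b $ i = k * affine_point c d $ i" if "i < 4" for i
    using that arg_cong[OF k, of "\<lambda>v. v $ i"] carrier_vecD[OF points_carrier(2)[of c d]] by simp
  show "a = c \<and> b = d"
    using e[of 0] e[of 1] e[of 2] by (simp add: affine_point_def numeral_eq_Suc)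
qed simp

lemma affine_point_neq_infinity: "vec_line (affine_point a b) \<noteq> \<omega>"
proof
  assume eq: "vec_line (affine_point a b) = \<omega>"
  have "affine_point a b \<in> \<omega>" unfolding eq[symmetric] by (rule vec_line_self)
  then obtain k where k: "affine_point a b = k \<cdot>\<^sub>v point_at_infinity" by (auto simp: \<omega>_def vec_line_def)
  have "affine_point a b $ 0 = k * point_at_infinity $ 0"
    unfolding k by (rule index_smult_vec(1)) (simp add: point_at_infinity_def)
  then show False by (simp add: affine_point_def point_at_infinity_def vec_of_list_index)
qed

lemma infinity_carrier: "\<omega> \<subseteq> carrier_vec 4"
  by (auto simp: \<omega>_def vec_line_def)

lemma act_carrier: "g \<in> carrier_mat 4 4 \<Longrightarrow> l \<subseteq> carrier_vec 4 \<Longrightarrow> act g l \<subseteq> carrier_vec 4"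
  by (auto simp: act_def)

lemma ovoid_carrier: "l \<in> ovoid \<Longrightarrow> l \<subseteq> carrier_vec 4"
  using act_carrier[OF G_carrier_mat infinity_carrier] by (auto simp: ovoid_def)

lemma ovoid_iff: "l \<in> ovoid \<longleftrightarrow> l = \<omega> \<or> (\<exists>a b. l = vec_line (affine_point a b))"
proof
  assume "l \<in> ovoid"
  then obtain g where g: "g \<in> carrier G" "l = act g \<omega>" by (auto simp: ovoid_def)
  then consider (1) a b t where "t \<noteq> 0" "g = S a b * M t"
    | (2) a b c d t where "t \<noteq> 0" "g = S a b * (T * (S c d * M t))"
    unfolding Bruhat_decomposition Bruhat_cells_def by blast
  then show "l = \<omega> \<or> (\<exists>a b. l = vec_line (affine_point a b))"
  proof cases
    case 1
    have "l = act (S a b) (act (M t) \<omega>)"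
      unfolding g(2) 1(2) by (rule act_mult) (simp_all add: infinity_carrier)
    then have "l = \<omega>" by (simp only: act_M_infinity[OF 1(1)] act_S_infinity)
    then show ?thesis ..
  next
    case 2
    have "l = act (S a b) (act T (act (S c d) (act (M t) \<omega>)))"
      unfolding g(2) 2(2) by (simp add: act_mult infinity_carrier mult_carrier_mat[of _ 4 4])
    then have "l = vec_line (affine_point (a + 0) (b + 0 + \<theta> a * 0))"
      by (simp only: act_M_infinity[OF 2(1)] act_S_infinity act_T_infinity act_S_affine)
    then show ?thesis by blast
  qed
next
  assume "l = \<omega> \<or> (\<exists>a b. l = vec_line (affine_point a b))"
  then show "l \<in> ovoid"
  proof (elim disjE exE)
    assume "l = \<omega>"
    then have "l = act \<one>\<^bsub>G\<^esub> \<omega>" by (simp add: act_one infinity_carrier)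
    then show ?thesis unfolding ovoid_def by (rule image_eqI) (rule G.one_closed)
  next
    fix a b assume l: "l = vec_line (affine_point a b)"
    have "act (S a b \<otimes>\<^bsub>G\<^esub> T) \<omega> = act (S a b) (act T \<omega>)"
      unfolding G_mult by (rule act_mult) (simp_all add: infinity_carrier)
    then have "l = act (S a b \<otimes>\<^bsub>G\<^esub> T) \<omega>"
      unfolding l by (simp add: act_T_infinity act_S_affine)
    then show ?thesis unfolding ovoid_def
      by (rule image_eqI) (intro G.m_closed generators_G)
  qed
qed

lemma affine_in_ovoid: "vec_line (affine_point a b) \<in> ovoid"
  unfolding ovoid_iff by (rule disjI2, rule exI, rule exI, rule refl)

lemma card_ovoid: "card ovoid = card (UNIV :: 'q set) ^ 2 + 1" "finite ovoid"
proof -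
  define aff where "aff = (\<lambda>p. vec_line (affine_point (fst p) (snd p))) ` UNIV"
  have eq: "ovoid = insert \<omega> aff"
    by (rule Set.set_eqI) (simp only: ovoid_iff aff_def image_iff insert_iff bex_UNIV split_paired_Ex fst_conv snd_conv)
  have "inj (\<lambda>p. vec_line (affine_point (fst p) (snd p)))"
    by (rule injI) (simp add: affine_point_inj prod_eq_iff)
  then have "card aff = card (UNIV :: ('q \<times> 'q) set)" unfolding aff_def by (rule card_image)
  also have "\<dots> = card (UNIV :: 'q set) ^ 2"
    using card_cartesian_product[of "UNIV :: 'q set" "UNIV :: 'q set"] by (simp add: power2_eq_square)
  finally have "card aff = card (UNIV :: 'q set) ^ 2" .
  moreover have "\<omega> \<notin> aff"
    unfolding aff_def by (rule notI, erule imageE) (use affine_point_neq_infinity[symmetric] in \<open>simp only:\<close>)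
  moreover have "finite aff" unfolding aff_def by (rule finite_imageI) (rule finite)
  ultimately show "card ovoid = card (UNIV :: 'q set) ^ 2 + 1" "finite ovoid"
    unfolding eq by simp_all
qed

definition U :: "'q mat set" where "U = range (\<lambda>(a, b). S a b)"

lemma S_in_U: "S a b \<in> U"
  unfolding U_def by (rule range_eqI[of _ _ "(a, b)"]) simp

lemma subgroup_U: "subgroup U G"
proof (rule G.subgroupI)
  show "U \<subseteq> carrier G" by (auto simp: U_def generators_G)
  show "U \<noteq> {}" by (auto simp: U_def)
  show "inv\<^bsub>G\<^esub> u \<in> U" if u: "u \<in> U" for u
  proof -
    obtain a b where "u = S a b" using u by (auto simp: U_def)
    then have "inv\<^bsub>G\<^esub> u = S a (b + \<theta> a * a)"
      using S_inverse(2)[of a b] by (intro G.inv_equality) (simp_all add: generators_G)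
    then show ?thesis by (simp add: S_in_U)
  qed
  show "u \<otimes>\<^bsub>G\<^esub> u' \<in> U" if "u \<in> U" "u' \<in> U" for u u'
    using that S_in_U by (auto simp: U_def S_mult)
qed

text \<open>
  \<open>S a b\<close> translates the point with coordinates \<open>(c, d)\<close> to \<open>(a
  + c, b + d + \<theta> a c)\<close>, and this can be solved uniquely for \<open>(a, b)\<close>.
\<close>

lemma U_regular:
  assumes "x \<in> ovoid - {\<omega>}"
  shows "bij_betw (\<lambda>u. act u x) U (ovoid - {\<omega>})"
proof -
  obtain c d where x: "x = vec_line (affine_point c d)"
    using assms ovoid_iff[of x] by auto
  show ?thesis
    unfolding bij_betw_def
  proof
    show "inj_on (\<lambda>u. act u x) U"
    proof (rule inj_onI)
      fix u u' assume uu: "u \<in> U" "u' \<in> U" "act u x = act u' x"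
      obtain a b where u: "u = S a b" using uu(1) by (auto simp: U_def)
      obtain a' b' where u': "u' = S a' b'" using uu(2) by (auto simp: U_def)
      have e: "a + c = a' + c \<and> b + d + \<theta> a * c = b' + d + \<theta> a' * c"
        using uu(3) unfolding u u' x act_S_affine affine_point_inj .
      then have "a = a'" by simp
      moreover from this have "b = b'" using e by simp
      ultimately show "u = u'" unfolding u u' by simp
    qed
    show "(\<lambda>u. act u x) ` U = ovoid - {\<omega>}"
    proof (intro equalityI subsetI)
      fix y assume "y \<in> (\<lambda>u. act u x) ` U"
      then obtain a b where "y = act (S a b) x" by (auto simp: U_def)
      then have "y = vec_line (affine_point (a + c) (b + d + \<theta> a * c))" by (simp only: x act_S_affine)
      then show "y \<in> ovoid - {\<omega>}" by (simp add: affine_in_ovoid affine_point_neq_infinity)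
    next
      fix y assume "y \<in> ovoid - {\<omega>}"
      then obtain a b where y: "y = vec_line (affine_point a b)"
        using ovoid_iff[of y] by auto
      have "y = act (S (a + c) (b + d + \<theta> (a + c) * c)) x"
        unfolding x y act_S_affine affine_point_inj by (simp add: char2_normalize)
      then show "y \<in> (\<lambda>u. act u x) ` U" by (rule image_eqI) (rule S_in_U)
    qed
  qed
qed

text \<open>
  The bound \<open>card H \<le> 4q\<close> for odd order is incompatible with transitivity on
  \<open>q\<^sup>2 + 1\<close> points.
\<close>

theorem not_property_I:
  assumes two: "(2::'k::field) = 0" and large: "card (UNIV :: 'q set) > 4"
  shows "\<not> property_I TYPE('k) G"
proof
  assume "property_I TYPE('k) G"
  then have "\<exists>H. subgroup H G \<and> property_I_wrt TYPE('k) G H" by (simp only: property_I_def)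
  then obtain H where H: "subgroup H G" and I: "property_I_wrt TYPE('k) G H" by (elim exE conjE)
  interpret H: subgroup H G by (fact H)
  have "odd (card H)"
  proof
    assume "even (card H)"
    then have "of_nat (card H) = (0::'k)" using two by (auto elim!: evenE)
    with G.property_I_wrt_imp_card_nonzero[OF H finite_G I] show False ..
  qed
  from odd_subgroup_card[OF H this] have small: "card H \<le> 4 * card (UNIV :: 'q set)" .
  let ?q = "card (UNIV :: 'q set)"
  have inf: "\<omega> \<in> ovoid" by (simp add: ovoid_iff)
  have "even ?q" unfolding card_field by simp
  then have odd: "odd (card ovoid)" by (simp add: card_ovoid)
  have "\<exists>h\<in>H. act h \<omega> = y" if y: "y \<in> ovoid" for y
  proof (rule G.property_I_wrt_imp_transitive[OF H finite_G I two card_ovoid(2) odd])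
    show "act g x \<in> ovoid" if g: "g \<in> carrier G" and x: "x \<in> ovoid" for g x
    proof -
      obtain h where h: "h \<in> carrier G" "x = act h \<omega>" using x unfolding ovoid_def by (rule imageE)
      have "act g x = act (g \<otimes>\<^bsub>G\<^esub> h) \<omega>"
        using g h by (simp add: act_mult G_carrier_mat infinity_carrier)
      then show ?thesis unfolding ovoid_def by (rule image_eqI) (rule G.m_closed[OF g h(1)])
    qed
    show "act \<one>\<^bsub>G\<^esub> x = x" if "x \<in> ovoid" for x using act_one[OF ovoid_carrier[OF that]] by simp
    show "act (g \<otimes>\<^bsub>G\<^esub> h) x = act g (act h x)" if "g \<in> carrier G" "h \<in> carrier G" "x \<in> ovoid" for g h x
      using that by (simp add: act_mult G_carrier_mat ovoid_carrier)
    show "\<exists>g\<in>carrier G. act g \<omega> = x" if "x \<in> ovoid" for x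
      using that by (auto simp: ovoid_def)
    show "act u \<omega> = \<omega>" if "u \<in> U" for u using that by (auto simp: U_def act_S_infinity)
  qed (fact inf subgroup_U U_regular y)+
  then have "ovoid \<subseteq> (\<lambda>h. act h \<omega>) ` H" by auto
  moreover have "finite H" by (rule finite_subset[OF H.subset finite_G])
  ultimately have "card ovoid \<le> card H" by (rule surj_card_le[rotated])
  with small have "?q * ?q + 1 \<le> 4 * ?q" by (simp add: card_ovoid power2_eq_square)
  moreover have "4 * ?q \<le> ?q * ?q" using large by simp
  ultimately show False by simp
qed

end

theorem lemma6p2:
  fixes f :: nat
  assumes "CHAR('k::alg_closed_field) = 2"
    and "card (UNIV :: 'q::{field, finite} set) = 2 ^ (2 * f + 1)"
    and "2 ^ (2 * f + 1) \<ge> (8::nat)"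
  shows "\<not> property_I TYPE('k) (suzuki_group f TYPE('q))"
proof -
  interpret suzuki_field f "TYPE('q)"
    using assms(2) by unfold_locales
  have "(2::'k) = 0" using of_nat_CHAR[where 'a = 'k] assms(1) by simp
  then show ?thesis by (rule not_property_I) (use assms(2,3) in simp)
qed

end
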